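(* There exists a one-sided property tester for cycle-freeness in the bounded-degree graph model whose running time is $\sqrt{n}\cdot \mathrm{poly}(d\,\varepsilon^{-1}\log n)$. That is: given query access to an $n$-vertex graph $G$ of maximum degree at most $d$ and a parameter $0<\varepsilon<1$, the tester always accepts $G$ (with probability $1$) if $G$ is a forest; if $G$ is $\varepsilon$-far from being a forest, it rejects $G$ with probability at least $2/3$. Moreover, whenever the tester rejects $G$, it outputs a certificate in the form of a cycle of $G$ of length $\mathrm{poly}(\varepsilon^{-1}\log n)$.
   Context: Bounded-degree graph model: the input is a simple undirected graph $G$ on $n$ vertices without self-loops, with maximum degree at most $d$ (a constant), represented by adjacency lists; the algorithm may query, for any vertex $v$ and index $i\le d$, the $i$-th neighbor of $v$. $G$ is $\varepsilon$-far from being a forest (cycle-free) if more than $\varepsilon n d$ edges of $G$ must be changed for it to become a forest. A one-sided property tester accepts every graph having the property with probability $1$. *)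

theory Defs
  imports
    "HOL-Probability.Probability"
    "HOL-Computational_Algebra.Polynomial"
    "HOL-Library.Log_Nat"
begin

text \<open>A graph on the vertex set \<open>{1..n}\<close> is given by its set of (two-element) edges.\<close>

definition simple_graph :: "nat \<Rightarrow> nat set set \<Rightarrow> bool" where
  "simple_graph n E \<longleftrightarrow> (\<forall>e\<in>E. \<exists>u\<in>{1..n}. \<exists>v\<in>{1..n}. u \<noteq> v \<and> e = {u, v})"

definition vertex_degree :: "nat set set \<Rightarrow> nat \<Rightarrow> nat" where
  "vertex_degree E v = card {e \<in> E. v \<in> e}"

definition is_cycle :: "nat set set \<Rightarrow> nat list \<Rightarrow> bool" where
  "is_cycle E c \<longleftrightarrow> length c \<ge> 3 \<and> distinct c \<and>
     (\<forall>i<length c. {c ! i, c ! (Suc i mod length c)} \<in> E)"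

definition forest :: "nat set set \<Rightarrow> bool" where
  "forest E \<longleftrightarrow> (\<nexists>c. is_cycle E c)"

text \<open>The distance to a forest is the number of edges that have to be inserted or deleted.\<close>

definition far_from_forest :: "nat \<Rightarrow> nat \<Rightarrow> real \<Rightarrow> nat set set \<Rightarrow> bool" where
  "far_from_forest n d \<epsilon> E \<longleftrightarrow>
     (\<forall>F. simple_graph n F \<and> forest F \<longrightarrow> real (card ((E - F) \<union> (F - E))) > \<epsilon> * real n * real d)"

text \<open>The order of each adjacency list is arbitrary. The values of \<open>adj\<close> outside the vertex
  set are irrelevant, since \<open>neighbour\<close> below never returns them.\<close>

definition adjacency_lists :: "nat \<Rightarrow> nat set set \<Rightarrow> (nat \<Rightarrow> nat list) \<Rightarrow> bool" where
  "adjacency_lists n E adj \<longleftrightarrow>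
     (\<forall>v\<in>{1..n}. distinct (adj v) \<and> set (adj v) = {u. {v, u} \<in> E})"

text \<open>The answer to the query ``what is the \<open>i\<close>-th neighbour of \<open>v\<close>?'', with indices starting
  from 1. As 0 is not a vertex, it serves as the answer ``there is none''.\<close>

definition neighbour :: "nat \<Rightarrow> (nat \<Rightarrow> nat list) \<Rightarrow> nat \<Rightarrow> nat \<Rightarrow> nat" where
  "neighbour n adj v i =
     (if v \<in> {1..n} \<and> i \<in> {1..length (adj v)} then adj v ! (i - 1) else 0)"

text \<open>The memory consists of named arrays of natural numbers; a program mentions only finitely
  many of them. Every operation is charged the number of binary digits of its operands (the
  logarithmic cost criterion), so large numbers and large addresses cannot be used for free.\<close>

type_synonym store = "string \<Rightarrow> nat \<Rightarrow> nat"

datatype binop = Add | Sub | Mul | Div | Mod | Less | Eq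

datatype expr =
    Const nat
  | Get string expr
  | Op binop expr expr

datatype com =
    Skip
  | Put string expr expr               \<comment> \<open>\<open>a[i] := e\<close>\<close>
  | Random string expr expr            \<comment> \<open>\<open>a[i] :=\<close> uniformly random element of \<open>{1..e}\<close>\<close>
  | Query string expr expr expr        \<comment> \<open>\<open>a[i] :=\<close> oracle answer to the query \<open>(v, j)\<close>\<close>
  | Seq com com
  | If expr com com
  | While expr com

fun apply_op :: "binop \<Rightarrow> nat \<Rightarrow> nat \<Rightarrow> nat" where
  "apply_op Add x y = x + y"
| "apply_op Sub x y = x - y"
| "apply_op Mul x y = x * y"
| "apply_op Div x y = x div y"
| "apply_op Mod x y = x mod y"
| "apply_op Less x y = of_bool (x < y)"
| "apply_op Eq x y = of_bool (x = y)"

fun evaluate :: "store \<Rightarrow> expr \<Rightarrow> nat" where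
  "evaluate s (Const k) = k"
| "evaluate s (Get a e) = s a (evaluate s e)"
| "evaluate s (Op f e1 e2) = apply_op f (evaluate s e1) (evaluate s e2)"

definition bits :: "nat \<Rightarrow> nat" where
  "bits k = max 1 (floorlog 2 k)"

fun expr_cost :: "store \<Rightarrow> expr \<Rightarrow> nat" where
  "expr_cost s (Const k) = bits k"
| "expr_cost s (Get a e) = expr_cost s e + bits (evaluate s e) + bits (s a (evaluate s e))"
| "expr_cost s (Op f e1 e2) = expr_cost s e1 + expr_cost s e2
     + bits (evaluate s e1) + bits (evaluate s e2)"

definition update :: "store \<Rightarrow> string \<Rightarrow> nat \<Rightarrow> nat \<Rightarrow> store" where
  "update s a i k = s(a := (s a)(i := k))"

text \<open>A configuration consists of the stack of commands still to be executed, the memory, and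
  the time spent so far. It is terminal if the stack is empty. Every step from a non-terminal
  configuration costs at least 1. The parameter \<open>q\<close> is the oracle.\<close>

type_synonym config = "com list \<times> store \<times> nat"

fun step :: "(nat \<Rightarrow> nat \<Rightarrow> nat) \<Rightarrow> config \<Rightarrow> config pmf" where
  "step q ([], s, t) = return_pmf ([], s, t)"
| "step q (Skip # K, s, t) = return_pmf (K, s, t + 1)"
| "step q (Put a i e # K, s, t) =
     return_pmf (K, update s a (evaluate s i) (evaluate s e),
       t + expr_cost s i + expr_cost s e + bits (evaluate s i) + bits (evaluate s e))"
| "step q (Random a i e # K, s, t) =
     map_pmf (\<lambda>r. (K, update s a (evaluate s i) r,
         t + expr_cost s i + expr_cost s e + bits (evaluate s i) + bits (evaluate s e)))
       (if evaluate s e = 0 then return_pmf 0 else pmf_of_set {1..evaluate s e})"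
| "step q (Query a i v j # K, s, t) =
     (let r = q (evaluate s v) (evaluate s j)
      in return_pmf (K, update s a (evaluate s i) r,
           t + expr_cost s i + expr_cost s v + expr_cost s j
             + bits (evaluate s i) + bits (evaluate s v) + bits (evaluate s j) + bits r))"
| "step q (Seq c1 c2 # K, s, t) = return_pmf (c1 # c2 # K, s, t + 1)"
| "step q (If b c1 c2 # K, s, t) =
     return_pmf ((if evaluate s b \<noteq> 0 then c1 else c2) # K, s, t + 1 + expr_cost s b)"
| "step q (While b c # K, s, t) =
     return_pmf (if evaluate s b \<noteq> 0 then c # While b c # K else K, s, t + 1 + expr_cost s b)"

fun steps :: "(nat \<Rightarrow> nat \<Rightarrow> nat) \<Rightarrow> nat \<Rightarrow> config \<Rightarrow> config pmf" where
  "steps q 0 C = return_pmf C"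
| "steps q (Suc k) C = bind_pmf (step q C) (steps q k)"

definition terminal :: "config \<Rightarrow> bool" where
  "terminal C \<longleftrightarrow> fst C = []"

definition time :: "config \<Rightarrow> nat" where
  "time C = snd (snd C)"

text \<open>A worst-case time bound, over all outcomes of the random choices.\<close>

definition runs_in_time :: "com \<Rightarrow> (nat \<Rightarrow> nat \<Rightarrow> nat) \<Rightarrow> store \<Rightarrow> real \<Rightarrow> bool" where
  "runs_in_time P q s T \<longleftrightarrow>
     (\<exists>k. \<forall>C\<in>set_pmf (steps q k ([P], s, 0)). terminal C \<and> real (time C) \<le> T)"

text \<open>The distribution of the final memory. It is meaningful only if the number of steps is bounded,
  in particular if some time bound holds in the sense of \<open>runs_in_time\<close>. The choice of the
  least bound is then immaterial, as terminal configurations do not change any more.\<close>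

definition final_store :: "com \<Rightarrow> (nat \<Rightarrow> nat \<Rightarrow> nat) \<Rightarrow> store \<Rightarrow> store pmf" where
  "final_store P q s =
     (let k = (LEAST k. \<forall>C\<in>set_pmf (steps q k ([P], s, 0)). terminal C)
      in map_pmf (\<lambda>C. fst (snd C)) (steps q k ([P], s, 0)))"

datatype verdict = Accept | Reject "nat list"

text \<open>The real parameter \<open>\<epsilon>\<close> is passed to the program as the integer \<open>\<lceil>1/\<epsilon>\<rceil>\<close>.\<close>

definition input :: "nat \<Rightarrow> nat \<Rightarrow> real \<Rightarrow> store" where
  "input n d \<epsilon> = (\<lambda>a i.
     if a = ''n'' \<and> i = 0 then n
     else if a = ''d'' \<and> i = 0 then d
     else if a = ''inv_eps'' \<and> i = 0 then nat \<lceil>1 / \<epsilon>\<rceil>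
     else 0)"

text \<open>A nonzero entry \<open>reject[0]\<close> means rejection. The certificate then has length \<open>cert[0]\<close> and
  is stored in \<open>cert[1]\<close>, \<open>cert[2]\<close>, \<dots>\<close>

definition verdict :: "store \<Rightarrow> verdict" where
  "verdict s = (if s ''reject'' 0 = 0 then Accept
     else Reject (map (s ''cert'') [1..<Suc (s ''cert'' 0)]))"

definition tester_output :: "com \<Rightarrow> nat \<Rightarrow> nat \<Rightarrow> real \<Rightarrow> (nat \<Rightarrow> nat list) \<Rightarrow> verdict pmf" where
  "tester_output P n d \<epsilon> adj =
     map_pmf verdict (final_store P (neighbour n adj) (input n d \<epsilon>))"

end

(*
  Non-backtracking random walks replace the reduction to bipartiteness testing.

  Discard the arcs that lead into a hanging tree with at most B arcs; this removes no arc of a cycle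
  and leaves few dead ends. The walk that moves to a uniformly random remaining neighbour, but never
  back, is stationary on the remaining arcs up to the dead ends. If the graph is far from being a
  forest, then either many vertices lie on short isolated cycles, which every walk closes, or a
  1/poly(1/eps) fraction of the arcs is branching. In the latter case many start arcs have walks of
  length poly(log n, 1/eps) that are individually so unlikely (each has probability much less than 1/n) that
  the end vertex cannot determine the walk. By the birthday paradox about sqrt n walks from such an
  arc contain two different walks with the same end, whose union contains a cycle.
*)
theory Submission
  imports Defs
begin

section \<open>Verification of deterministic programs\<close>

text \<open>Only averages over arcs are controlled: stationarity bounds the expected number of
  branchings and the probability of getting stuck, and these two bound the average probability of a
  light walk from below. Dead ends spoil stationarity once per step, so the discarded trees must
  outgrow the walks by a factor of order 1/eps; hence the search budget is fixed after the walk
  length. All numbers are drawn beforehand, uniformly from \<open>{1..n * fact d}\<close>. Reduced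
  modulo any possible number of choices they are exactly uniform, without rejection sampling, so the
  time bound is worst-case; and \<open>fact d\<close> has only poly(d) digits. For a fixed list of
  numbers the rest is deterministic and is verified list by list; probability concerns lists only.
  Comparing all pairs of walks would take time linear in \<open>n\<close>. A table holds the first
  walk for each end vertex, and comparing with it suffices because equality of walks is transitive.
  One-sided error is an invariant: the flag is set only together with a genuine cycle.\<close>

definition bounded_store :: "nat \<Rightarrow> store \<Rightarrow> bool" where
  "bounded_store b s \<longleftrightarrow> (\<forall>a i. s a i < 2 ^ b)"

text \<open>An upper bound, in units of \<open>b\<close> digits, for the length of a value when all
  memory entries have at most \<open>b\<close> digits. Sizes add up because multiplication is the
  worst operation; a constant is charged generously, by \<open>k < 2 ^ Suc k\<close>.\<close>

fun value_size :: "expr \<Rightarrow> nat" where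
  "value_size (Const k) = Suc k"
| "value_size (Get a e) = 1"
| "value_size (Op f e1 e2) = value_size e1 + value_size e2"

fun expr_weight :: "expr \<Rightarrow> nat" where
  "expr_weight (Const k) = Suc k"
| "expr_weight (Get a e) = expr_weight e + value_size e + 1"
| "expr_weight (Op f e1 e2) = expr_weight e1 + expr_weight e2 + value_size e1 + value_size e2"

text \<open>The weight of a compound command dominates those of its parts, so that one number bounds
  each single step of a run; how many steps there are is counted separately by
  \<open>wp\<close>.\<close>

fun com_weight :: "com \<Rightarrow> nat" where
  "com_weight Skip = 1"
| "com_weight (Put a i e) = expr_weight i + expr_weight e + value_size i + value_size e"
| "com_weight (Random a i e) = expr_weight i + expr_weight e + value_size i + value_size e"
| "com_weight (Query a i v j) = expr_weight i + expr_weight v + expr_weight j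
     + value_size i + value_size v + value_size j + 1"
| "com_weight (Seq c1 c2) = 1 + com_weight c1 + com_weight c2"
| "com_weight (If e c1 c2) = 1 + expr_weight e + com_weight c1 + com_weight c2"
| "com_weight (While e c) = 1 + expr_weight e + com_weight c"

lemma value_size_pos: "0 < value_size e"
  by (induction e) auto

lemma bits_le: "x < 2 ^ p \<Longrightarrow> 0 < p \<Longrightarrow> bits x \<le> p"
  unfolding bits_def by (auto simp: floorlog_le_iff)

lemma evaluate_less:
  assumes "bounded_store b s" "0 < b"
  shows "evaluate s e < 2 ^ (value_size e * b)"
proof (induction e)
  case (Const k)
  have "k < 2 ^ (Suc k)"
    by (meson less_exp less_SucI lessI order_less_trans)
  also have "\<dots> \<le> (2::nat) ^ (Suc k * b)"
    by (rule power_increasing) (use assms(2) mult_le_mono2[of 1 b "Suc k"] in auto)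
  finally show ?case by simp
next
  case (Get a e)
  then show ?case using assms by (simp add: bounded_store_def)
next
  case (Op f e1 e2)
  let ?p = "value_size e1 * b" and ?q = "value_size e2 * b"
  let ?x = "evaluate s e1" and ?y = "evaluate s e2"
  have pq: "0 < ?p" "0 < ?q" using assms value_size_pos by auto
  have p2: "(2::nat) \<le> 2 ^ ?p" "(2::nat) \<le> 2 ^ ?q"
    using power_increasing[of 1 ?p "2::nat"] power_increasing[of 1 ?q "2::nat"] pq by auto
  \<comment> \<open>For two numbers that are at least 2 the sum is at most the product; this lets
    \<open>Add\<close> share the bound of \<open>Mul\<close>.\<close>
  have prod: "(2::nat) ^ ?p + 2 ^ ?q \<le> 2 ^ ?p * 2 ^ ?q"
  proof -
    obtain u v where uv: "(2::nat) ^ ?p = 2 + u" "(2::nat) ^ ?q = 2 + v"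
      using p2 by (metis le_Suc_ex)
    show ?thesis unfolding uv by (simp add: algebra_simps)
  qed
  have le: "(2::nat) ^ ?p \<le> 2 ^ ?p * 2 ^ ?q" by simp
  have "apply_op f ?x ?y < 2 ^ ?p * 2 ^ ?q"
  proof (cases f)
    case Add
    then show ?thesis using Op prod by simp
  next
    case Mul
    have "?x * ?y < 2 ^ ?p * 2 ^ ?q"
      using Op by (intro mult_strict_mono) auto
    with Mul show ?thesis by simp
  next
    case Sub
    have "?x - ?y \<le> ?x" by simp
    then have "?x - ?y < 2 ^ ?p * 2 ^ ?q" using Op(1) le by linarith
    then show ?thesis using Sub by (simp only: apply_op.simps)
  next
    case Div
    have "?x div ?y \<le> ?x" by simp
    then have "?x div ?y < 2 ^ ?p * 2 ^ ?q" using Op(1) le by linarith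
    then show ?thesis using Div by (simp only: apply_op.simps)
  next
    case Mod
    have "?x mod ?y \<le> ?x" by simp
    then have "?x mod ?y < 2 ^ ?p * 2 ^ ?q" using Op(1) le by linarith
    then show ?thesis using Mod by (simp only: apply_op.simps)
  next
    case Less
    have "(1::nat) < 2 ^ ?p * 2 ^ ?q" using p2 le by linarith
    then show ?thesis using Less by (auto simp only: apply_op.simps of_bool_def split: if_splits)
  next
    case Eq
    have "(1::nat) < 2 ^ ?p * 2 ^ ?q" using p2 le by linarith
    then show ?thesis using Eq by (auto simp only: apply_op.simps of_bool_def split: if_splits)
  qed
  then show ?case by (simp add: power_add add_mult_distrib)
qed

lemma bits_evaluate_le:
  assumes "bounded_store b s" "0 < b"
  shows "bits (evaluate s e) \<le> value_size e * b"
  using evaluate_less[OF assms] value_size_pos[of e] assms(2) by (intro bits_le) auto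

lemma bits_entry_le:
  assumes "bounded_store b s" "0 < b"
  shows "bits (s a i) \<le> b"
  using assms by (intro bits_le) (auto simp: bounded_store_def)

lemma expr_cost_le:
  assumes "bounded_store b s" "0 < b"
  shows "expr_cost s e \<le> expr_weight e * b"
proof (induction e)
  case (Const k)
  show ?case using bits_evaluate_le[OF assms, of "Const k"] by simp
next
  case (Get a e)
  then show ?case
    using bits_evaluate_le[OF assms, of e] bits_entry_le[OF assms, of a "evaluate s e"]
    by (simp add: algebra_simps)
next
  case (Op f e1 e2)
  then show ?case
    using bits_evaluate_le[OF assms, of e1] bits_evaluate_le[OF assms, of e2]
    by (simp add: algebra_simps)
qed

section \<open>A predicate transformer with step counts and its soundness\<close>

fun mods :: "com \<Rightarrow> string set" where
  "mods Skip = {}"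
| "mods (Put a i e) = {a}"
| "mods (Random a i e) = {a}"
| "mods (Query a i v j) = {a}"
| "mods (Seq c1 c2) = mods c1 \<union> mods c2"
| "mods (If e c1 c2) = mods c1 \<union> mods c2"
| "mods (While e c) = mods c"

text \<open>A total-correctness predicate transformer for programs that draw no random numbers. The
  postcondition also sees the number of steps: \<open>k\<close> counts those made so far. The loop invariant is
  indexed by a bound on the number of remaining iterations.\<close>

primrec wp :: "(nat \<Rightarrow> nat \<Rightarrow> nat) \<Rightarrow> nat \<Rightarrow> com \<Rightarrow> store \<Rightarrow> nat \<Rightarrow> (store \<Rightarrow> nat \<Rightarrow> bool) \<Rightarrow> bool" where
  "wp q b Skip s k R \<longleftrightarrow> R s (k + 1)"
| "wp q b (Put a i e) s k R \<longleftrightarrow>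
     evaluate s e < 2 ^ b \<and> R (update s a (evaluate s i) (evaluate s e)) (k + 1)"
| "wp q b (Random a i e) s k R \<longleftrightarrow> False"
| "wp q b (Query a i v j) s k R \<longleftrightarrow>
     q (evaluate s v) (evaluate s j) < 2 ^ b \<and>
     R (update s a (evaluate s i) (q (evaluate s v) (evaluate s j))) (k + 1)"
| "wp q b (Seq c1 c2) s k R \<longleftrightarrow> wp q b c1 s (k + 1) (\<lambda>s' k'. wp q b c2 s' k' R)"
| "wp q b (If e c1 c2) s k R \<longleftrightarrow>
     (if evaluate s e \<noteq> 0 then wp q b c1 s (k + 1) R else wp q b c2 s (k + 1) R)"
| "wp q b (While e c) s k R \<longleftrightarrow>
     (\<exists>(I :: nat \<Rightarrow> store \<Rightarrow> nat \<Rightarrow> bool) m. I m s k \<and>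
       (\<forall>j s k. I j s k \<longrightarrow>
         (if evaluate s e \<noteq> 0 then wp q b c s (k + 1) (\<lambda>s' k'. \<exists>j'<j. I j' s' k')
          else R s (k + 1))))"

lemma wp_mono:
  "wp q b c s k R \<Longrightarrow> (\<And>s' k'. R s' k' \<Longrightarrow> R' s' k') \<Longrightarrow> wp q b c s k R'"
proof (induction c arbitrary: s k R R')
  case (Seq c1 c2)
  have *: "wp q b c2 s' k' R \<Longrightarrow> wp q b c2 s' k' R'" for s' k'
    using Seq.IH(2) Seq.prems(2) by blast
  show ?case using Seq.IH(1)[where R = "\<lambda>s' k'. wp q b c2 s' k' R"] Seq.prems(1) * by auto
next
  case (If e c1 c2)
  have "wp q b c1 s (k+1) R \<Longrightarrow> wp q b c1 s (k+1) R'" "wp q b c2 s (k+1) R \<Longrightarrow> wp q b c2 s (k+1) R'"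
    using If.IH If.prems(2) by blast+
  then show ?case using If.prems(1) by (auto split: if_splits)
next
  case (While e c)
  from While.prems(1) obtain I :: "nat \<Rightarrow> store \<Rightarrow> nat \<Rightarrow> bool" and m where I': "I m s k \<and> (\<forall>j s k. I j s k \<longrightarrow>
       (if evaluate s e \<noteq> 0 then wp q b c s (k + 1) (\<lambda>s' k'. \<exists>j'<j. I j' s' k')
          else R s (k + 1)))"
    unfolding wp.simps by (elim exE) (rule that)
  have I1: "I m s k" using I' by (rule conjunct1)
  have I2: "if evaluate s e \<noteq> 0 then wp q b c s (k + 1) (\<lambda>s' k'. \<exists>j'<j. I j' s' k')
          else R s (k + 1)" if "I j s k" for j s k
    using I' that by blast
  note I = I1 I2
  show ?case unfolding wp.simps
  proof (rule exI[of _ I], rule exI[of _ m], intro conjI allI impI)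
    fix j s k assume "I j s k"
    from I2[OF this] show "if evaluate s e \<noteq> 0 then wp q b c s (k + 1) (\<lambda>s' k'. \<exists>j'<j. I j' s' k')
          else R' s (k + 1)" using While.prems(2) by (auto split: if_splits)
  qed (rule I1)
qed auto

lemma bounded_store_update: "bounded_store b s \<Longrightarrow> v < 2 ^ b \<Longrightarrow> bounded_store b (update s a i v)"
  by (auto simp: bounded_store_def update_def)

text \<open>Every assignment checks the bound \<open>2 ^ b\<close> and names the only array it
  changes. So boundedness and the frame come for free with every postcondition, and the invariants
  of concrete loops need not mention them.\<close>

lemma wp_frame:
  assumes "wp q b c s k R" "bounded_store b s"
  shows "wp q b c s k (\<lambda>s' k'. R s' k' \<and> bounded_store b s' \<and> (\<forall>a. a \<notin> mods c \<longrightarrow> s' a = s a))"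
  using assms
proof (induction c arbitrary: s k R)
  case (Seq c1 c2)
  show ?case unfolding wp.simps
  proof (rule wp_mono[OF Seq.IH(1)])
    show "wp q b c1 s (k + 1) (\<lambda>s' k'. wp q b c2 s' k' R)" using Seq.prems by simp
    show "bounded_store b s" by fact
    fix s' k' assume *: "wp q b c2 s' k' R \<and> bounded_store b s' \<and> (\<forall>a. a \<notin> mods c1 \<longrightarrow> s' a = s a)"
    show "wp q b c2 s' k' (\<lambda>s' k'. R s' k' \<and> bounded_store b s' \<and> (\<forall>a. a \<notin> mods (Seq c1 c2) \<longrightarrow> s' a = s a))"
      by (rule wp_mono[OF Seq.IH(2)[where R = R]]) (use * in auto)
  qed
next
  case (If e c1 c2)
  show ?case
  proof (cases "evaluate s e \<noteq> 0")
    case True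
    have "wp q b c1 s (k+1) R" using If.prems(1) True by (simp only: wp.simps if_True not_False_eq_True simp_thms)
    then have "wp q b c1 s (k+1) (\<lambda>s' k'. R s' k' \<and> bounded_store b s' \<and> (\<forall>a. a \<notin> mods (If e c1 c2) \<longrightarrow> s' a = s a))"
      by (rule wp_mono[OF If.IH(1)[where R = R, OF _ If.prems(2)]]) simp
    then show ?thesis using True by (simp only: wp.simps if_True not_False_eq_True simp_thms)
  next
    case False
    have "wp q b c2 s (k+1) R" using If.prems(1) False by (simp only: wp.simps if_False simp_thms)
    then have "wp q b c2 s (k+1) (\<lambda>s' k'. R s' k' \<and> bounded_store b s' \<and> (\<forall>a. a \<notin> mods (If e c1 c2) \<longrightarrow> s' a = s a))"
      by (rule wp_mono[OF If.IH(2)[where R = R, OF _ If.prems(2)]]) simp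
    then show ?thesis using False by (simp only: wp.simps if_False simp_thms)
  qed
next
  case (While e c)
  from While.prems(1) obtain I :: "nat \<Rightarrow> store \<Rightarrow> nat \<Rightarrow> bool" and m where I': "I m s k \<and> (\<forall>j s k. I j s k \<longrightarrow>
       (if evaluate s e \<noteq> 0 then wp q b c s (k + 1) (\<lambda>s' k'. \<exists>j'<j. I j' s' k')
          else R s (k + 1)))"
    unfolding wp.simps by (elim exE) (rule that)
  have I1: "I m s k" using I' by (rule conjunct1)
  have I2: "if evaluate s e \<noteq> 0 then wp q b c s (k + 1) (\<lambda>s' k'. \<exists>j'<j. I j' s' k')
          else R s (k + 1)" if "I j s k" for j s k
    using I' that by blast
  note I = I1 I2
  show ?case unfolding wp.simps
  \<comment> \<open>The frame is stated relative to the store before the loop, so that it composes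
    over the iterations.\<close>
  proof (rule exI[of _ "\<lambda>j s' k'. I j s' k' \<and> bounded_store b s' \<and> (\<forall>a. a \<notin> mods c \<longrightarrow> s' a = s a)"],
      rule exI[of _ m], intro conjI allI impI)
    fix j s' k'
    assume *: "I j s' k' \<and> bounded_store b s' \<and> (\<forall>a. a \<notin> mods c \<longrightarrow> s' a = s a)"
    show "if evaluate s' e \<noteq> 0
          then wp q b c s' (k' + 1) (\<lambda>s' k'. \<exists>j'<j. I j' s' k' \<and> bounded_store b s' \<and> (\<forall>a. a \<notin> mods c \<longrightarrow> s' a = s a))
          else R s' (k' + 1) \<and> bounded_store b s' \<and> (\<forall>a. a \<notin> mods (While e c) \<longrightarrow> s' a = s a)"
    proof (cases "evaluate s' e \<noteq> 0")
      case True
      with I(2)[of j s' k'] * have "wp q b c s' (k' + 1) (\<lambda>s' k'. \<exists>j'<j. I j' s' k')" by auto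
      then have "wp q b c s' (k' + 1) (\<lambda>s' k'. \<exists>j'<j. I j' s' k' \<and> bounded_store b s' \<and> (\<forall>a. a \<notin> mods c \<longrightarrow> s' a = s a))"
        by (rule wp_mono[OF While.IH[where R = "\<lambda>s' k'. \<exists>j'<j. I j' s' k'"]]) (use * in auto)
      then show ?thesis using True by simp
    next
      case False
      with I(2)[of j s' k'] * show ?thesis by auto
    qed
  qed (use I While.prems in auto)
qed (auto simp: update_def bounded_store_def)

text \<open>Every step costs at most \<open>com_weight c * b\<close>, since all numbers have at most \<open>b\<close> digits.\<close>

definition runs :: "(nat \<Rightarrow> nat \<Rightarrow> nat) \<Rightarrow> nat \<Rightarrow> com \<Rightarrow> store \<Rightarrow> nat \<Rightarrow> store \<Rightarrow> bool" where
  "runs q T c s N s' \<longleftrightarrow> (\<exists>t'\<le>N * T. \<forall>K t. steps q N (c # K, s, t) = return_pmf (K, s', t + t'))"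

lemma steps_add: "steps q (m + k) C = bind_pmf (steps q m C) (steps q k)"
proof (induction m arbitrary: C)
  case (Suc m)
  have "steps q (m + k) = (\<lambda>C. bind_pmf (steps q m C) (steps q k))" using Suc.IH by blast
  then show ?case by (simp add: bind_assoc_pmf)
qed (simp add: bind_return_pmf)

lemma runs_mono: "runs q T c s N s' \<Longrightarrow> T \<le> T' \<Longrightarrow> runs q T' c s N s'"
  unfolding runs_def by (meson mult_le_mono2 order_trans)

lemma runsE:
  assumes "runs q T c s N s'" "T \<le> T'"
  obtains t' where "t' \<le> N * T'" "\<And>K t. steps q N (c # K, s, t) = return_pmf (K, s', t + t')"
  using runs_mono[OF assms] unfolding runs_def by blast

text \<open>The time is bounded by the number of steps times the maximal cost of a step, and
  \<open>runs\<close> is monotone in the latter. Runs of subcommands therefore compose once their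
  bounds are raised to the weight of the compound command.\<close>

lemma wp_sound:
  assumes "wp q b c s k R" "bounded_store b s" "0 < b"
  shows "\<exists>N s'. runs q (com_weight c * b) c s N s' \<and> bounded_store b s' \<and> R s' (k + N)"
  using assms
proof (induction c arbitrary: s k R)
  case Skip
  have "runs q (com_weight Skip * b) Skip s 1 s"
    using Skip.prems by (auto simp: runs_def bind_return_pmf bind_return_pmf')
  with Skip.prems show ?case by force
next
  case (Put a i e)
  have "expr_cost s i + expr_cost s e + bits (evaluate s i) + bits (evaluate s e) \<le> com_weight (Put a i e) * b"
    using expr_cost_le[OF Put.prems(2,3), of i] expr_cost_le[OF Put.prems(2,3), of e]
      bits_evaluate_le[OF Put.prems(2,3), of i] bits_evaluate_le[OF Put.prems(2,3), of e]
    by (simp add: algebra_simps)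
  then have "runs q (com_weight (Put a i e) * b) (Put a i e) s 1 (update s a (evaluate s i) (evaluate s e))"
    unfolding runs_def
    by (intro exI[of _ "expr_cost s i + expr_cost s e + bits (evaluate s i) + bits (evaluate s e)"])
       (auto simp: bind_return_pmf bind_return_pmf' add.assoc)
  with Put.prems bounded_store_update show ?case by force
next
  case (Random a i e)
  then show ?case by simp
next
  case (Query a i v j)
  let ?r = "q (evaluate s v) (evaluate s j)"
  let ?t = "expr_cost s i + expr_cost s v + expr_cost s j + bits (evaluate s i) + bits (evaluate s v)
     + bits (evaluate s j) + bits ?r"
  have "?r < 2 ^ b" using Query.prems by simp
  then have "bits ?r \<le> b" using Query.prems bits_le by blast
  then have "?t \<le> com_weight (Query a i v j) * b"
    using expr_cost_le[OF Query.prems(2,3), of i] expr_cost_le[OF Query.prems(2,3), of v]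
      expr_cost_le[OF Query.prems(2,3), of j] bits_evaluate_le[OF Query.prems(2,3), of i]
      bits_evaluate_le[OF Query.prems(2,3), of v] bits_evaluate_le[OF Query.prems(2,3), of j]
    by (simp add: algebra_simps)
  then have "runs q (com_weight (Query a i v j) * b) (Query a i v j) s 1 (update s a (evaluate s i) ?r)"
    unfolding runs_def
    by (intro exI[of _ ?t]) (auto simp: bind_return_pmf bind_return_pmf' add.assoc Let_def)
  with Query.prems bounded_store_update show ?case by force
next
  case (Seq c1 c2)
  let ?w = "com_weight (Seq c1 c2) * b"
  from Seq.IH(1)[of s "k+1" "\<lambda>s' k'. wp q b c2 s' k' R"] Seq.prems obtain N1 s1 where
    1: "runs q (com_weight c1 * b) c1 s N1 s1" "bounded_store b s1" "wp q b c2 s1 (k + 1 + N1) R" by auto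
  from Seq.IH(2)[OF 1(3,2)] Seq.prems obtain N2 s2 where
    2: "runs q (com_weight c2 * b) c2 s1 N2 s2" "bounded_store b s2" "R s2 (k + 1 + N1 + N2)" by auto
  obtain t1 where t1: "t1 \<le> N1 * ?w"
    "\<And>K t. steps q N1 (c1 # K, s, t) = return_pmf (K, s1, t + t1)"
    by (rule runsE[OF 1(1), of ?w]) (auto simp: add_mult_distrib)
  obtain t2 where t2: "t2 \<le> N2 * ?w"
    "\<And>K t. steps q N2 (c2 # K, s1, t) = return_pmf (K, s2, t + t2)"
    by (rule runsE[OF 2(1), of ?w]) (auto simp: add_mult_distrib)
  have "steps q (1 + N1 + N2) (Seq c1 c2 # K, s, t) = return_pmf (K, s2, t + (1 + t1 + t2))" for K t
    by (simp only: steps_add) (simp add: t1(2) t2(2) bind_return_pmf add.assoc)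
  moreover have "1 + t1 + t2 \<le> (1 + N1 + N2) * ?w"
  proof -
    have "1 \<le> ?w" using Seq.prems by simp
    then show ?thesis using t1(1) t2(1) unfolding add_mult_distrib by linarith
  qed
  ultimately have "runs q ?w (Seq c1 c2) s (1 + N1 + N2) s2" unfolding runs_def by blast
  moreover have "R s2 (k + (1 + N1 + N2))" using 2(3) by (simp add: ac_simps)
  ultimately show ?case using 2(2) by blast
next
  case (If e c1 c2)
  let ?w = "com_weight (If e c1 c2) * b"
  let ?c = "if evaluate s e \<noteq> 0 then c1 else c2"
  have "\<exists>N s'. runs q (com_weight ?c * b) ?c s N s' \<and> bounded_store b s' \<and> R s' (k + 1 + N)"
    using If.IH(1)[of s "k + 1" R] If.IH(2)[of s "k + 1" R] If.prems by (simp split: if_splits)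
  then obtain N s' where N: "runs q (com_weight ?c * b) ?c s N s'" "bounded_store b s'" "R s' (k + 1 + N)"
    by blast
  have wle: "com_weight ?c * b \<le> ?w" by (auto simp: add_mult_distrib)
  obtain t1 where t1: "t1 \<le> N * ?w"
    "\<And>K t. steps q N (?c # K, s, t) = return_pmf (K, s', t + t1)"
    using N(1) wle by (rule runsE) blast
  have "steps q (1 + N) (If e c1 c2 # K, s, t) = return_pmf (K, s', t + (1 + expr_cost s e + t1))" for K t
    using t1(2)[of K "t + 1 + expr_cost s e"]
    by (simp only: steps_add) (simp add: bind_return_pmf add.assoc)
  moreover have "1 + expr_cost s e + t1 \<le> (1 + N) * ?w"
  proof -
    have "1 + expr_cost s e \<le> ?w"
      using expr_cost_le[OF If.prems(2,3), of e] If.prems(3) by (simp add: algebra_simps)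
    then show ?thesis using t1(1) unfolding add_mult_distrib by linarith
  qed
  ultimately have "runs q ?w (If e c1 c2) s (1 + N) s'" unfolding runs_def by blast
  moreover have "R s' (k + (1 + N))" using N(3) by (simp add: ac_simps)
  ultimately show ?case using N(2) by blast
next
  case (While e c)
  let ?w = "com_weight (While e c) * b"
  from While.prems(1) obtain I :: "nat \<Rightarrow> store \<Rightarrow> nat \<Rightarrow> bool" and m where I': "I m s k \<and> (\<forall>j s k. I j s k \<longrightarrow>
       (if evaluate s e \<noteq> 0 then wp q b c s (k + 1) (\<lambda>s' k'. \<exists>j'<j. I j' s' k')
          else R s (k + 1)))"
    unfolding wp.simps by (elim exE) (rule that)
  have I1: "I m s k" using I' by (rule conjunct1)
  have I2: "if evaluate s e \<noteq> 0 then wp q b c s (k + 1) (\<lambda>s' k'. \<exists>j'<j. I j' s' k')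
          else R s (k + 1)" if "I j s k" for j s k
    using I' that by blast
  note I = I1 I2
  \<comment> \<open>The index of the invariant strictly decreases with each iteration, so strong
    induction on it yields termination.\<close>
  have "I j s k \<Longrightarrow> bounded_store b s \<Longrightarrow>
    \<exists>N s'. runs q ?w (While e c) s N s' \<and> bounded_store b s' \<and> R s' (k + N)" for j s k
  proof (induction j arbitrary: s k rule: less_induct)
    case (less j)
    have w1: "1 + expr_cost s e \<le> ?w"
      using expr_cost_le[OF less.prems(2) While.prems(3), of e] While.prems(3) by (simp add: algebra_simps)
    show ?case
    proof (cases "evaluate s e \<noteq> 0")
      case True
      with I(2)[OF less.prems(1)] have "wp q b c s (k + 1) (\<lambda>s' k'. \<exists>j'<j. I j' s' k')" by simp
      from While.IH[OF this less.prems(2) While.prems(3)] obtain N1 s1 j' where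
        1: "runs q (com_weight c * b) c s N1 s1" "bounded_store b s1" "j' < j" "I j' s1 (k + 1 + N1)" by blast
      from less.IH[OF 1(3,4,2)] obtain N2 s2 where
        2: "runs q ?w (While e c) s1 N2 s2" "bounded_store b s2" "R s2 (k + 1 + N1 + N2)" by blast
      have wle: "com_weight c * b \<le> ?w" by (auto simp: add_mult_distrib)
      obtain t1 where t1: "t1 \<le> N1 * ?w"
        "\<And>K t. steps q N1 (c # K, s, t) = return_pmf (K, s1, t + t1)"
    using 1(1) wle by (rule runsE) blast
      obtain t2 where t2: "t2 \<le> N2 * ?w"
        "\<And>K t. steps q N2 (While e c # K, s1, t) = return_pmf (K, s2, t + t2)"
    by (rule runsE[OF 2(1), of ?w]) (auto simp: add_mult_distrib)
      have "steps q (1 + N1 + N2) (While e c # K, s, t)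
          = return_pmf (K, s2, t + (1 + expr_cost s e + t1 + t2))" for K t
        using True
        by (simp only: steps_add) (simp add: t1(2) t2(2) bind_return_pmf add.assoc)
      moreover have "1 + expr_cost s e + t1 + t2 \<le> (1 + N1 + N2) * ?w" using t1(1) t2(1) w1 unfolding add_mult_distrib by linarith
      ultimately have "runs q ?w (While e c) s (1 + N1 + N2) s2" unfolding runs_def by blast
      moreover have "R s2 (k + (1 + N1 + N2))" using 2(3) by (simp add: ac_simps)
      ultimately show ?thesis using 2(2) by blast
    next
      case False
      have "runs q ?w (While e c) s 1 s" unfolding runs_def
        by (rule exI[of _ "1 + expr_cost s e"])
           (use w1 False in \<open>auto simp: bind_return_pmf bind_return_pmf' add.assoc\<close>)
      moreover have "R s (k + 1)" using I(2)[OF less.prems(1)] False by simp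
      ultimately show ?thesis using less.prems(2) by blast
    qed
  qed
  from this[OF I(1) While.prems(2)] show ?case .
qed

section \<open>Program syntax and a rule for counting loops\<close>

abbreviation V :: "string \<Rightarrow> expr" where "V x \<equiv> Get x (Const 0)"

abbreviation Assign :: "string \<Rightarrow> expr \<Rightarrow> com" where "Assign x e \<equiv> Put x (Const 0) e"

abbreviation seq_infix :: "com \<Rightarrow> com \<Rightarrow> com" (infixr ";;" 60) where "c1 ;; c2 \<equiv> Seq c1 c2"

abbreviation add_infix :: "expr \<Rightarrow> expr \<Rightarrow> expr" (infixl "\<oplus>" 65) where "x \<oplus> y \<equiv> Op Add x y"

abbreviation sub_infix :: "expr \<Rightarrow> expr \<Rightarrow> expr" (infixl "\<ominus>" 65) where "x \<ominus> y \<equiv> Op Sub x y"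

abbreviation mul_infix :: "expr \<Rightarrow> expr \<Rightarrow> expr" (infixl "\<otimes>" 70) where "x \<otimes> y \<equiv> Op Mul x y"

definition For :: "string \<Rightarrow> expr \<Rightarrow> com \<Rightarrow> com" where
  "For i e c = (Assign i (Const 0) ;; While (Op Less (V i) e) (c ;; Assign i (V i \<oplus> Const 1)))"

lemma mods_For [simp]: "mods (For i e c) = insert i (mods c)"
  by (simp add: For_def)

text \<open>One iteration costs \<open>N + 3\<close> steps: loop test, sequencing and increment
  besides the body. Entry takes two steps and the final test one, whence the trailing 3. The
  invariant \<open>I j\<close> refers to the store after the counter was set to \<open>j\<close>;
  the bound \<open>e\<close> is evaluated anew each time, so its stability is a premise.\<close>

lemma wp_For:
  assumes bnd: "bounded_store b s" "m < 2 ^ b" and im: "i \<notin> mods c"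
    and init: "I 0 (update s i 0 0)"
    and ev: "\<And>j s1. j \<le> m \<Longrightarrow> (\<forall>a. a \<notin> insert i (mods c) \<longrightarrow> s1 a = s a) \<Longrightarrow> s1 i 0 = j \<Longrightarrow> evaluate s1 e = m"
    and step: "\<And>j s1 k1. j < m \<Longrightarrow> (\<forall>a. a \<notin> insert i (mods c) \<longrightarrow> s1 a = s a) \<Longrightarrow> bounded_store b s1 \<Longrightarrow>
       s1 i 0 = j \<Longrightarrow> I j s1 \<Longrightarrow>
       wp q b c s1 k1 (\<lambda>s2 k2. k2 \<le> k1 + N \<and> I (Suc j) (update s2 i 0 (Suc j)))"
    and fin: "\<And>s1 k1. (\<forall>a. a \<notin> insert i (mods c) \<longrightarrow> s1 a = s a) \<Longrightarrow> bounded_store b s1 \<Longrightarrow>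
       I m s1 \<Longrightarrow> k1 \<le> k + m * (N + 3) + 3 \<Longrightarrow> R s1 k1"
  shows "wp q b (For i e c) s k R"
proof -
  define J where "J = (\<lambda>j' s1 k1. \<exists>j\<le>m. j' = m - j \<and> (\<forall>a. a \<notin> insert i (mods c) \<longrightarrow> s1 a = s a) \<and>
     bounded_store b s1 \<and> s1 i 0 = j \<and> I j s1 \<and> k1 \<le> k + 2 + j * (N + 3))"
  have "wp q b (While (Op Less (V i) e) (c ;; Assign i (V i \<oplus> Const 1))) (update s i 0 0) (k + 2) R"
    unfolding wp.simps
  proof (rule exI[of _ J], rule exI[of _ m], intro conjI allI impI)
    show "J m (update s i 0 0) (k + 2)"
      unfolding J_def using bnd init
      by (intro exI[of _ 0]) (auto simp: update_def bounded_store_def)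
    fix j' s1 k1 assume "J j' s1 k1"
    then obtain j where j: "j \<le> m" "j' = m - j" "\<forall>a. a \<notin> insert i (mods c) \<longrightarrow> s1 a = s a"
      "bounded_store b s1" "s1 i 0 = j" "I j s1" "k1 \<le> k + 2 + j * (N + 3)" unfolding J_def by blast
    have ev1: "evaluate s1 e = m" using ev j by blast
    show "if evaluate s1 (Op Less (V i) e) \<noteq> 0
       then wp q b c s1 (k1 + 1 + 1) (\<lambda>s' k'. evaluate s' (V i \<oplus> Const 1) < 2 ^ b \<and>
              (\<exists>j''<j'. J j'' (update s' i (evaluate s' (Const 0)) (evaluate s' (V i \<oplus> Const 1))) (k' + 1)))
       else R s1 (k1 + 1)"
    proof (cases "j < m")
      case True
      have "wp q b c s1 (k1 + 2) (\<lambda>s' k'. (k' \<le> k1 + 2 + N \<and> I (Suc j) (update s' i 0 (Suc j))) \<and>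
          bounded_store b s' \<and> (\<forall>a. a \<notin> mods c \<longrightarrow> s' a = s1 a))"
        by (intro wp_frame step) (use True j in auto)
      then have "wp q b c s1 (k1 + 2) (\<lambda>s' k'. evaluate s' (V i \<oplus> Const 1) < 2 ^ b \<and>
              (\<exists>j''<j'. J j'' (update s' i (evaluate s' (Const 0)) (evaluate s' (V i \<oplus> Const 1))) (k' + 1)))"
      proof (rule wp_mono)
        fix s' k'
        assume *: "(k' \<le> k1 + 2 + N \<and> I (Suc j) (update s' i 0 (Suc j))) \<and>
          bounded_store b s' \<and> (\<forall>a. a \<notin> mods c \<longrightarrow> s' a = s1 a)"
        have si: "s' i 0 = j" using * im j by simp
        have jb: "Suc j < 2 ^ b" using True bnd by linarith
        have "J (m - Suc j) (update s' i 0 (Suc j)) (k' + 1)" unfolding J_def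
          by (rule exI[of _ "Suc j"]) (use True * j jb in \<open>auto simp: update_def bounded_store_def\<close>)
        moreover have "m - Suc j < j'" using True j by simp
        ultimately show "evaluate s' (V i \<oplus> Const 1) < 2 ^ b \<and>
              (\<exists>j''<j'. J j'' (update s' i (evaluate s' (Const 0)) (evaluate s' (V i \<oplus> Const 1))) (k' + 1))"
          using si jb by auto
      qed
      then show ?thesis using True ev1 j by simp
    next
      case False
      with j have [simp]: "j = m" by simp
      have "R s1 (k1 + 1)" using j by (intro fin) auto
      then show ?thesis using ev1 j by simp
    qed
  qed
  then show ?thesis by (simp add: For_def)
qed

section \<open>Non-backtracking walks\<close>

type_synonym arc = "nat \<times> nat"

locale adjacency_graph =
  fixes n d :: nat and adj :: "nat \<Rightarrow> nat list" and E :: "nat set set"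
  assumes simple: "simple_graph n E"
    and degree: "\<forall>v\<in>{1..n}. vertex_degree E v \<le> d"
    and lists: "adjacency_lists n E adj"
begin

abbreviation vertices :: "nat set" where "vertices \<equiv> {1..n}"

lemma distinct_adj: "v \<in> vertices \<Longrightarrow> distinct (adj v)"
  using lists by (auto simp: adjacency_lists_def)

lemma adj_iff: "v \<in> vertices \<Longrightarrow> w \<in> set (adj v) \<longleftrightarrow> {v, w} \<in> E"
  using lists by (auto simp: adjacency_lists_def)

lemma edgeD: "{v, w} \<in> E \<Longrightarrow> v \<in> vertices \<and> w \<in> vertices \<and> v \<noteq> w"
  using simple unfolding simple_graph_def by (metis doubleton_eq_iff)

lemma edge_cases:
  assumes "e \<in> E"
  obtains u v where "u \<in> vertices" "v \<in> vertices" "u \<noteq> v" "e = {u, v}"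
  using assms simple unfolding simple_graph_def by blast

lemma adj_vertex: "v \<in> vertices \<Longrightarrow> w \<in> set (adj v) \<Longrightarrow> w \<in> vertices"
  using adj_iff edgeD by blast

lemma finite_E: "finite E"
proof (rule finite_subset)
  show "E \<subseteq> Pow vertices" using simple by (auto simp: simple_graph_def)
qed simp

lemma length_adj:
  assumes "v \<in> vertices"
  shows "length (adj v) \<le> d"
proof -
  have "length (adj v) = card (set (adj v))" using distinct_adj[OF assms] by (simp add: distinct_card)
  also have "\<dots> = card ((\<lambda>w. {v, w}) ` set (adj v))"
    by (rule card_image[symmetric]) (auto simp: inj_on_def doubleton_eq_iff)
  also have "\<dots> \<le> card {e \<in> E. v \<in> e}"
    by (rule card_mono) (use finite_E adj_iff[OF assms] in auto)
  also have "\<dots> \<le> d" using degree assms by (auto simp: vertex_degree_def)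
  finally show ?thesis .
qed

definition arcs :: "arc set" where "arcs = (SIGMA u:vertices. set (adj u))"

lemma finite_arcs: "finite arcs"
  by (auto simp: arcs_def)

lemma card_arcs: "card arcs \<le> n * d"
proof -
  have "card arcs = (\<Sum>u\<in>vertices. card (set (adj u)))" by (simp add: arcs_def)
  also have "\<dots> \<le> (\<Sum>u\<in>vertices. d)"
    by (rule sum_mono) (use length_adj card_length order_trans in blast)
  finally show ?thesis by simp
qed

lemma arcs_iff: "(u, v) \<in> arcs \<longleftrightarrow> {u, v} \<in> E"
  unfolding arcs_def using adj_iff edgeD by blast

lemma arcs_sym: "(u, v) \<in> arcs \<longleftrightarrow> (v, u) \<in> arcs"
  by (simp add: arcs_iff insert_commute)

lemma arcs_vertices: "(u, v) \<in> arcs \<Longrightarrow> u \<in> vertices \<and> v \<in> vertices \<and> u \<noteq> v"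
  using arcs_iff edgeD by blast

lemma arcsD: "(u, v) \<in> arcs \<Longrightarrow> (v, u) \<in> arcs"
  using arcs_sym by blast

lemma set_adj: "v \<in> vertices \<Longrightarrow> set (adj v) = {w. (v, w) \<in> arcs}"
  by (auto simp: arcs_def)

section \<open>Trees of non-backtracking walks\<close>

definition children :: "arc \<Rightarrow> arc list" where
  "children e = map (Pair (snd e)) (filter (\<lambda>w. w \<noteq> fst e) (adj (snd e)))"

lemma set_children: "(u, v) \<in> arcs \<Longrightarrow> set (children (u, v)) = {(v, w) | w. (v, w) \<in> arcs \<and> w \<noteq> u}"
  using arcs_vertices set_adj by (auto simp: children_def)

lemma distinct_children: "(u, v) \<in> arcs \<Longrightarrow> distinct (children (u, v))"
  using arcs_vertices distinct_adj by (auto simp: children_def distinct_map inj_on_def)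

text \<open>Breadth-first search in the tree of non-backtracking walks, stopped after \<open>k\<close> arcs.\<close>

fun explore :: "nat \<Rightarrow> arc list \<Rightarrow> bool" where
  "explore 0 q = (q = [])"
| "explore (Suc k) [] = True"
| "explore (Suc k) (e # q) = explore k (q @ children e)"

text \<open>The number of nodes of the tree of all non-backtracking walks that start with a given arc.\<close>

definition tree_size :: "arc \<Rightarrow> enat" where
  "tree_size = lfp (\<lambda>F e. 1 + (\<Sum>c\<leftarrow>children e. F c))"

lemma tree_size_eq: "tree_size e = eSuc (\<Sum>c\<leftarrow>children e. tree_size c)"
proof -
  have "mono (\<lambda>(F :: arc \<Rightarrow> enat) e. 1 + (\<Sum>c\<leftarrow>children e. F c))"
    by (intro monoI le_funI add_left_mono sum_list_mono) (auto simp: le_fun_def)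
  from lfp_unfold[OF this] have "tree_size = (\<lambda>e. 1 + (\<Sum>c\<leftarrow>children e. tree_size c))"
    unfolding tree_size_def .
  then show ?thesis by (metis plus_1_eSuc(1))
qed

lemma tree_size_nonzero: "tree_size e \<noteq> 0"
  by (subst tree_size_eq) simp

text \<open>Expanding an arc replaces its tree by the trees of its children, which removes exactly
  one node. So the total size of the queued trees is an exact clock for the search, also when it is
  infinite.\<close>

lemma explore_iff: "explore k q \<longleftrightarrow> (\<Sum>e\<leftarrow>q. tree_size e) \<le> enat k"
proof (induction k q rule: explore.induct)
  case (1 q)
  show ?case by (cases q) (simp_all add: zero_enat_def[symmetric] tree_size_nonzero)
next
  case (3 k e q)
  have "(\<Sum>e\<leftarrow>e # q. tree_size e) = eSuc (\<Sum>e\<leftarrow>q @ children e. tree_size e)"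
    by (subst (1) list.map, subst sum_list.Cons, subst tree_size_eq)
       (simp add: eSuc_plus_1 ac_simps)
  then show ?case using 3 by (simp add: eSuc_enat[symmetric])
qed auto

definition dead :: "nat \<Rightarrow> arc \<Rightarrow> bool" where
  "dead B e \<longleftrightarrow> explore B [e]"

lemma dead_iff: "dead B e \<longleftrightarrow> tree_size e \<le> enat B"
  by (simp add: dead_def explore_iff)

lemma dead_child:
  assumes "dead B e" "c \<in> set (children e)"
  shows "dead B c"
proof -
  have "tree_size c \<le> (\<Sum>c\<leftarrow>children e. tree_size c)"
    using assms(2) by (intro member_le_sum_list) auto
  also have "\<dots> \<le> eSuc \<dots>" by (rule ile_eSuc)
  also have "\<dots> = tree_size e" by (rule tree_size_eq[symmetric])
  finally show ?thesis using assms(1) by (auto simp: dead_iff)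
qed

text \<open>If every arc of \<open>X\<close> can be continued inside \<open>X\<close>, walks never
  have to end, and the tree sizes exceed every \<open>k\<close> by induction. Applied to the arcs of
  a cycle, this shows that no cycle is destroyed.\<close>

lemma not_dead_closed:
  assumes "\<And>e. e \<in> X \<Longrightarrow> \<exists>c\<in>set (children e). c \<in> X" "e \<in> X"
  shows "\<not> dead B e"
proof -
  have "e \<in> X \<Longrightarrow> enat k \<le> tree_size e" for k e
  proof (induction k arbitrary: e)
    case (Suc k)
    then obtain c where c: "c \<in> set (children e)" "c \<in> X" using assms(1) by blast
    have "enat k \<le> tree_size c" using Suc c by blast
    also have "tree_size c \<le> (\<Sum>c\<leftarrow>children e. tree_size c)"
      using c by (intro member_le_sum_list) auto
    finally have "eSuc (enat k) \<le> eSuc (\<Sum>c\<leftarrow>children e. tree_size c)" by simp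
    then show ?case by (simp only: eSuc_enat flip: tree_size_eq)
  qed (simp add: zero_enat_def[symmetric])
  from this[OF assms(2), of "Suc B"] show ?thesis
    by (metis Suc_n_not_le_n dead_iff enat_ord_simps(1) order_trans)
qed

section \<open>Live arcs and dead ends\<close>

definition live :: "nat \<Rightarrow> arc set" where
  "live B = {(u, v) \<in> arcs. \<not> dead B (u, v) \<and> \<not> dead B (v, u)}"

text \<open>Only \<open>(v, w)\<close> is tested, which saves the program a second search; on a live
  arc \<open>(u, v)\<close> the reverse arc \<open>(w, v)\<close> passes automatically, as
  \<open>kids_live\<close> shows.\<close>

definition kids :: "nat \<Rightarrow> nat \<Rightarrow> nat \<Rightarrow> nat list" where
  "kids B u v = filter (\<lambda>w. w \<noteq> u \<and> \<not> dead B (v, w)) (adj v)"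

lemma live_arcs: "live B \<subseteq> arcs"
  by (auto simp: live_def)

lemma finite_live: "finite (live B)"
  using live_arcs finite_arcs by (rule finite_subset)

lemma live_sym: "(u, v) \<in> live B \<longleftrightarrow> (v, u) \<in> live B"
  using arcsD[of u v] arcsD[of v u] by (auto simp: live_def)

lemma set_kids: "(u, v) \<in> arcs \<Longrightarrow> set (kids B u v) = {w. (v, w) \<in> arcs \<and> w \<noteq> u \<and> \<not> dead B (v, w)}"
  using arcs_vertices set_adj by (auto simp: kids_def)

lemma distinct_kids: "(u, v) \<in> arcs \<Longrightarrow> distinct (kids B u v)"
  using arcs_vertices distinct_adj by (auto simp: kids_def)

lemma length_kids: "(u, v) \<in> arcs \<Longrightarrow> length (kids B u v) \<le> d"
  using arcs_vertices length_adj by (metis kids_def le_trans length_filter_le)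

text \<open>If \<open>(w, v)\<close> were dead, so would be its child \<open>(v, u)\<close>, against
  the liveness of \<open>(u, v)\<close>. Hence a walk that starts on a live arc stays on live
  arcs.\<close>

lemma kids_live:
  assumes "(u, v) \<in> live B"
  shows "set (kids B u v) = {w. (v, w) \<in> live B \<and> w \<noteq> u}"
proof -
  have uv: "(u, v) \<in> arcs" "\<not> dead B (v, u)" using assms by (auto simp: live_def)
  have "\<not> dead B (w, v)" if "(v, w) \<in> arcs" "w \<noteq> u" for w
  proof
    assume "dead B (w, v)"
    moreover have "(v, u) \<in> set (children (w, v))"
      using that uv arcsD[of u v] arcsD[of v w] by (simp add: set_children)
    ultimately show False using dead_child uv by blast
  qed
  then show ?thesis using uv by (auto simp: set_kids live_def)
qed

definition leaves :: "nat \<Rightarrow> arc set" where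
  "leaves B = {(u, v) \<in> live B. kids B u v = []}"

text \<open>Every leaf carries a discarded subtree with at least \<open>B\<close> arcs, and these subtrees are
  disjoint.\<close>

lemma card_leaves: "card (leaves B) * B \<le> n * d"
proof -
  \<comment> \<open>\<open>R\<close> collects the arcs that point into a discarded tree, away from
    the rest; \<open>g\<close> turns their finite tree sizes into numbers.\<close>
  define R where "R = {(x, y) \<in> arcs. dead B (x, y) \<and> \<not> dead B (y, x)}"
  define g where "g e = the_enat (tree_size e)" for e
  let ?C = "\<lambda>e. set (children e)" and ?D = "R \<union> leaves B"
  have fin: "finite R" "finite (leaves B)"
    using finite_arcs finite_live by (auto simp: R_def leaves_def intro: finite_subset)
  have disj: "R \<inter> leaves B = {}" by (auto simp: R_def leaves_def live_def)
  have D_arcs: "?D \<subseteq> arcs" using live_arcs by (auto simp: R_def leaves_def)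
  have behind: "\<not> dead B (y, x)" if "(x, y) \<in> ?D" for x y
    using that by (auto simp: R_def leaves_def live_def)
  have ahead: "dead B c" if e: "e \<in> ?D" and c: "c \<in> ?C e" for e c
  proof (cases "e \<in> R")
    case True
    then have "dead B e" by (auto simp: R_def)
    then show ?thesis using c by (rule dead_child)
  next
    case False
    obtain u v where uv: "e = (u, v)" by fastforce
    with False e have "kids B u v = []" "(u, v) \<in> arcs" by (auto simp: leaves_def live_def)
    then have "{w. (v, w) \<in> arcs \<and> w \<noteq> u \<and> \<not> dead B (v, w)} = {}"
      using set_kids[of u v B] by simp
    then show ?thesis using c uv set_children[OF \<open>(u, v) \<in> arcs\<close>] by auto
  qed
  have sub: "?C e \<subseteq> R" if e: "e \<in> ?D" for e
  proof
    fix c assume c: "c \<in> ?C e"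
    obtain u v where uv: "e = (u, v)" by fastforce
    have uva: "(u, v) \<in> arcs" using e uv D_arcs by auto
    then obtain w where w: "c = (v, w)" "(v, w) \<in> arcs" "w \<noteq> u" using c uv set_children by auto
    have "(v, u) \<in> ?C (w, v)" using w uva arcsD[of u v] arcsD[of v w] by (simp add: set_children)
    then have "\<not> dead B (w, v)" using behind[of u v] e uv dead_child by blast
    then show "c \<in> R" using ahead[OF e c] w by (auto simp: R_def)
  qed
  \<comment> \<open>A common child means that both arcs enter the same vertex \<open>v\<close>. Then
    \<open>(v, u)\<close> is a child of the other arc \<open>(u', v)\<close> and thus dead, although
    the reversal of an arc in \<open>?D\<close> is never dead.\<close>
  have dj: "?C e \<inter> ?C e' = {}" if e: "e \<in> ?D" "e' \<in> ?D" "e \<noteq> e'" for e e'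
  proof (rule ccontr)
    assume "?C e \<inter> ?C e' \<noteq> {}"
    then obtain c where c: "c \<in> ?C e" "c \<in> ?C e'" by blast
    obtain u v u' v' where uv: "e = (u, v)" "e' = (u', v')" by fastforce
    have a: "(u, v) \<in> arcs" "(u', v') \<in> arcs" using e uv D_arcs by auto
    have [simp]: "v' = v" using c uv a set_children by auto
    have "u \<noteq> u'" using e uv by auto
    then have "(v, u) \<in> ?C (u', v)" using a arcsD[of u v] by (simp add: set_children)
    then have "dead B (v, u)" using ahead e uv by simp
    then show False using behind e uv by blast
  qed
  have fg: "tree_size c = enat (g c)" if "c \<in> R" for c
  proof -
    have "tree_size c \<le> enat B" using that by (auto simp: R_def dead_iff)
    then show ?thesis unfolding g_def by (metis enat_ile the_enat.simps)
  qed
  have step: "tree_size e = enat (Suc (\<Sum>c\<in>?C e. g c))" if e: "e \<in> ?D" for e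
  proof -
    have "distinct (children e)" using e D_arcs distinct_children by (cases e) auto
    then have "(\<Sum>c\<leftarrow>children e. tree_size c) = (\<Sum>c\<in>?C e. tree_size c)"
      by (simp add: sum_list_distinct_conv_sum_set)
    also have "\<dots> = (\<Sum>c\<in>?C e. enat (g c))" using sub[OF e] fg by (intro sum.cong) auto
    also have "\<dots> = enat (\<Sum>c\<in>?C e. g c)"
      by (induction rule: infinite_finite_induct) (auto simp: zero_enat_def)
    finally show ?thesis by (simp add: tree_size_eq[of e] eSuc_enat)
  qed
  have gR: "g e = Suc (\<Sum>c\<in>?C e. g c)" if "e \<in> R" for e
    using step[of e] fg[OF that] that by simp
  have gL: "B \<le> (\<Sum>c\<in>?C e. g c)" if "e \<in> leaves B" for e
  proof -
    have "\<not> tree_size e \<le> enat B" using that by (auto simp: leaves_def live_def simp flip: dead_iff)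
    then show ?thesis using step[of e] that by simp
  qed
  \<comment> \<open>Each tree size in \<open>R\<close> counts one for the root plus the sizes of the
    children, and the child sets are disjoint subsets of \<open>R\<close>. In the sum the total of
    \<open>g\<close> over \<open>R\<close> cancels, leaving \<open>B\<close> per leaf against one
    per arc of \<open>R\<close>.\<close>
  have "(\<Sum>e\<in>R. g e) = (\<Sum>e\<in>R. Suc (\<Sum>c\<in>?C e. g c))"
    by (rule sum.cong[OF refl gR])
  then have "(\<Sum>e\<in>R. g e) + card (leaves B) * B = card R + (\<Sum>e\<in>R. \<Sum>c\<in>?C e. g c) + (\<Sum>e\<in>leaves B. B)"
    by (simp only: sum_Suc sum_constant of_nat_id)
  also have "\<dots> \<le> card R + (\<Sum>e\<in>R. \<Sum>c\<in>?C e. g c) + (\<Sum>e\<in>leaves B. \<Sum>c\<in>?C e. g c)"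
    using gL by (intro add_left_mono sum_mono) auto
  also have "\<dots> = card R + (\<Sum>e\<in>?D. \<Sum>c\<in>?C e. g c)"
    using fin disj by (simp add: sum.union_disjoint)
  also have "(\<Sum>e\<in>?D. \<Sum>c\<in>?C e. g c) = (\<Sum>c\<in>(\<Union>e\<in>?D. ?C e). g c)"
    using fin dj by (intro sum.UNION_disjoint[symmetric]) auto
  also have "\<dots> \<le> (\<Sum>c\<in>R. g c)" using sub fin by (intro sum_mono2) auto
  finally have "card (leaves B) * B \<le> card R" by simp
  also have "\<dots> \<le> card arcs" by (intro card_mono finite_arcs) (auto simp: R_def)
  also have "\<dots> \<le> n * d" by (rule card_arcs)
  finally show ?thesis .
qed

text \<open>The random choices are an explicit list, so that the program can be verified list by
  list. A walk that gets stuck yields \<open>None\<close> and not a shorter list; hence all walks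
  that are compared have equal length.\<close>

fun walk :: "nat \<Rightarrow> nat list \<Rightarrow> nat \<Rightarrow> nat \<Rightarrow> nat list option" where
  "walk B [] u v = Some [u, v]"
| "walk B (r # rs) u v =
     (if kids B u v = [] then None
      else map_option (Cons u) (walk B rs v (kids B u v ! (r mod length (kids B u v)))))"

definition nb_walk :: "nat list \<Rightarrow> bool" where
  "nb_walk p \<longleftrightarrow> (\<forall>i. Suc i < length p \<longrightarrow> (p ! i, p ! Suc i) \<in> arcs) \<and>
     (\<forall>i. Suc (Suc i) < length p \<longrightarrow> p ! i \<noteq> p ! Suc (Suc i))"

lemma kid_arc: "(u, v) \<in> arcs \<Longrightarrow> kids B u v \<noteq> [] \<Longrightarrow>
    (v, kids B u v ! (r mod length (kids B u v))) \<in> arcs \<and> kids B u v ! (r mod length (kids B u v)) \<noteq> u"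
  using nth_mem[of "r mod length (kids B u v)" "kids B u v"] by (auto simp: set_kids)

lemma walk_length: "walk B rs u v = Some p \<Longrightarrow> length p = length rs + 2 \<and> p ! 0 = u \<and> p ! 1 = v"
  by (induction rs arbitrary: u v p) (auto split: if_splits simp: nth_Cons')

lemma walk_nb: "(u, v) \<in> arcs \<Longrightarrow> walk B rs u v = Some p \<Longrightarrow> nb_walk p"
proof (induction rs arbitrary: u v p)
  case Nil
  then show ?case by (auto simp: nb_walk_def less_Suc_eq nth_Cons')
next
  case (Cons r rs)
  let ?w = "kids B u v ! (r mod length (kids B u v))"
  from Cons.prems obtain p' where p': "p = u # p'" "walk B rs v ?w = Some p'" "kids B u v \<noteq> []"
    by (auto split: if_splits)
  have w: "(v, ?w) \<in> arcs" "?w \<noteq> u" using kid_arc[OF Cons.prems(1) p'(3)] by auto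
  have nb: "nb_walk p'" using Cons.IH[OF w(1) p'(2)] .
  have p0: "p' ! 0 = v" "p' ! Suc 0 = ?w" using walk_length[OF p'(2)] by auto
  show ?case unfolding nb_walk_def
  proof (intro conjI allI impI)
    fix i assume "Suc i < length p"
    then show "(p ! i, p ! Suc i) \<in> arcs" using nb p0 p'(1) Cons.prems(1)
      by (cases i) (auto simp: nb_walk_def)
  next
    fix i assume "Suc (Suc i) < length p"
    then show "p ! i \<noteq> p ! Suc (Suc i)" using nb p0 p'(1) w(2)
      by (cases i) (auto simp: nb_walk_def)
  qed
qed

text \<open>\<open>walk\<close> recurses at the front, but the program appends vertices at the end;
  this equation is the step of its loop.\<close>

lemma walk_snoc:
  "walk B (rs @ [r]) u v = (case walk B rs u v of None \<Rightarrow> None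
     | Some p \<Rightarrow> let ks = kids B (p ! length rs) (p ! Suc (length rs))
        in if ks = [] then None else Some (p @ [ks ! (r mod length ks)]))"
proof (induction rs arbitrary: u v)
  case (Cons r' rs)
  show ?case
    by (auto simp: Cons.IH Let_def split: option.splits)
qed (simp add: Let_def)

text \<open>Since \<open>j\<close> is the first index whose vertex occurred before, the vertices
  from \<open>i\<close> up to \<open>j\<close> are distinct. The segment has length at least 3:
  length 1 would be a loop, length 2 an immediate reversal.\<close>

lemma cycle_of_repeat:
  assumes "nb_walk W" "i < j" "j < length W" "W ! i = W ! j" "distinct (take j W)"
  shows "is_cycle E (map ((!) W) [i..<j])"
proof -
  have adjE: "{W ! k, W ! Suc k} \<in> E" if "k < j" for k
    using assms(1,3) that by (auto simp: nb_walk_def simp flip: arcs_iff)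
  have "j \<noteq> Suc i"
    using adjE[of i] assms edgeD by auto
  moreover have "j \<noteq> Suc (Suc i)"
    using assms by (auto simp: nb_walk_def)
  ultimately have len: "3 \<le> j - i" using assms(2) by linarith
  have "inj_on ((!) W) {i..<j}"
  proof (rule inj_onI)
    fix x y assume "x \<in> {i..<j}" "y \<in> {i..<j}" "W ! x = W ! y"
    then show "x = y" using assms(3,5) nth_eq_iff_index_eq[of "take j W" x y] by simp
  qed
  then have "distinct (map ((!) W) [i..<j])" by (simp add: distinct_map)
  moreover have "{map ((!) W) [i..<j] ! k, map ((!) W) [i..<j] ! (Suc k mod (j - i))} \<in> E"
    if "k < j - i" for k
  proof (cases "Suc k = j - i")
    case True
    then have "i + k = j - 1" "Suc (i + k) = j" using assms(2) by auto
    then show ?thesis using True that adjE[of "i + k"] assms(2,4) by simp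
  next
    case False
    then show ?thesis using that adjE[of "i + k"] by simp
  qed
  ultimately show ?thesis using len by (simp add: is_cycle_def)
qed

text \<open>From the last vertex of \<open>x\<close> back to index \<open>p\<close>, then forward
  along \<open>y\<close> to its last vertex, provided that the walks part right after
  \<open>p\<close>; the turn is then not a backtracking. Otherwise only the tail of \<open>x\<close>
  remains. So every \<open>p\<close> yields a non-backtracking walk, and the program may try all of
  them.\<close>

definition joined :: "nat list \<Rightarrow> nat list \<Rightarrow> nat \<Rightarrow> nat list" where
  "joined x y p =
     (if x ! p = y ! p \<and> x ! Suc p \<noteq> y ! Suc p then rev (drop p x) @ drop (Suc p) y
      else rev (drop p x))"

lemma nth_joined1: "p < length x \<Longrightarrow> i < length x - p \<Longrightarrow> (rev (drop p x) @ ys) ! i = x ! (length x - 1 - i)"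
  by (simp add: nth_append rev_nth)

lemma nth_joined2:
  "p < length x \<Longrightarrow> length y = length x \<Longrightarrow> length x - p \<le> i \<Longrightarrow> i < 2 * length x - 2 * p - 1 \<Longrightarrow>
    (rev (drop p x) @ drop (Suc p) y) ! i = y ! (2 * p + i + 1 - length x)"
  by (simp add: nth_append) (rule arg_cong[where f = "(!) y"], linarith)

lemma nb_walk_rev_drop:
  assumes "nb_walk x" "p < length x"
  shows "nb_walk (rev (drop p x))"
proof -
  have "(x ! (length x - 1 - i), x ! (length x - 1 - Suc i)) \<in> arcs" if "Suc i < length x - p" for i
  proof -
    have "Suc (length x - 1 - Suc i) = length x - 1 - i" using that by linarith
    moreover have "(x ! (length x - 1 - Suc i), x ! Suc (length x - 1 - Suc i)) \<in> arcs"
      using assms that unfolding nb_walk_def by auto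
    ultimately show ?thesis using arcs_sym by metis
  qed
  moreover have "x ! (length x - 1 - i) \<noteq> x ! (length x - 1 - Suc (Suc i))" if "Suc (Suc i) < length x - p" for i
  proof -
    have "Suc (Suc (length x - 1 - Suc (Suc i))) = length x - 1 - i" using that by linarith
    moreover have "x ! (length x - 1 - Suc (Suc i)) \<noteq> x ! Suc (Suc (length x - 1 - Suc (Suc i)))"
      using assms that unfolding nb_walk_def by auto
    ultimately show ?thesis by metis
  qed
  ultimately show ?thesis
    using nth_joined1[OF assms(2), of _ "[]"] assms(2) unfolding nb_walk_def by simp
qed

lemma nb_walk_joined:
  assumes x: "nb_walk x" and y: "nb_walk y" and len: "length y = length x" "Suc p < length x"
  shows "nb_walk (joined x y p)"
proof (cases "x ! p = y ! p \<and> x ! Suc p \<noteq> y ! Suc p")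
  case False
  have "nb_walk (rev (drop p x))" using nb_walk_rev_drop[OF x] len by simp
  then show ?thesis using False by (auto simp: joined_def)
next
  case True
  let ?N = "length x"
  let ?W = "rev (drop p x) @ drop (Suc p) y"
  have lW: "length ?W = 2 * ?N - 2 * p - 1" using len by simp
  have p: "p < ?N" using len by simp
  have nb: "nb_walk (rev (drop p x))" using nb_walk_rev_drop[OF x p] .
  note n1 = nth_joined1[OF p, of _ "drop (Suc p) y"] and n2 = nth_joined2[OF p len(1)]
  have e1: "?W ! i = rev (drop p x) ! i" if "i < ?N - p" for i using that by (simp add: nth_append)
  have e2: "?W ! (?N - Suc p) = y ! p" using n1[of "?N - Suc p"] len True by simp
  \<comment> \<open>The vertex at index \<open>p\<close> is shared, so the formula for the part
    along \<open>y\<close> holds one position earlier than in \<open>nth_joined2\<close>.\<close>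
  have e3: "?W ! i = y ! (2 * p + i + 1 - ?N)" if "?N - Suc p \<le> i" "i < 2 * ?N - 2 * p - 1" for i
  proof (cases "i = ?N - Suc p")
    case True
    then have "2 * p + i + 1 - ?N = p" using len by linarith
    then show ?thesis using e2 True by simp
  qed (use that n2 in auto)
  have e4: "?W ! (?N - Suc (Suc p)) = x ! Suc p" using n1[of "?N - Suc (Suc p)"] len
    by (simp add: Suc_diff_Suc)
  have "nb_walk ?W" unfolding nb_walk_def
  proof (intro conjI allI impI)
    fix i assume i: "Suc i < length ?W"
    show "(?W ! i, ?W ! Suc i) \<in> arcs"
    proof (cases "Suc i < ?N - p")
      case True
      then show ?thesis using nb unfolding nb_walk_def by (simp add: e1)
    next
      case False
      let ?j = "2 * p + i + 1 - ?N"
      have j: "Suc ?j = 2 * p + Suc i + 1 - ?N" "Suc ?j < ?N" using False i lW len by linarith+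
      have "(y ! ?j, y ! Suc ?j) \<in> arcs" using y j(2) len unfolding nb_walk_def by simp
      then show ?thesis using e3[of i] e3[of "Suc i"] False i lW j by simp
    qed
  next
    fix i assume i: "Suc (Suc i) < length ?W"
    \<comment> \<open>The positions of three consecutive vertices: within the reversed
      \<open>x\<close>, centred at the turn, or within \<open>y\<close> together with the shared
      vertex.\<close>
    consider "Suc (Suc i) < ?N - p" | "i = ?N - Suc (Suc p)" | "?N - Suc p \<le> i" by linarith
    then show "?W ! i \<noteq> ?W ! Suc (Suc i)"
    proof cases
      case 1
      then show ?thesis using nb unfolding nb_walk_def by (simp add: e1)
    next
      case 2
      then have "2 * p + Suc (Suc i) + 1 - ?N = Suc p" using len by linarith
      moreover have "?N - Suc p \<le> Suc (Suc i)" "Suc (Suc i) < 2 * ?N - 2 * p - 1"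
        using 2 i lW by linarith+
      ultimately have "?W ! Suc (Suc i) = y ! Suc p" using e3[of "Suc (Suc i)"] by metis
      then show ?thesis using 2 e4 True by simp
    next
      case 3
      let ?j = "2 * p + i + 1 - ?N"
      have j: "Suc (Suc ?j) = 2 * p + Suc (Suc i) + 1 - ?N" "Suc (Suc ?j) < ?N" using 3 i lW len by linarith+
      have "y ! ?j \<noteq> y ! Suc (Suc ?j)" using y j(2) len unfolding nb_walk_def by simp
      then show ?thesis using e3[of i] e3[of "Suc (Suc i)"] 3 i lW j by simp
    qed
  qed
  then show ?thesis using True by (simp add: joined_def)
qed

text \<open>If the walks differ, let \<open>p\<close> be the index before their first difference.
  The walk joined there begins and ends with the common last vertex, which is a repetition. For
  \<open>p = 0\<close> the joined walk is just the reversal of \<open>x\<close>, as both walks start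
  with the same arc; so repetitions inside a walk are noticed as well.\<close>

lemma joined_repeat:
  assumes len: "length y = length x" "2 \<le> length x"
    and start: "x ! 0 = y ! 0" "x ! 1 = y ! 1" and last: "x ! (length x - 1) = y ! (length x - 1)"
    and dist: "\<And>p. Suc p < length x \<Longrightarrow> distinct (joined x y p)"
  shows "x = y \<and> distinct x"
proof
  show "distinct x" using dist[of 0] start len by (simp add: joined_def)
  show "x = y"
  proof (rule ccontr)
    assume "x \<noteq> y"
    then obtain i where i: "i < length x" "x ! i \<noteq> y ! i" using len by (auto simp: list_eq_iff_nth_eq)
    define k where "k = (LEAST i. i < length x \<and> x ! i \<noteq> y ! i)"
    have k: "k < length x" "x ! k \<noteq> y ! k" using LeastI[of "\<lambda>i. i < length x \<and> x ! i \<noteq> y ! i" i] i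
      by (auto simp: k_def)
    have "k \<noteq> 0" using k start by metis
    then obtain p where p: "k = Suc p" by (cases k) auto
    have "x ! p = y ! p" using not_less_Least[of p "\<lambda>i. i < length x \<and> x ! i \<noteq> y ! i"] p k
      by (fold k_def) auto
    then have J: "joined x y p = rev (drop p x) @ drop (Suc p) y" using k p by (simp add: joined_def)
    have "Suc p \<noteq> length x - 1" using k p last by metis
    then have sp: "Suc p < length x - 1" using k p by linarith
    have ne: "x \<noteq> []" "y \<noteq> []" using len by auto
    have "last (drop p x) = last x" "last (drop (Suc p) y) = last y"
      using sp len by (simp_all add: last_drop)
    then have "last (drop p x) = x ! (length x - 1)" "last (drop (Suc p) y) = y ! (length x - 1)"
      using ne len by (simp_all add: last_conv_nth)
    then have a: "x ! (length x - 1) \<in> set (drop p x)" and b: "y ! (length x - 1) \<in> set (drop (Suc p) y)"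
      using sp len last_in_set[of "drop p x"] last_in_set[of "drop (Suc p) y"] by auto
    have "Suc p < length x" using sp by simp
    then have "distinct (joined x y p)" by (rule dist)
    then show False using a b last unfolding J by auto
  qed
qed

end

section \<open>Repeated sampling\<close>

lemma expectation_bind_finite:
  fixes h :: "'b \<Rightarrow> real"
  assumes "finite (set_pmf p)" "\<And>x. x \<in> set_pmf p \<Longrightarrow> finite (set_pmf (f x))"
  shows "measure_pmf.expectation (bind_pmf p f) h =
    measure_pmf.expectation p (\<lambda>x. measure_pmf.expectation (f x) h)"
proof -
  have "measure_pmf.expectation (bind_pmf p f) h =
      (\<Sum>a\<in>set_pmf p. pmf p a *\<^sub>R measure_pmf.expectation (f a) h)"
    by (rule pmf_expectation_bind) (use assms in auto)
  also have "\<dots> = measure_pmf.expectation p (\<lambda>x. measure_pmf.expectation (f x) h)"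
    by (rule integral_measure_pmf[symmetric]) (use assms in auto)
  finally show ?thesis .
qed

lemma prob_eq_expectation: "measure_pmf.prob p X = measure_pmf.expectation p (indicator X)"
  by simp

lemma prob_bind_finite:
  assumes "finite (set_pmf p)" "\<And>x. x \<in> set_pmf p \<Longrightarrow> finite (set_pmf (f x))"
  shows "measure_pmf.prob (bind_pmf p f) X = measure_pmf.expectation p (\<lambda>x. measure_pmf.prob (f x) X)"
  unfolding prob_eq_expectation using assms by (rule expectation_bind_finite)

lemma finite_replicate_pmf [intro]: "finite (set_pmf p) \<Longrightarrow> finite (set_pmf (replicate_pmf m p))"
  using finite_lists_length_eq[of "set_pmf p" m]
  by (simp add: set_replicate_pmf lists_eq_set Int_def conj_commute)

lemma expectation_mono_finite:
  fixes f g :: "'a \<Rightarrow> real"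
  assumes "finite (set_pmf p)" "\<And>x. x \<in> set_pmf p \<Longrightarrow> f x \<le> g x"
  shows "measure_pmf.expectation p f \<le> measure_pmf.expectation p g"
  by (rule integral_mono_AE)
     (use assms in \<open>auto intro!: integrable_measure_pmf_finite simp: AE_measure_pmf_iff\<close>)

text \<open>Exchanging the independent draws makes the head of the list the most recent sample. A
  bound for one more sample with a fixed history then carries over to the expectation.\<close>

lemma replicate_pmf_Suc':
  "replicate_pmf (Suc m) p = bind_pmf (replicate_pmf m p) (\<lambda>xs. map_pmf (\<lambda>x. x # xs) p)"
proof -
  have "replicate_pmf (Suc m) p = bind_pmf p (\<lambda>x. bind_pmf (replicate_pmf m p) (\<lambda>xs. return_pmf (x # xs)))"
    by simp
  also have "\<dots> = bind_pmf (replicate_pmf m p) (\<lambda>xs. bind_pmf p (\<lambda>x. return_pmf (x # xs)))"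
    by (rule bind_commute_pmf)
  finally show ?thesis by (simp add: map_pmf_def)
qed

lemma expectation_replicate_Suc:
  fixes h :: "'a list \<Rightarrow> real"
  assumes "finite (set_pmf p)"
  shows "measure_pmf.expectation (replicate_pmf (Suc m) p) h =
    measure_pmf.expectation (replicate_pmf m p) (\<lambda>xs. measure_pmf.expectation p (\<lambda>x. h (x # xs)))"
  unfolding replicate_pmf_Suc' using assms
  by (subst expectation_bind_finite) auto

lemma prob_replicate_add:
  assumes "finite (set_pmf p)"
  shows "measure_pmf.prob (replicate_pmf (m + k) p) X =
    measure_pmf.expectation (replicate_pmf m p) (\<lambda>xs. measure_pmf.prob (replicate_pmf k p) {ys. xs @ ys \<in> X})"
proof -
  have "replicate_pmf (m + k) p = bind_pmf (replicate_pmf m p) (\<lambda>xs. map_pmf (\<lambda>ys. xs @ ys) (replicate_pmf k p))"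
    by (simp add: replicate_pmf_distrib map_pmf_def)
  then show ?thesis using assms
    by (simp only:) (subst prob_bind_finite, auto simp: vimage_def)
qed

lemma prob_replicate_all:
  assumes "finite (set_pmf p)"
  shows "measure_pmf.prob (replicate_pmf m p) {xs. set xs \<subseteq> A} = measure_pmf.prob p A ^ m"
proof (induction m)
  case (Suc m)
  have *: "measure_pmf.expectation p (\<lambda>x. indicator {xs. set xs \<subseteq> A} (x # xs))
      = measure_pmf.prob p A * indicator {xs. set xs \<subseteq> A} xs" for xs
  proof -
    have "(\<lambda>x. indicator {xs. set xs \<subseteq> A} (x # xs) :: real) = (\<lambda>x. indicator A x * indicator {xs. set xs \<subseteq> A} xs)"
      by (auto simp: indicator_def)
    then show ?thesis by simp
  qed
  have "measure_pmf.prob (replicate_pmf (Suc m) p) {xs. set xs \<subseteq> A}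
      = measure_pmf.expectation (replicate_pmf m p)
          (\<lambda>xs. measure_pmf.prob p A * indicator {xs. set xs \<subseteq> A} xs)"
    unfolding prob_eq_expectation expectation_replicate_Suc[OF assms] by (simp only: * prob_eq_expectation)
  also have "\<dots> = measure_pmf.prob p A * measure_pmf.prob p A ^ m"
    using Suc by simp
  finally show ?case by simp
qed simp

definition blocks :: "nat \<Rightarrow> nat \<Rightarrow> 'a list \<Rightarrow> 'a list list" where
  "blocks k m xs = map (\<lambda>i. take k (drop (i * k) xs)) [0..<m]"

text \<open>Cutting independent numbers into blocks gives independent blocks. This is used twice:
  for the walks of a trial and for the trials.\<close>

lemma map_blocks_replicate_pmf:
  "map_pmf (blocks k m) (replicate_pmf (m * k) p) = replicate_pmf m (replicate_pmf k p)"
proof (induction m)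
  case 0
  show ?case by (simp add: blocks_def)
next
  case (Suc m)
  have *: "blocks k (Suc m) (xs @ ys) = xs # blocks k m ys" if "length xs = k" for xs ys :: "'a list"
    using that by (simp add: blocks_def upt_conv_Cons map_Suc_upt[symmetric] del: upt_Suc)
  have "map_pmf (blocks k (Suc m)) (replicate_pmf (Suc m * k) p) =
      bind_pmf (replicate_pmf k p) (\<lambda>xs. bind_pmf (replicate_pmf (m * k) p)
        (\<lambda>ys. return_pmf (blocks k (Suc m) (xs @ ys))))"
    by (simp add: replicate_pmf_distrib map_bind_pmf)
  also have "\<dots> = bind_pmf (replicate_pmf k p) (\<lambda>xs. bind_pmf (replicate_pmf (m * k) p)
        (\<lambda>ys. return_pmf (xs # blocks k m ys)))"
    by (intro bind_pmf_cong refl) (auto simp: * set_replicate_pmf)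
  also have "\<dots> = bind_pmf (replicate_pmf k p) (\<lambda>xs. bind_pmf (map_pmf (blocks k m) (replicate_pmf (m * k) p))
        (\<lambda>yss. return_pmf (xs # yss)))"
    by (simp add: bind_map_pmf)
  also have "\<dots> = replicate_pmf (Suc m) (replicate_pmf k p)"
    by (simp only: Suc.IH replicate_pmf.simps)
  finally show ?case .
qed

lemma map_replicate_pmf: "map_pmf (map f) (replicate_pmf m p) = replicate_pmf m (map_pmf f p)"
proof (induction m)
  case (Suc m)
  show ?case by (simp add: map_bind_pmf bind_map_pmf Suc.IH[symmetric])
qed simp

section \<open>Birthday collisions\<close>

text \<open>The first \<open>m\<close> samples almost surely hit many classes (or classes of large total weight):
  \<open>2 ^ (number of classes hit)\<close> has exponentially growing expectation until that happens.
  Each of the other \<open>m\<close> samples then has a fair chance to hit one of these classes, in an element that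
  was not sampled before since single elements are light.\<close>

lemma birthday:
  fixes p :: "'a pmf" and f :: "'a \<Rightarrow> 'b"
  assumes fin: "finite (set_pmf p)"
    and VV: "finite VV" "card VV \<le> N" "\<And>x. x \<in> G \<Longrightarrow> f x \<in> VV"
    and light: "\<And>x. x \<in> G \<Longrightarrow> pmf p x \<le> \<alpha> / (4 * real N)"
    and mass: "\<alpha> \<le> measure_pmf.prob p G" and "0 < \<alpha>"
    and m: "32 \<le> real m * \<alpha>" "256 * real N \<le> (real m * \<alpha>)\<^sup>2"
  shows "measure_pmf.prob (replicate_pmf (m + m) p)
    {xs. \<exists>x\<in>set xs. \<exists>y\<in>set xs. x \<in> G \<and> y \<in> G \<and> f x = f y \<and> x \<noteq> y} \<ge> 1 / 2"
proof -
  define a where "a v = measure_pmf.prob p {x \<in> G. f x = v}" for v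
  \<comment> \<open>Classes below half of \<open>\<alpha> / N\<close> are ignored. There are at most
    \<open>N\<close> of them, so they carry at most \<open>\<alpha> / 2\<close>, and
    \<open>H\<close> keeps at least the other half.\<close>
  define HV where "HV = {v \<in> VV. \<alpha> / (2 * real N) \<le> a v}"
  define H where "H = sum a HV"
  define hit where "hit xs = f ` (set xs \<inter> G) \<inter> HV" for xs
  define D where "D xs = sum a (hit xs)" for xs
  \<comment> \<open>The potential is the reciprocal power, cut off to 0 as soon as half of the heavy
    weight is hit; each sample shrinks its expectation by the factor
    \<open>1 - H / 4\<close>.\<close>
  define \<Phi> where "\<Phi> xs = (if D xs < H / 2 then (1 / 2) ^ card (hit xs) else 0 :: real)" for xs
  have finHV: "finite HV" using VV by (auto simp: HV_def)
  have finhit: "finite (hit xs)" for xs using finHV by (auto simp: hit_def)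
  have hitHV: "hit xs \<subseteq> HV" for xs by (auto simp: hit_def)
  have a0: "0 \<le> a v" for v by (simp add: a_def)
  have sum_a: "sum a S = measure_pmf.prob p {x \<in> G. f x \<in> S}" if "finite S" for S
  proof -
    have "measure_pmf.prob p (\<Union>v\<in>S. {x \<in> G. f x = v}) = sum a S"
      unfolding a_def using that
      by (intro measure_pmf.finite_measure_finite_Union) (auto simp: disjoint_family_on_def)
    moreover have "(\<Union>v\<in>S. {x \<in> G. f x = v}) = {x \<in> G. f x \<in> S}" by auto
    ultimately show ?thesis by simp
  qed
  have N0: "0 < N"
  proof (rule ccontr)
    assume "\<not> 0 < N"
    then have "VV = {}" using VV by simp
    then have "G = {}" using VV by auto
    then show False using mass \<open>0 < \<alpha>\<close> by simp
  qed
  have H: "\<alpha> / 2 \<le> H"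
  proof -
    have "{x \<in> G. f x \<in> VV} = G" using VV by auto
    then have "\<alpha> \<le> sum a VV" using mass sum_a[OF VV(1)] by simp
    also have "\<dots> = H + sum a (VV - HV)"
      unfolding H_def using VV by (subst sum.subset_diff[of HV]) (auto simp: HV_def)
    also have "sum a (VV - HV) \<le> (\<Sum>v\<in>VV - HV. \<alpha> / (2 * real N))"
      by (intro sum_mono) (auto simp: HV_def)
    also have "\<dots> = real (card (VV - HV)) * (\<alpha> / (2 * real N))" by simp
    also have "\<dots> \<le> real N * (\<alpha> / (2 * real N))"
      using VV \<open>0 < \<alpha>\<close> card_mono[of VV "VV - HV"] by (intro mult_right_mono) auto
    also have "\<dots> = \<alpha> / 2" using N0 by simp
    finally show ?thesis by simp
  qed
  have H1: "H \<le> 1" unfolding H_def using sum_a[OF finHV] by simp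
  have step: "measure_pmf.expectation p (\<lambda>x. \<Phi> (x # xs)) \<le> (1 - H / 4) * \<Phi> xs" for xs
  proof (cases "D xs < H / 2")
    case False
    have "D xs \<le> D (x # xs)" for x
      unfolding D_def by (intro sum_mono2 finhit a0) (auto simp: hit_def)
    then have "\<Phi> (x # xs) = 0" for x
      using False unfolding \<Phi>_def by (smt (verit))
    then show ?thesis using False by (simp add: \<Phi>_def)
  next
    case True
    \<comment> \<open>While less than half of the heavy weight is hit, a sample hits a new heavy
      class with probability at least \<open>H / 2\<close>, which halves the potential. The expected
      factor is thus at most \<open>1 - H / 4\<close>.\<close>
    define NW where "NW = {x \<in> G. f x \<in> HV - hit xs}"
    have NW: "measure_pmf.prob p NW = H - D xs"
      unfolding NW_def H_def D_def using finHV hitHV[of xs]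
      by (subst sum_a[symmetric]) (auto simp: sum_diff)
    have le: "\<Phi> (x # xs) \<le> \<Phi> xs * (1 - indicator NW x / 2)" for x
    proof (cases "x \<in> NW")
      case True
      then have "hit (x # xs) = insert (f x) (hit xs)" "f x \<notin> hit xs" by (auto simp: hit_def NW_def)
      then have "card (hit (x # xs)) = Suc (card (hit xs))" using finhit by simp
      then show ?thesis using True \<open>D xs < H / 2\<close> by (simp add: \<Phi>_def)
    next
      case False
      then have "hit (x # xs) = hit xs" by (auto simp: hit_def NW_def)
      then show ?thesis using False by (simp add: \<Phi>_def D_def)
    qed
    have "measure_pmf.expectation p (\<lambda>x. \<Phi> (x # xs)) \<le>
        measure_pmf.expectation p (\<lambda>x. \<Phi> xs * (1 - indicator NW x / 2))"
      using fin le by (intro expectation_mono_finite)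
    also have "\<dots> = \<Phi> xs * (1 - (H - D xs) / 2)"
      using fin by (simp add: integrable_measure_pmf_finite Bochner_Integration.integral_diff NW)
    also have "\<dots> \<le> \<Phi> xs * (1 - H / 4)"
      using True by (intro mult_left_mono) (auto simp: \<Phi>_def)
    finally show ?thesis by (simp add: mult.commute)
  qed
  have pot: "measure_pmf.expectation (replicate_pmf j p) \<Phi> \<le> (1 - H / 4) ^ j" for j
  proof (induction j)
    case 0
    show ?case by (simp add: \<Phi>_def hit_def)
  next
    case (Suc j)
    have "measure_pmf.expectation (replicate_pmf (Suc j) p) \<Phi>
        \<le> measure_pmf.expectation (replicate_pmf j p) (\<lambda>xs. (1 - H / 4) * \<Phi> xs)"
      unfolding expectation_replicate_Suc[OF fin] using fin step
      by (intro expectation_mono_finite) auto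
    also have "\<dots> = (1 - H / 4) * measure_pmf.expectation (replicate_pmf j p) \<Phi>" by simp
    also have "\<dots> \<le> (1 - H / 4) * (1 - H / 4) ^ j"
      using Suc H1 by (intro mult_left_mono) auto
    finally show ?case by simp
  qed
  \<comment> \<open>With this threshold \<open>2 ^ k\<close> is at most
    \<open>exp (real m * \<alpha> / 16)\<close>, while the expected potential is at most
    \<open>exp (- real m * \<alpha> / 8)\<close>. The product is at most \<open>exp (-2)\<close>, as
    \<open>real m * \<alpha>\<close> is at least 32.\<close>
  define k where "k = nat \<lfloor>real m * \<alpha> / 16\<rfloor>"
  have k: "real k \<le> real m * \<alpha> / 16" "real m * \<alpha> / 32 \<le> real k"
    using m(1) unfolding k_def by linarith+
  \<comment> \<open>If \<open>D xs\<close> is below both terms of the minimum, the potential is not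
    cut off and fewer than \<open>k\<close> classes are hit, so it exceeds \<open>1 / 2 ^ k\<close>;
    Markov's inequality then bounds the probability of \<open>Bad\<close>.\<close>
  define D0 where "D0 = min (H / 2) (real k * (\<alpha> / (2 * real N)))"
  define Bad where "Bad = {xs. D xs < D0}"
  have exp2: "exp (-2) \<le> (1 / 4 :: real)"
  proof -
    have "exp (-2) = exp (-1) * exp (-1 :: real)" by (simp flip: exp_add)
    also have "\<dots> \<le> (1 / 2) * (1 / 2)"
      using exp_ge_add_one_self[of 1] by (intro mult_mono) (auto simp: exp_minus field_simps)
    finally show ?thesis by simp
  qed
  have bad: "measure_pmf.prob (replicate_pmf m p) Bad \<le> 1 / 4"
  proof -
    have "indicator Bad xs \<le> 2 ^ k * \<Phi> xs" for xs
    proof (cases "xs \<in> Bad")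
      case True
      then have lt: "D xs < H / 2" "D xs < real k * (\<alpha> / (2 * real N))" by (auto simp: Bad_def D0_def)
      have "real (card (hit xs)) * (\<alpha> / (2 * real N)) = (\<Sum>v\<in>hit xs. \<alpha> / (2 * real N))" by simp
      also have "\<dots> \<le> D xs" unfolding D_def using hitHV by (intro sum_mono) (auto simp: HV_def)
      finally have "real (card (hit xs)) * (\<alpha> / (2 * real N)) < real k * (\<alpha> / (2 * real N))"
        using lt by simp
      then have "card (hit xs) < k" using \<open>0 < \<alpha>\<close> N0 by (simp add: mult_less_cancel_right divide_simps)
      then have "(2::real) ^ card (hit xs) \<le> 2 ^ k" by simp
      then show ?thesis using True lt(1) by (simp add: \<Phi>_def field_simps)
    next
      case False
      then show ?thesis by (simp add: \<Phi>_def)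
    qed
    then have "measure_pmf.prob (replicate_pmf m p) Bad
        \<le> measure_pmf.expectation (replicate_pmf m p) (\<lambda>xs. 2 ^ k * \<Phi> xs)"
      unfolding prob_eq_expectation using fin by (intro expectation_mono_finite) auto
    also have "\<dots> \<le> 2 ^ k * (1 - H / 4) ^ m" using pot[of m] by simp
    also have "(1 - H / 4) ^ m \<le> exp (- (H / 4)) ^ m"
      using H1 exp_ge_add_one_self[of "- (H / 4)"] by (intro power_mono) auto
    also have "exp (- (H / 4)) ^ m = exp (- (real m * (H / 4)))"
      by (simp flip: exp_of_nat_mult)
    also have "(2::real) ^ k \<le> exp 1 ^ k"
      using exp_ge_add_one_self[of 1] by (intro power_mono) auto
    also have "exp (1::real) ^ k = exp (real k)" by (simp flip: exp_of_nat_mult)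
    also have "exp (real k) * exp (- (real m * (H / 4))) = exp (real k - real m * (H / 4))"
      by (simp flip: exp_add)
    also have "\<dots> \<le> exp (-2)"
    proof -
      have "real m * (\<alpha> / 2) \<le> real m * H" using H by (intro mult_left_mono) auto
      then show ?thesis using k(1) m(1) by simp
    qed
    finally show ?thesis using exp2 by simp
  qed
  let ?C = "{xs. \<exists>x\<in>set xs. \<exists>y\<in>set xs. x \<in> G \<and> y \<in> G \<and> f x = f y \<and> x \<noteq> y}"
  have good: "measure_pmf.prob (replicate_pmf m p) {ys. xs @ ys \<notin> ?C} \<le> 1 / 4" if "xs \<notin> Bad" for xs
  proof -
    define W where "W = {y \<in> G. \<exists>x\<in>set xs. x \<in> G \<and> f x = f y \<and> x \<noteq> y}"
    \<comment> \<open>Pick a sampled element \<open>g v\<close> of each hit class. Avoiding this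
      single element costs at most \<open>\<alpha> / (4 * real N)\<close>, which is at most half the
      weight of a heavy class.\<close>
    have "\<forall>v\<in>hit xs. \<exists>x. x \<in> set xs \<and> x \<in> G \<and> f x = v" by (auto simp: hit_def)
    then obtain g where g: "\<And>v. v \<in> hit xs \<Longrightarrow> g v \<in> set xs \<and> g v \<in> G \<and> f (g v) = v" by metis
    have "D xs / 2 = (\<Sum>v\<in>hit xs. a v / 2)" by (simp add: D_def sum_divide_distrib)
    also have "\<dots> \<le> (\<Sum>v\<in>hit xs. measure_pmf.prob p {y \<in> G. f y = v \<and> y \<noteq> g v})"
    proof (rule sum_mono)
      fix v assume v: "v \<in> hit xs"
      have "{x \<in> G. f x = v} = insert (g v) {y \<in> G. f y = v \<and> y \<noteq> g v}" using g[OF v] by auto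
      then have "a v = measure_pmf.prob p {g v} + measure_pmf.prob p {y \<in> G. f y = v \<and> y \<noteq> g v}"
        unfolding a_def by (subst measure_pmf.finite_measure_Union[symmetric]) auto
      moreover have "pmf p (g v) \<le> \<alpha> / (4 * real N)" using light g[OF v] by blast
      moreover have "\<alpha> / (2 * real N) \<le> a v" using v hitHV by (auto simp: HV_def)
      ultimately show "a v / 2 \<le> measure_pmf.prob p {y \<in> G. f y = v \<and> y \<noteq> g v}"
        by (simp add: measure_pmf_single)
    qed
    also have "\<dots> = measure_pmf.prob p (\<Union>v\<in>hit xs. {y \<in> G. f y = v \<and> y \<noteq> g v})"
      by (intro measure_pmf.finite_measure_finite_Union[symmetric] finhit) (auto simp: disjoint_family_on_def)
    also have "\<dots> \<le> measure_pmf.prob p W"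
    proof (intro measure_pmf.finite_measure_mono)
      show "(\<Union>v\<in>hit xs. {y \<in> G. f y = v \<and> y \<noteq> g v}) \<subseteq> W"
        unfolding W_def using g by fastforce
    qed simp
    finally have W: "D xs / 2 \<le> measure_pmf.prob p W" .
    have "measure_pmf.prob (replicate_pmf m p) {ys. xs @ ys \<notin> ?C}
        \<le> measure_pmf.prob (replicate_pmf m p) {ys. set ys \<subseteq> - W}"
      by (intro measure_pmf.finite_measure_mono) (auto simp: W_def)
    also have "\<dots> = (1 - measure_pmf.prob p W) ^ m"
      by (simp add: prob_replicate_all[OF fin] measure_pmf.prob_compl[of W p, simplified] Compl_eq_Diff_UNIV)
    also have "\<dots> \<le> exp (- measure_pmf.prob p W) ^ m"
      using exp_ge_add_one_self[of "- measure_pmf.prob p W"] by (intro power_mono) auto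
    also have "\<dots> = exp (- (real m * measure_pmf.prob p W))" by (simp flip: exp_of_nat_mult)
    also have "\<dots> \<le> exp (-2)"
    proof -
      \<comment> \<open>If \<open>H / 2\<close> is the minimum, \<open>real m * \<alpha> / 4\<close>
        is already at least 8. Otherwise \<open>k\<close> is at least
        \<open>real m * \<alpha> / 32\<close>, so \<open>real m * D0\<close> is at least
        \<open>(real m * \<alpha>)\<^sup>2 / (64 * real N)\<close>, and 256 / 64 = 4.\<close>
      have "4 \<le> real m * D0"
      proof (cases "H / 2 \<le> real k * (\<alpha> / (2 * real N))")
        case True
        have "real m * (\<alpha> / 4) \<le> real m * (H / 2)" using H by (intro mult_left_mono) auto
        then show ?thesis using True m(1) by (simp add: D0_def mult_ac)
      next
        case False
        have "4 * real N \<le> (real m * \<alpha>)\<^sup>2 / 64" using m(2) by simp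
        also have "\<dots> = (real m * \<alpha> / 32) * (real m * \<alpha> / 2)" by (simp add: power2_eq_square)
        also have "\<dots> \<le> real k * (real m * \<alpha> / 2)"
          using k(2) m(1) by (intro mult_right_mono) auto
        finally have "4 \<le> real k * (real m * \<alpha> / 2) / real N" using N0 by (simp add: field_simps)
        then show ?thesis using False by (simp add: D0_def mult_ac)
      qed
      also have "real m * D0 \<le> real m * (2 * measure_pmf.prob p W)"
        using W that by (intro mult_left_mono) (auto simp: Bad_def)
      finally show ?thesis by simp
    qed
    finally show ?thesis using exp2 by simp
  qed
  have "measure_pmf.prob (replicate_pmf (m + m) p) (- ?C) =
     measure_pmf.expectation (replicate_pmf m p)
       (\<lambda>xs. measure_pmf.prob (replicate_pmf m p) {ys. xs @ ys \<notin> ?C})"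
    unfolding prob_replicate_add[OF fin] by simp
  also have "\<dots> \<le> measure_pmf.expectation (replicate_pmf m p) (\<lambda>xs. indicator Bad xs + 1 / 4)"
  proof (rule expectation_mono_finite)
    fix xs
    show "measure_pmf.prob (replicate_pmf m p) {ys. xs @ ys \<notin> ?C} \<le> indicator Bad xs + 1 / 4"
    proof (cases "xs \<in> Bad")
      case True
      then show ?thesis by (intro order_trans[OF measure_pmf.prob_le_1]) simp
    next
      case False
      then show ?thesis using good[OF False] by simp
    qed
  qed (use fin in auto)
  also have "\<dots> = measure_pmf.prob (replicate_pmf m p) Bad + 1 / 4"
    using fin by (subst Bochner_Integration.integral_add) (auto intro!: integrable_measure_pmf_finite)
  also have "\<dots> \<le> 1 / 2" using bad by simp
  finally show ?thesis
    using measure_pmf.prob_compl[of ?C "replicate_pmf (m + m) p"] by (simp add: Compl_eq_Diff_UNIV)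
qed

section \<open>Random walks are unpredictable\<close>

lemma card_residue_class:
  assumes "0 < c" "i < c"
  shows "card {r \<in> {1..c * k}. r mod c = i} = (k::nat)"
proof -
  \<comment> \<open>Since the range starts at 1, the residue class of 0 starts with
    \<open>c\<close>.\<close>
  have "{r \<in> {1..c * k}. r mod c = i} = (\<lambda>j. j * c + (if i = 0 then c else i)) ` {..<k}"
  proof (intro equalityI subsetI)
    fix r assume "r \<in> {r \<in> {1..c * k}. r mod c = i}"
    then have r: "1 \<le> r" "r \<le> c * k" "r mod c = i" by auto
    have rd: "r = r div c * c + i" using r(3) by (metis div_mult_mod_eq)
    show "r \<in> (\<lambda>j. j * c + (if i = 0 then c else i)) ` {..<k}"
    proof (cases "i = 0")
      case True
      then have "0 < r div c" using rd r(1) by (cases "r div c") auto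
      then obtain j where j: "r div c = Suc j" using gr0_implies_Suc by blast
      have "r = j * c + c" using rd j True by simp
      moreover have "j < k"
      proof -
        have "Suc j * c \<le> k * c" using r(2) \<open>r = j * c + c\<close> by (simp add: mult.commute)
        then show ?thesis using assms(1) by (metis Suc_le_eq mult_le_cancel2)
      qed
      ultimately show ?thesis using True by auto
    next
      case False
      have "k * c = c * k" by simp
      then have "r div c * c < k * c" using rd r(2) False by linarith
      then have "r div c < k" using assms(1) by (metis mult_less_cancel2)
      then show ?thesis using False rd by auto
    qed
  next
    fix r assume "r \<in> (\<lambda>j. j * c + (if i = 0 then c else i)) ` {..<k}"
    then obtain j where j: "j < k" "r = j * c + (if i = 0 then c else i)" by auto
    have "Suc j * c \<le> k * c" using j(1) by (intro mult_le_mono1) auto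
    then have "r \<le> c * k" using j assms by (auto simp: mult.commute)
    then show "r \<in> {r \<in> {1..c * k}. r mod c = i}" using j assms by auto
  qed
  moreover have "inj_on (\<lambda>j. j * c + (if i = 0 then c else i)) {..<k}"
    by (rule inj_onI) (use assms in auto)
  ultimately show ?thesis by (simp only: card_image card_lessThan)
qed

text \<open>A range whose size is a multiple of \<open>c\<close> contains each residue equally
  often. One fixed range whose size is divisible by all numbers up to \<open>d\<close> thus serves
  every vertex degree.\<close>

lemma map_mod_pmf_of_set:
  assumes "0 < Q" "c dvd Q"
  shows "map_pmf (\<lambda>r. r mod c) (pmf_of_set {1..Q}) = pmf_of_set {..<c::nat}"
proof (rule pmf_eqI)
  fix i
  obtain k where k: "Q = c * k" using assms(2) by auto
  have ck: "0 < c" "0 < k" using assms(1) k by auto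
  have "pmf (map_pmf (\<lambda>r. r mod c) (pmf_of_set {1..Q})) i = card ({1..Q} \<inter> (\<lambda>r. r mod c) -` {i}) / Q"
    using assms by (simp add: pmf_map measure_pmf_of_set)
  also have "{1..Q} \<inter> (\<lambda>r. r mod c) -` {i} = {r \<in> {1..c * k}. r mod c = i}" using k by auto
  also have "card \<dots> = (if i < c then k else 0)"
  proof (cases "i < c")
    case False
    then have "{r \<in> {1..c * k}. r mod c = i} = {}" using ck mod_less_divisor by blast
    then show ?thesis using False by simp
  qed (use ck card_residue_class in simp)
  finally show "pmf (map_pmf (\<lambda>r. r mod c) (pmf_of_set {1..Q})) i = pmf (pmf_of_set {..<c}) i"
    using ck k pmf_of_set[of "{..<c}" i] by (auto simp: indicator_def lessThan_empty_iff)
qed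

context adjacency_graph begin

definition walk_pmf :: "nat \<Rightarrow> nat \<Rightarrow> nat \<Rightarrow> nat \<Rightarrow> nat \<Rightarrow> nat list option pmf" where
  "walk_pmf B Q L u v = map_pmf (\<lambda>rs. walk B rs u v) (replicate_pmf L (pmf_of_set {1..Q}))"

lemma finite_walk_pmf: "0 < Q \<Longrightarrow> finite (set_pmf (walk_pmf B Q L u v))"
  unfolding walk_pmf_def by (auto intro!: finite_imageI finite_replicate_pmf)

lemma walk_pmf_0: "walk_pmf B Q 0 u v = return_pmf (Some [u, v])"
  by (simp add: walk_pmf_def)

lemma walk_pmf_support:
  "Some p \<in> set_pmf (walk_pmf B Q L u v) \<Longrightarrow> length p = L + 2 \<and> p ! 0 = u \<and> p ! 1 = v"
  using walk_length by (fastforce simp: walk_pmf_def set_replicate_pmf)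

lemma walk_pmf_Suc_dead:
  "kids B u v = [] \<Longrightarrow> walk_pmf B Q (Suc L) u v = return_pmf None"
  by (simp add: walk_pmf_def map_bind_pmf map_pmf_def bind_assoc_pmf bind_return_pmf)

lemma map_kids_pmf:
  assumes "(u, v) \<in> arcs" "kids B u v \<noteq> []" "0 < Q" "\<forall>c. 1 \<le> c \<longrightarrow> c \<le> d \<longrightarrow> c dvd Q"
  shows "map_pmf (\<lambda>r. kids B u v ! (r mod length (kids B u v))) (pmf_of_set {1..Q}) = pmf_of_set (set (kids B u v))"
proof -
  let ?ks = "kids B u v"
  have c: "length ?ks dvd Q" using assms length_kids by (simp add: Suc_leI)
  have "map_pmf (\<lambda>r. ?ks ! (r mod length ?ks)) (pmf_of_set {1..Q})
      = map_pmf ((!) ?ks) (map_pmf (\<lambda>r. r mod length ?ks) (pmf_of_set {1..Q}))"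
    by (simp add: pmf.map_comp o_def)
  also have "\<dots> = map_pmf ((!) ?ks) (pmf_of_set {..<length ?ks})"
    using map_mod_pmf_of_set[OF assms(3) c] by simp
  also have "\<dots> = pmf_of_set ((!) ?ks ` {..<length ?ks})"
    by (rule map_pmf_of_set_inj) (use assms(2) inj_on_nth[OF distinct_kids[OF assms(1)]] in auto)
  also have "(!) ?ks ` {..<length ?ks} = set ?ks"
    by (auto simp: set_conv_nth)
  finally show ?thesis .
qed

lemma walk_pmf_Suc:
  assumes "(u, v) \<in> arcs" "kids B u v \<noteq> []" "0 < Q" "\<forall>c. 1 \<le> c \<longrightarrow> c \<le> d \<longrightarrow> c dvd Q"
  shows "walk_pmf B Q (Suc L) u v =
    bind_pmf (pmf_of_set (set (kids B u v))) (\<lambda>w. map_pmf (map_option (Cons u)) (walk_pmf B Q L v w))"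
proof -
  let ?ks = "kids B u v" and ?U = "pmf_of_set {1..Q}"
  have "walk_pmf B Q (Suc L) u v = bind_pmf ?U
     (\<lambda>r. map_pmf (map_option (Cons u)) (walk_pmf B Q L v (?ks ! (r mod length ?ks))))"
    using assms(2) by (simp add: walk_pmf_def map_bind_pmf map_pmf_def bind_assoc_pmf bind_return_pmf)
  also have "\<dots> = bind_pmf (map_pmf (\<lambda>r. ?ks ! (r mod length ?ks)) ?U)
     (\<lambda>w. map_pmf (map_option (Cons u)) (walk_pmf B Q L v w))"
    by (simp add: bind_map_pmf)
  finally show ?thesis using map_kids_pmf[OF assms] by simp
qed

text \<open>The transition operator of the walk, applied to a function on arcs. At a dead end the
  empty sum makes it 0.\<close>

definition average :: "nat \<Rightarrow> (nat \<Rightarrow> nat \<Rightarrow> real) \<Rightarrow> nat \<Rightarrow> nat \<Rightarrow> real" where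
  "average B f u v = (\<Sum>w\<in>set (kids B u v). f v w) / real (card (set (kids B u v)))"

lemma average_mono:
  "(\<And>w. w \<in> set (kids B u v) \<Longrightarrow> f v w \<le> g v w) \<Longrightarrow> average B f u v \<le> average B g u v"
  unfolding average_def by (intro divide_right_mono sum_mono) auto

lemma average_nonneg: "(\<And>w. w \<in> set (kids B u v) \<Longrightarrow> 0 \<le> f v w) \<Longrightarrow> 0 \<le> average B f u v"
  unfolding average_def by (intro divide_nonneg_nonneg sum_nonneg) auto

lemma average_affine:
  assumes "kids B u v \<noteq> []"
  shows "average B (\<lambda>v w. a + c * (f v w + g v w)) u v = a + c * (average B f u v + average B g u v)"
proof -
  have "card (set (kids B u v)) \<noteq> 0" using assms by simp
  then show ?thesis
    unfolding average_def by (simp add: sum.distrib flip: sum_distrib_left) (simp add: field_simps)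
qed

lemma prob_walk_Suc:
  assumes "(u, v) \<in> arcs" "kids B u v \<noteq> []" "0 < Q" "\<forall>c. 1 \<le> c \<longrightarrow> c \<le> d \<longrightarrow> c dvd Q"
  shows "measure_pmf.prob (walk_pmf B Q (Suc L) u v) X =
    average B (\<lambda>v w. measure_pmf.prob (walk_pmf B Q L v w) (map_option (Cons u) -` X)) u v"
proof -
  have "finite (set_pmf (pmf_of_set (set (kids B u v))))" using assms(2) by simp
  then show ?thesis
    unfolding walk_pmf_Suc[OF assms] average_def using assms(2) finite_walk_pmf[OF assms(3)]
    by (simp add: prob_bind_finite integral_pmf_of_set)
qed

section \<open>Stationarity on the live arcs\<close>

definition neighbours :: "nat \<Rightarrow> nat \<Rightarrow> nat set" where
  "neighbours B v = {w. (v, w) \<in> live B}"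

lemma finite_neighbours: "finite (neighbours B v)"
proof -
  have "neighbours B v \<subseteq> snd ` live B" by (force simp: neighbours_def)
  then show ?thesis using finite_live finite_subset by blast
qed

lemma kids_neighbours: "(u, v) \<in> live B \<Longrightarrow> set (kids B u v) = neighbours B v - {u} \<and> u \<in> neighbours B v"
  using kids_live live_sym by (auto simp: neighbours_def)

lemma card_kids:
  "(u, v) \<in> live B \<Longrightarrow> card (set (kids B u v)) = card (neighbours B v) - 1 \<and> 1 \<le> card (neighbours B v)"
  using kids_neighbours[of u v B] finite_neighbours[of B v]
  by (auto simp: card_Diff_singleton Suc_le_eq card_gt_0_iff)

lemma sum_live1: "(\<Sum>(v, w)\<in>live B. f v w) = (\<Sum>v\<in>vertices. \<Sum>w\<in>neighbours B v. f v w)"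
proof -
  have "live B = (SIGMA v:vertices. neighbours B v)"
    using live_arcs arcs_vertices by (fastforce simp: neighbours_def)
  then show ?thesis by (simp add: sum.Sigma finite_neighbours)
qed

text \<open>Liveness is symmetric, so the arcs into \<open>v\<close> are indexed by the same
  neighbour set as the arcs out of \<open>v\<close>. Stationarity is proved by grouping one sum by
  heads and the other by tails.\<close>

lemma sum_live2: "(\<Sum>(u, v)\<in>live B. f u v) = (\<Sum>v\<in>vertices. \<Sum>u\<in>neighbours B v. f u v)"
proof -
  have "(\<Sum>(u, v)\<in>live B. f u v) = (\<Sum>(v, u)\<in>live B. f u v)"
    by (rule sum.reindex_bij_witness[of _ prod.swap prod.swap]) (use live_sym in auto)
  then show ?thesis using sum_live1[of "\<lambda>v u. f u v"] by simp
qed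

lemma card_leaves_eq: "card (leaves B) = (\<Sum>v\<in>vertices. if card (neighbours B v) = 1 then 1 else 0)"
proof -
  have "real (card (leaves B)) = (\<Sum>(u, v)\<in>live B. if kids B u v = [] then 1 else 0)"
    unfolding leaves_def using finite_live
    by (simp add: sum.If_cases case_prod_unfold Int_def conj_commute)
  also have "\<dots> = (\<Sum>v\<in>vertices. \<Sum>u\<in>neighbours B v. if kids B u v = [] then 1 else 0)"
    by (rule sum_live2)
  also have "\<dots> = (\<Sum>v\<in>vertices. if card (neighbours B v) = 1 then 1 else 0)"
  proof (rule sum.cong[OF refl])
    fix v
    have "(\<Sum>u\<in>neighbours B v. if kids B u v = [] then 1 else 0 :: real)
        = (\<Sum>u\<in>neighbours B v. if card (neighbours B v) = 1 then 1 else 0)"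
    proof (rule sum.cong[OF refl])
      fix u assume "u \<in> neighbours B v"
      then have "(u, v) \<in> live B" using live_sym by (simp add: neighbours_def)
      then have "card (set (kids B u v)) = card (neighbours B v) - 1" "1 \<le> card (neighbours B v)"
        using card_kids by blast+
      moreover have "kids B u v = [] \<longleftrightarrow> card (set (kids B u v)) = 0" by simp
      ultimately show "(if kids B u v = [] then 1 else 0 :: real) = (if card (neighbours B v) = 1 then 1 else 0)"
        by auto
    qed
    then show "(\<Sum>u\<in>neighbours B v. if kids B u v = [] then 1 else 0 :: real)
        = (if card (neighbours B v) = 1 then 1 else 0)" by simp
  qed
  also have "\<dots> = real (\<Sum>v\<in>vertices. if card (neighbours B v) = 1 then 1 else 0)"
    unfolding of_nat_sum by (intro sum.cong) auto
  finally show ?thesis by linarith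
qed

text \<open>The uniform distribution on the live arcs is stationary, except for the walks that get stuck.\<close>

lemma sum_average:
  assumes f: "\<And>v w. 0 \<le> f v w" "\<And>v w. f v w \<le> C"
  shows "(\<Sum>(u, v)\<in>live B. average B f u v) \<le> (\<Sum>(u, v)\<in>live B. f u v)"
    and "(\<Sum>(u, v)\<in>live B. f u v) - C * real (card (leaves B)) \<le> (\<Sum>(u, v)\<in>live B. average B f u v)"
proof -
  let ?s = "\<lambda>v. \<Sum>w\<in>neighbours B v. f v w"
  \<comment> \<open>At a vertex of live degree \<open>k\<close>, each outgoing arc is chosen with
    probability \<open>1 / (k - 1)\<close> from each of the \<open>k - 1\<close> arcs that enter
    along other edges, so its value is counted exactly once in total. Only at degree 1 the value is
    lost.\<close>
  have eq: "(\<Sum>u\<in>neighbours B v. average B f u v) = (if card (neighbours B v) = 1 then 0 else ?s v)" for v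
  proof -
    let ?S = "neighbours B v"
    have "(\<Sum>u\<in>?S. average B f u v) = (\<Sum>u\<in>?S. (?s v - f v u) / (real (card ?S) - 1))"
    proof (rule sum.cong[OF refl])
      fix u assume u: "u \<in> ?S"
      then have uv: "(u, v) \<in> live B" using live_sym by (simp add: neighbours_def)
      have "real (card ?S - 1) = real (card ?S) - 1" using card_kids[OF uv] by simp
      then show "average B f u v = (?s v - f v u) / (real (card ?S) - 1)"
        unfolding average_def using card_kids[OF uv] kids_neighbours[OF uv] finite_neighbours[of B v]
        by (simp add: sum_diff1)
    qed
    also have "\<dots> = (real (card ?S) * ?s v - ?s v) / (real (card ?S) - 1)"
      by (simp add: sum_divide_distrib[symmetric] sum_subtractf)
    also have "\<dots> = (if card ?S = 1 then 0 else ?s v)"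
    proof (cases "card ?S = 1")
      case False
      then have "real (card ?S) - 1 \<noteq> 0" by simp
      moreover have "real (card ?S) * ?s v - ?s v = (real (card ?S) - 1) * ?s v" by (simp add: algebra_simps)
      ultimately show ?thesis using False by simp
    qed simp
    finally show ?thesis .
  qed
  have A: "(\<Sum>(u, v)\<in>live B. average B f u v) = (\<Sum>v\<in>vertices. if card (neighbours B v) = 1 then 0 else ?s v)"
    unfolding sum_live2 by (simp only: eq)
  have F: "(\<Sum>(u, v)\<in>live B. f u v) = (\<Sum>v\<in>vertices. ?s v)" by (rule sum_live1)
  show "(\<Sum>(u, v)\<in>live B. average B f u v) \<le> (\<Sum>(u, v)\<in>live B. f u v)"
    unfolding A F using f by (intro sum_mono) (auto intro: sum_nonneg)
  have "(\<Sum>v\<in>vertices. ?s v) \<le> (\<Sum>v\<in>vertices. (if card (neighbours B v) = 1 then 0 else ?s v)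
      + C * (if card (neighbours B v) = 1 then 1 else 0))"
  proof (intro sum_mono)
    fix v
    show "?s v \<le> (if card (neighbours B v) = 1 then 0 else ?s v) + C * (if card (neighbours B v) = 1 then 1 else 0)"
    proof (cases "card (neighbours B v) = 1")
      case True
      have "?s v \<le> (\<Sum>w\<in>neighbours B v. C)" using f by (intro sum_mono) auto
      then show ?thesis using True by simp
    qed simp
  qed
  also have "\<dots> = (\<Sum>v\<in>vertices. if card (neighbours B v) = 1 then 0 else ?s v) + C * real (card (leaves B))"
    unfolding card_leaves_eq of_nat_sum sum_distrib_left sum.distrib
    by (intro arg_cong2[where f = "(+)"] refl sum.cong) auto
  finally show "(\<Sum>(u, v)\<in>live B. f u v) - C * real (card (leaves B)) \<le> (\<Sum>(u, v)\<in>live B. average B f u v)"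
    unfolding A F by simp
qed

section \<open>Light walks and the expected number of branchings\<close>

definition stuck_prob :: "nat \<Rightarrow> nat \<Rightarrow> nat \<Rightarrow> nat \<Rightarrow> nat \<Rightarrow> real" where
  "stuck_prob B Q L u v = measure_pmf.prob (walk_pmf B Q L u v) {None}"

text \<open>The threshold corresponds to \<open>z\<close> branchings, because each branching at
  least halves the probability of a walk.\<close>

definition light_walks :: "nat \<Rightarrow> nat \<Rightarrow> nat \<Rightarrow> nat \<Rightarrow> nat \<Rightarrow> nat \<Rightarrow> nat list option set" where
  "light_walks B Q L z u v = {Some p | p. pmf (walk_pmf B Q L u v) (Some p) \<le> (1 / 2) ^ z}"

definition light_prob :: "nat \<Rightarrow> nat \<Rightarrow> nat \<Rightarrow> nat \<Rightarrow> nat \<Rightarrow> nat \<Rightarrow> real" where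
  "light_prob B Q L z u v = measure_pmf.prob (walk_pmf B Q L u v) (light_walks B Q L z u v)"

definition is_branching :: "nat \<Rightarrow> nat \<Rightarrow> nat \<Rightarrow> nat" where
  "is_branching B u v = (if 2 \<le> card (set (kids B u v)) then 1 else 0)"

text \<open>The expected number of branching arcs among the first \<open>L\<close> arcs of a walk,
  by conditioning on the first step. A stuck walk contributes no further terms, as
  \<open>average\<close> is 0 at a dead end.\<close>

primrec branchings :: "nat \<Rightarrow> nat \<Rightarrow> nat \<Rightarrow> nat \<Rightarrow> real" where
  "branchings B 0 u v = 0"
| "branchings B (Suc L) u v = real (is_branching B u v) + average B (branchings B L) u v"

lemma average_const_le:
  assumes "\<And>w. w \<in> set (kids B u v) \<Longrightarrow> f v w \<le> a" "0 \<le> a"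
  shows "average B f u v \<le> a"
proof (cases "kids B u v = []")
  case False
  have "average B f u v \<le> average B (\<lambda>v w. a + 0 * (0 + 0)) u v"
    using assms by (intro average_mono) auto
  then show ?thesis by (subst (asm) average_affine[OF False]) simp
qed (simp add: average_def assms)

lemma branchings_bounds: "0 \<le> branchings B L u v \<and> branchings B L u v \<le> real L"
proof (induction L arbitrary: u v)
  case (Suc L)
  have "0 \<le> average B (branchings B L) u v" using Suc by (intro average_nonneg) auto
  moreover have "average B (branchings B L) u v \<le> real L" using Suc by (intro average_const_le) auto
  ultimately show ?case by (auto simp: is_branching_def)
qed simp

text \<open>Prefixing \<open>u\<close> divides the probability of a walk by the number of kids, so a
  branching arc pays for one more factor 1/2 in the threshold.\<close>

lemma light_prob_Suc:
  assumes "(u, v) \<in> arcs" "kids B u v \<noteq> []" "0 < Q" "\<forall>c. 1 \<le> c \<longrightarrow> c \<le> d \<longrightarrow> c dvd Q"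
    and z: "is_branching B u v + z' = z"
  shows "average B (light_prob B Q L z') u v \<le> light_prob B Q (Suc L) z u v"
proof -
  let ?K = "set (kids B u v)"
  have fK: "finite ?K" "?K \<noteq> {}" using assms(2) by auto
  have "light_prob B Q L z' v w \<le>
      measure_pmf.prob (walk_pmf B Q L v w) (map_option (Cons u) -` light_walks B Q (Suc L) z u v)"
    if w: "w \<in> ?K" for w
  proof -
    have sub: "light_walks B Q L z' v w \<inter> set_pmf (walk_pmf B Q L v w)
        \<subseteq> map_option (Cons u) -` light_walks B Q (Suc L) z u v"
    proof
      fix x assume x: "x \<in> light_walks B Q L z' v w \<inter> set_pmf (walk_pmf B Q L v w)"
      then obtain p where p: "x = Some p" "pmf (walk_pmf B Q L v w) (Some p) \<le> (1 / 2) ^ z'"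
        by (auto simp: light_walks_def)
      have pw: "p ! 1 = w" using x p walk_pmf_support by blast
      \<comment> \<open>The second vertex of \<open>p\<close> reveals which kid was chosen, so only
        one term of the mixture is nonzero.\<close>
      have other: "pmf (walk_pmf B Q L v w') (Some p) = 0" if "w' \<noteq> w" for w'
      proof -
        have "Some p \<notin> set_pmf (walk_pmf B Q L v w')" using walk_pmf_support pw that by blast
        then show ?thesis by (simp add: set_pmf_iff)
      qed
      have inj: "inj (map_option (Cons u))" by (rule option.inj_map) (auto simp: inj_def)
      have "pmf (walk_pmf B Q (Suc L) u v) (Some (u # p))
          = (\<Sum>w'\<in>?K. pmf (map_pmf (map_option (Cons u)) (walk_pmf B Q L v w')) (map_option (Cons u) (Some p)))
              / real (card ?K)"
        unfolding walk_pmf_Suc[OF assms(1-4)] pmf_bind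
        using fK by (subst integral_pmf_of_set) auto
      also have "\<dots> = (\<Sum>w'\<in>?K. pmf (walk_pmf B Q L v w') (Some p)) / real (card ?K)"
        by (simp only: pmf_map_inj'[OF inj])
      also have "(\<Sum>w'\<in>?K. pmf (walk_pmf B Q L v w') (Some p)) = pmf (walk_pmf B Q L v w) (Some p)"
        using fK(1) w other by (subst sum.remove[OF fK(1) w]) (auto intro!: sum.neutral)
      also have "pmf (walk_pmf B Q L v w) (Some p) / real (card ?K) \<le> (1 / 2) ^ z' / real (card ?K)"
        using p(2) by (rule divide_right_mono) simp
      also have "\<dots> \<le> (1 / 2) ^ z"
      proof (cases "2 \<le> card ?K")
        case True
        then have "z = Suc z'" using z by (simp add: is_branching_def)
        moreover have "(1 / 2) ^ z' / real (card ?K) \<le> (1 / 2) ^ z' / 2"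
          using True by (intro divide_left_mono) auto
        ultimately show ?thesis by simp
      next
        case False
        then have "z = z'" using z by (simp add: is_branching_def)
        moreover have "card ?K = 1"
          using False fK by (metis One_nat_def Suc_1 Suc_leI card_gt_0_iff le_antisym not_less_eq_eq)
        ultimately show ?thesis by simp
      qed
      finally show "x \<in> map_option (Cons u) -` light_walks B Q (Suc L) z u v"
        using p(1) by (auto simp: light_walks_def)
    qed
    have "light_prob B Q L z' v w
        = measure_pmf.prob (walk_pmf B Q L v w) (light_walks B Q L z' v w \<inter> set_pmf (walk_pmf B Q L v w))"
      unfolding light_prob_def by (rule measure_Int_set_pmf[symmetric])
    also have "\<dots> \<le> measure_pmf.prob (walk_pmf B Q L v w) (map_option (Cons u) -` light_walks B Q (Suc L) z u v)"
      using sub by (intro measure_pmf.finite_measure_mono) auto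
    finally show ?thesis .
  qed
  then have "average B (light_prob B Q L z') u v
      \<le> average B (\<lambda>x w. measure_pmf.prob (walk_pmf B Q L x w)
           (map_option (Cons u) -` light_walks B Q (Suc L) z u v)) u v"
    by (rule average_mono)
  then show ?thesis unfolding light_prob_def[of _ _ "Suc L"] prob_walk_Suc[OF assms(1-4)] .
qed

lemma stuck_prob_Suc:
  assumes "(u, v) \<in> arcs" "0 < Q" "\<forall>c. 1 \<le> c \<longrightarrow> c \<le> d \<longrightarrow> c dvd Q"
  shows "stuck_prob B Q (Suc L) u v =
    (if kids B u v = [] then 1 else average B (stuck_prob B Q L) u v)"
proof (cases "kids B u v = []")
  case True
  then show ?thesis by (simp add: stuck_prob_def walk_pmf_Suc_dead)
next
  case False
  have "map_option (Cons u) -` {None} = {None}" by auto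
  then show ?thesis using False unfolding stuck_prob_def
    by (simp add: prob_walk_Suc[OF assms(1) False assms(2,3)])
qed

text \<open>A walk that is neither light nor stuck meets fewer than \<open>z\<close> branchings, any
  other walk at most \<open>L\<close>. The induction lowers \<open>z\<close> at each branching arc;
  for \<open>z = 0\<close> every walk that is not stuck is light.\<close>

lemma branchings_le:
  assumes Q: "0 < Q" "\<forall>c. 1 \<le> c \<longrightarrow> c \<le> d \<longrightarrow> c dvd Q"
  shows "(u, v) \<in> live B \<Longrightarrow>
    branchings B L u v \<le> real z + real L * (light_prob B Q L z u v + stuck_prob B Q L u v)"
proof (induction L arbitrary: u v z)
  case (Suc L)
  have uv: "(u, v) \<in> arcs" using Suc.prems live_arcs by auto
  have nonneg: "0 \<le> light_prob B Q (Suc L) z u v" "0 \<le> stuck_prob B Q (Suc L) u v"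
    by (auto simp: light_prob_def stuck_prob_def)
  show ?case
  proof (cases "kids B u v = []")
    case True
    have "branchings B (Suc L) u v = 0" using True by (simp add: is_branching_def average_def)
    then show ?thesis using nonneg by simp
  next
    case kids: False
    show ?thesis
    proof (cases "z = 0")
      case True
      have "light_walks B Q (Suc L) z u v = - {None}"
        using True by (auto simp: light_walks_def pmf_le_1)
      then have "light_prob B Q (Suc L) z u v + stuck_prob B Q (Suc L) u v = 1"
        unfolding light_prob_def stuck_prob_def
        using measure_pmf.prob_compl[of "{None}" "walk_pmf B Q (Suc L) u v"]
        by (simp add: Compl_eq_Diff_UNIV)
      then show ?thesis using branchings_bounds[of B "Suc L" u v] by simp
    next
      case False
      define z' where "z' = z - is_branching B u v"
      have z: "is_branching B u v + z' = z" using False by (auto simp: z'_def is_branching_def)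
      have live: "(v, w) \<in> live B" if "w \<in> set (kids B u v)" for w
        using that kids_live[OF Suc.prems] by auto
      have "branchings B (Suc L) u v \<le> real (is_branching B u v)
          + average B (\<lambda>v w. real z' + real L * (light_prob B Q L z' v w + stuck_prob B Q L v w)) u v"
        unfolding branchings.simps using Suc.IH live by (intro add_left_mono average_mono) auto
      also have "\<dots> = real z + real L * (average B (light_prob B Q L z') u v + average B (stuck_prob B Q L) u v)"
        using z by (subst average_affine[OF kids]) (simp flip: z)
      also have "average B (stuck_prob B Q L) u v = stuck_prob B Q (Suc L) u v"
        using stuck_prob_Suc[OF uv Q] kids by simp
      also have "average B (light_prob B Q L z') u v \<le> light_prob B Q (Suc L) z u v"
        by (rule light_prob_Suc[OF uv kids Q z])
      also have "real z + real L * (light_prob B Q (Suc L) z u v + stuck_prob B Q (Suc L) u v)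
          \<le> real z + real (Suc L) * (light_prob B Q (Suc L) z u v + stuck_prob B Q (Suc L) u v)"
        using nonneg by (intro add_left_mono mult_right_mono) auto
      finally show ?thesis by (simp add: mult_left_mono)
    qed
  qed
qed simp

definition branching_arcs :: "nat \<Rightarrow> arc set" where
  "branching_arcs B = {(u, v) \<in> live B. 2 \<le> card (set (kids B u v))}"

text \<open>Under exact stationarity each of the \<open>L\<close> steps would contribute the number
  of branching arcs. Each application of \<open>sum_average\<close> loses at most the maximal value,
  which is at most \<open>L\<close>, for every leaf; over \<open>L\<close> steps this is at most
  \<open>L ^ 2\<close> per leaf.\<close>

lemma sum_branchings:
  "real L * real (card (branching_arcs B)) - real L ^ 2 * real (card (leaves B))
     \<le> (\<Sum>(u, v)\<in>live B. branchings B L u v)"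
proof (induction L)
  case (Suc L)
  have br: "(\<Sum>(u, v)\<in>live B. real (is_branching B u v)) = real (card (branching_arcs B))"
    using finite_live[of B]
    by (simp add: is_branching_def branching_arcs_def case_prod_unfold sum.If_cases if_distrib Int_def conj_commute
        flip: of_nat_sum)
  have "(\<Sum>(u, v)\<in>live B. branchings B (Suc L) u v)
      = real (card (branching_arcs B)) + (\<Sum>(u, v)\<in>live B. average B (branchings B L) u v)"
    by (simp add: case_prod_unfold sum.distrib flip: br)
  moreover have "(\<Sum>(u, v)\<in>live B. branchings B L u v) - real L * real (card (leaves B))
      \<le> (\<Sum>(u, v)\<in>live B. average B (branchings B L) u v)"
    by (rule sum_average(2)) (use branchings_bounds in auto)
  moreover have "(real L ^ 2 + real L) * real (card (leaves B)) \<le> real (Suc L) ^ 2 * real (card (leaves B))"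
    by (intro mult_right_mono) (auto simp: power2_eq_square algebra_simps)
  ultimately show ?case using Suc by (simp add: algebra_simps)
qed simp

text \<open>In every step the mass that is newly stuck is at most the number of leaves, because
  averaging does not increase sums over the live arcs.\<close>

lemma sum_stuck_prob:
  assumes Q: "0 < Q" "\<forall>c. 1 \<le> c \<longrightarrow> c \<le> d \<longrightarrow> c dvd Q"
  shows "(\<Sum>(u, v)\<in>live B. stuck_prob B Q L u v) \<le> real L * real (card (leaves B))"
proof (induction L)
  case 0
  show ?case by (simp add: stuck_prob_def walk_pmf_0)
next
  case (Suc L)
  have lv: "(\<Sum>(u, v)\<in>live B. if kids B u v = [] then 1 else 0 :: real) = real (card (leaves B))"
    unfolding leaves_def using finite_live
    by (simp add: sum.If_cases case_prod_unfold Int_def conj_commute)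
  have "(\<Sum>(u, v)\<in>live B. stuck_prob B Q (Suc L) u v)
      \<le> (\<Sum>(u, v)\<in>live B. (if kids B u v = [] then 1 else 0) + average B (stuck_prob B Q L) u v)"
  proof (rule sum_mono, clarify)
    fix u v assume "(u, v) \<in> live B"
    then have "(u, v) \<in> arcs" using live_arcs by auto
    moreover have "0 \<le> average B (stuck_prob B Q L) u v"
      by (intro average_nonneg) (simp add: stuck_prob_def)
    ultimately show "stuck_prob B Q (Suc L) u v \<le> (if kids B u v = [] then 1 else 0) + average B (stuck_prob B Q L) u v"
      using stuck_prob_Suc[OF _ Q] by simp
  qed
  also have "\<dots> = real (card (leaves B)) + (\<Sum>(u, v)\<in>live B. average B (stuck_prob B Q L) u v)"
    by (simp add: case_prod_unfold sum.distrib flip: lv)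
  also have "(\<Sum>(u, v)\<in>live B. average B (stuck_prob B Q L) u v) \<le> (\<Sum>(u, v)\<in>live B. stuck_prob B Q L u v)"
    by (rule sum_average(1)[where C = 1]) (auto simp: stuck_prob_def)
  also have "\<dots> \<le> real L * real (card (leaves B))" by (rule Suc)
  finally show ?case by (simp add: algebra_simps)
qed

text \<open>The choice of \<open>L\<close> turns the term with \<open>z\<close> into
  \<open>n * d / (4 * e)\<close>, and that of \<open>B\<close> bounds \<open>L\<close> times the
  number of leaves by \<open>n * d / (16 * e)\<close>, which enters twice. From
  \<open>n * d / (2 * e)\<close> there remains \<open>n * d / (8 * e)\<close>, since 1/2 - 1/4 - 1/8
  = 1/8.\<close>

lemma sum_light_prob:
  assumes Q: "0 < Q" "\<forall>c. 1 \<le> c \<longrightarrow> c \<le> d \<longrightarrow> c dvd Q"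
    and pos: "0 < e" "0 < z" and L: "L = 4 * e * z" and B: "B = 16 * e * L"
    and many: "real (n * d) / (2 * real e) \<le> real (card (branching_arcs B))"
  shows "real (n * d) / (8 * real e) \<le> (\<Sum>(u, v)\<in>live B. light_prob B Q L z u v)"
proof -
  let ?S = "real (card (branching_arcs B))" and ?l = "real (card (leaves B))" and ?nd = "real (n * d)"
  let ?LP = "\<Sum>(u, v)\<in>live B. light_prob B Q L z u v"
  have L0: "0 < real L" using L pos by simp
  have live_nd: "real (card (live B)) \<le> ?nd"
    using card_mono[OF finite_arcs live_arcs[of B]] card_arcs by (metis le_trans of_nat_le_iff)
  have "real L * ?S - real L ^ 2 * ?l \<le> (\<Sum>(u, v)\<in>live B. branchings B L u v)" by (rule sum_branchings)
  also have "\<dots> \<le> (\<Sum>(u, v)\<in>live B. real z + real L * (light_prob B Q L z u v + stuck_prob B Q L u v))"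
    using branchings_le[OF Q] by (intro sum_mono) auto
  also have "\<dots> = real (card (live B)) * real z + real L * (?LP + (\<Sum>(u, v)\<in>live B. stuck_prob B Q L u v))"
    by (simp add: case_prod_unfold sum.distrib flip: sum_distrib_left)
  also have "\<dots> \<le> ?nd * real z + real L * (?LP + real L * ?l)"
    using live_nd sum_stuck_prob[OF Q, of B L] by (intro add_mono mult_right_mono mult_left_mono) auto
  finally have "real L * (?S - 2 * (real L * ?l) - ?LP) \<le> ?nd * real z"
    by (simp add: power2_eq_square algebra_simps)
  also have "?nd * real z = real L * (?nd / (4 * real e))" using pos by (simp add: L)
  finally have 1: "?S - 2 * (real L * ?l) - ?LP \<le> ?nd / (4 * real e)"
    using L0 by (simp only: mult_le_cancel_left_pos)
  have "real (card (leaves B) * B) \<le> real (n * d)" using card_leaves[of B] by (simp only: of_nat_le_iff)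
  then have "real L * ?l * (16 * real e) \<le> ?nd" by (simp add: B mult_ac)
  then have 2: "real L * ?l \<le> ?nd / (16 * real e)" using pos by (simp add: field_simps)
  have "?nd / (2 * real e) = 4 * (?nd / (8 * real e))" "?nd / (4 * real e) = 2 * (?nd / (8 * real e))"
    "2 * (?nd / (16 * real e)) = ?nd / (8 * real e)" by simp_all
  then show ?thesis using 1 2 many by linarith
qed

end

section \<open>Graphs far from forests\<close>

context adjacency_graph begin

section \<open>Cycles and live arcs\<close>

definition cyc :: "nat list \<Rightarrow> nat \<Rightarrow> nat" where
  "cyc c i = c ! (i mod length c)"

lemma cyc_edge:
  assumes "is_cycle F c"
  shows "{cyc c i, cyc c (Suc i)} \<in> F"
proof -
  let ?l = "length c"
  have "i mod ?l < ?l" using assms by (auto simp: is_cycle_def intro!: mod_less_divisor)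
  then have "{c ! (i mod ?l), c ! (Suc (i mod ?l) mod ?l)} \<in> F"
    using assms unfolding is_cycle_def by blast
  then show ?thesis by (simp add: cyc_def mod_Suc_eq)
qed

lemma cyc_arc: "is_cycle E c \<Longrightarrow> (cyc c i, cyc c (Suc i)) \<in> arcs"
  using cyc_edge by (simp add: arcs_iff)

lemma cyc_neq:
  assumes "is_cycle E c"
  shows "cyc c i \<noteq> cyc c (Suc (Suc i))"
proof
  let ?l = "length c"
  have l: "3 \<le> ?l" "distinct c" using assms by (auto simp: is_cycle_def)
  assume "cyc c i = cyc c (Suc (Suc i))"
  moreover have "i mod ?l < ?l" "Suc (Suc i) mod ?l < ?l"
    using l(1) by (auto intro!: mod_less_divisor)
  ultimately have "i mod ?l = Suc (Suc i) mod ?l"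
    using l nth_eq_iff_index_eq[of c "i mod ?l" "Suc (Suc i) mod ?l"] by (simp add: cyc_def)
  then have "?l dvd Suc (Suc i) - i" by (metis Suc_leD le_SucI mod_eq_dvd_iff_nat le_refl)
  then have "?l \<le> 2" by (intro dvd_imp_le) auto
  then show False using l by simp
qed

lemma cyc_add_length: "cyc c (i + length c) = cyc c i"
  by (simp add: cyc_def)

lemma set_cyc: "c \<noteq> [] \<Longrightarrow> set c = range (cyc c)"
proof (intro equalityI subsetI)
  fix x assume "x \<in> set c"
  then obtain i where "i < length c" "x = c ! i" by (auto simp: in_set_conv_nth)
  then have "x = cyc c i" by (simp add: cyc_def)
  then show "x \<in> range (cyc c)" by simp
qed (auto simp: cyc_def)

lemma cycle_nonempty: "is_cycle E c \<Longrightarrow> c \<noteq> []"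
  by (auto simp: is_cycle_def)

text \<open>Each orientation of a cycle is closed under continuation, so
  \<open>not_dead_closed\<close> applies in both directions.\<close>

lemma cyc_live:
  assumes "is_cycle E c"
  shows "(cyc c i, cyc c (Suc i)) \<in> live B"
proof -
  have f: "\<not> dead B (cyc c i, cyc c (Suc i))"
  proof (rule not_dead_closed[where X = "range (\<lambda>i. (cyc c i, cyc c (Suc i)))"])
    fix e assume "e \<in> range (\<lambda>i. (cyc c i, cyc c (Suc i)))"
    then obtain i where e: "e = (cyc c i, cyc c (Suc i))" by auto
    have "(cyc c (Suc i), cyc c (Suc (Suc i))) \<in> set (children e)"
      unfolding e using cyc_arc[OF assms] cyc_neq[OF assms, of i] by (subst set_children) auto
    then show "\<exists>c'\<in>set (children e). c' \<in> range (\<lambda>i. (cyc c i, cyc c (Suc i)))" by blast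
  qed simp
  have b: "\<not> dead B (cyc c (Suc i), cyc c i)"
  proof (rule not_dead_closed[where X = "range (\<lambda>i. (cyc c (Suc i), cyc c i))"])
    fix e assume "e \<in> range (\<lambda>i. (cyc c (Suc i), cyc c i))"
    then obtain i where e: "e = (cyc c (Suc i), cyc c i)" by auto
    \<comment> \<open>A full turn is added so that the index has a predecessor.\<close>
    obtain j where j: "i + length c = Suc j" using cycle_nonempty[OF assms] by (cases "i + length c") auto
    have e': "e = (cyc c (Suc (Suc j)), cyc c (Suc j))"
      unfolding e using cyc_add_length[of c i] cyc_add_length[of c "Suc i"] j by simp
    have "(cyc c (Suc j), cyc c j) \<in> set (children e)"
      unfolding e' using arcsD[OF cyc_arc[OF assms]] cyc_neq[OF assms, of j] by (subst set_children) auto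
    then show "\<exists>c'\<in>set (children e). c' \<in> range (\<lambda>i. (cyc c (Suc i), cyc c i))" by blast
  qed simp
  show ?thesis using f b cyc_arc[OF assms] by (simp add: live_def)
qed

section \<open>Branching vertices and isolated cycles\<close>

definition branching_vertices :: "nat \<Rightarrow> nat set" where
  "branching_vertices B = {v. 3 \<le> card (neighbours B v)}"

text \<open>The vertex sets of the cycles that form a connected component of the graph of live arcs.\<close>

definition isolated_cycles :: "nat \<Rightarrow> nat set set" where
  "isolated_cycles B = {set c | c. is_cycle E c \<and> set c \<inter> branching_vertices B = {}}"

text \<open>The two neighbours on the cycle are distinct live neighbours, so a vertex with at most
  two live neighbours has no others.\<close>

lemma neighbours_cycle:
  assumes c: "is_cycle E c" and v: "cyc c i \<notin> branching_vertices B"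
  shows "\<exists>j. neighbours B (cyc c i) = {cyc c j, cyc c (Suc (Suc j))} \<and> cyc c i = cyc c (Suc j) \<and>
    card (neighbours B (cyc c i)) = 2"
proof -
  obtain j where j: "i + length c = Suc j" using cycle_nonempty[OF c] by (cases "i + length c") auto
  have i: "cyc c i = cyc c (Suc j)" using cyc_add_length[of c i] j by simp
  let ?N = "neighbours B (cyc c (Suc j))"
  have sub: "{cyc c j, cyc c (Suc (Suc j))} \<subseteq> ?N"
    using cyc_live[OF c] live_sym by (auto simp: neighbours_def)
  have two: "card {cyc c j, cyc c (Suc (Suc j))} = 2" using cyc_neq[OF c, of j] by simp
  have "card ?N \<le> 2" using v i by (simp add: branching_vertices_def)
  then have eq: "{cyc c j, cyc c (Suc (Suc j))} = ?N"
    using sub two finite_neighbours by (metis card_seteq)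
  then show ?thesis using i two by (metis (no_types))
qed

lemma isolated_cycle_closed:
  assumes "X \<in> isolated_cycles B" "v \<in> X"
  shows "neighbours B v \<subseteq> X \<and> card (neighbours B v) = 2"
proof -
  obtain c where c: "X = set c" "is_cycle E c" "set c \<inter> branching_vertices B = {}"
    using assms(1) by (auto simp: isolated_cycles_def)
  have X: "X = range (cyc c)" using c set_cyc cycle_nonempty by blast
  then obtain i where i: "v = cyc c i" using assms(2) by auto
  then have "cyc c i \<notin> branching_vertices B" using c assms(2) by auto
  from neighbours_cycle[OF c(2) this] show ?thesis using X i by auto
qed

text \<open>Going around \<open>Y\<close> from a common vertex never leaves \<open>X\<close>, which
  is closed under live neighbours.\<close>

lemma isolated_cycles_disjoint:
  assumes "X \<in> isolated_cycles B" "Y \<in> isolated_cycles B" "v \<in> X" "v \<in> Y"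
  shows "Y \<subseteq> X"
proof -
  obtain c where c: "Y = set c" "is_cycle E c" using assms(2) by (auto simp: isolated_cycles_def)
  have Y: "Y = range (cyc c)" using c set_cyc cycle_nonempty by blast
  then obtain i where i: "v = cyc c i" using assms(4) by auto
  have step: "cyc c (i + k) \<in> X" for k
  proof (induction k)
    case (Suc k)
    have "cyc c (Suc (i + k)) \<in> neighbours B (cyc c (i + k))"
      using cyc_live[OF c(2)] by (simp add: neighbours_def)
    then show ?case using isolated_cycle_closed[OF assms(1) Suc] by auto
  qed (use i assms in simp)
  show ?thesis
  proof
    fix y assume "y \<in> Y"
    then obtain j where j: "y = cyc c j" using Y by auto
    have l: "0 < length c" using cycle_nonempty[OF c(2)] by simp
    \<comment> \<open>The added steps first complete the turn from \<open>i\<close> and then proceed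
      to \<open>j\<close>.\<close>
    have "cyc c (i + (j + (length c - i mod length c))) = cyc c j"
    proof -
      have "i mod length c + (length c - i mod length c) = length c" using l by (simp add: less_imp_le)
      then have "i + (j + (length c - i mod length c)) = j + (1 + i div length c) * length c"
        using div_mult_mod_eq[of i "length c"] unfolding add_mult_distrib by linarith
      then show ?thesis unfolding cyc_def by (metis mod_mult_self1)
    qed
    then show "y \<in> X" using step[of "j + (length c - i mod length c)"] j by simp
  qed
qed

lemma isolated_cycles_eq:
  "X \<in> isolated_cycles B \<Longrightarrow> Y \<in> isolated_cycles B \<Longrightarrow> X \<inter> Y \<noteq> {} \<Longrightarrow> X = Y"
  using isolated_cycles_disjoint by blast

lemma isolated_cycles_vertices: "X \<in> isolated_cycles B \<Longrightarrow> X \<subseteq> vertices \<and> X \<noteq> {}"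
proof -
  assume "X \<in> isolated_cycles B"
  then obtain c where c: "X = set c" "is_cycle E c" by (auto simp: isolated_cycles_def)
  have X: "X = range (cyc c)" using c set_cyc cycle_nonempty by blast
  have "cyc c i \<in> vertices" for i using cyc_arc[OF c(2), of i] arcs_vertices by blast
  then show ?thesis using X by blast
qed

lemma finite_isolated_cycles: "finite (isolated_cycles B)"
  by (rule finite_subset[of _ "Pow vertices"]) (use isolated_cycles_vertices in auto)

lemma finite_branching_arcs: "finite (branching_arcs B)"
  by (rule finite_subset[OF _ finite_live[of B]]) (auto simp: branching_arcs_def)

text \<open>Deleting the edges of all branching arcs and one edge from each isolated cycle destroys
  every cycle. In a graph far from forests this must take many deletions.\<close>

lemma far_dichotomy:
  assumes far: "far_from_forest n d \<epsilon> E"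
  shows "\<epsilon> * real n * real d < real (card (branching_arcs B)) + real (card (isolated_cycles B))"
proof -
  define pick where "pick X = (SOME e. \<exists>u v. e = {u, v} \<and> u \<in> X \<and> (u, v) \<in> live B)" for X
  define F1 where "F1 = (\<lambda>(u, v). {u, v}) ` branching_arcs B"
  define F2 where "F2 = pick ` isolated_cycles B"
  define F where "F = E - F1 - F2"
  have pick: "\<exists>u v. pick X = {u, v} \<and> u \<in> X \<and> (u, v) \<in> live B" if X: "X \<in> isolated_cycles B" for X
  proof -
    obtain c where c: "X = set c" "is_cycle E c" using X by (auto simp: isolated_cycles_def)
    have "cyc c 0 \<in> X" using c set_cyc[OF cycle_nonempty[OF c(2)]] by auto
    then have "\<exists>e u v. e = {u, v} \<and> u \<in> X \<and> (u, v) \<in> live B" using cyc_live[OF c(2), of 0] by blast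
    then show ?thesis unfolding pick_def by (rule someI_ex)
  qed
  have "forest F"
  proof (rule ccontr)
    assume "\<not> forest F"
    then obtain c where cF: "is_cycle F c" by (auto simp: forest_def)
    then have c: "is_cycle E c" unfolding is_cycle_def F_def by blast
    note edge = cyc_edge[OF cF]
    show False
    proof (cases "set c \<inter> branching_vertices B = {}")
      case True
      then have X: "set c \<in> isolated_cycles B" using c by (auto simp: isolated_cycles_def)
      \<comment> \<open>The picked edge starts at a vertex of the cycle, where the only live edges
        are the two edges of the cycle; so an edge of this cycle was deleted.\<close>
      from pick[OF X] obtain u v where uv: "pick (set c) = {u, v}" "u \<in> set c" "(u, v) \<in> live B" by blast
      obtain i where i: "u = cyc c i" using uv set_cyc[OF cycle_nonempty[OF c]] by auto
      have "cyc c i \<notin> branching_vertices B" using True uv i by auto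
      from neighbours_cycle[OF c this] obtain j where
        j: "neighbours B (cyc c i) = {cyc c j, cyc c (Suc (Suc j))}" "cyc c i = cyc c (Suc j)" by blast
      have "v \<in> neighbours B (cyc c i)" using uv i by (simp add: neighbours_def)
      then have "v = cyc c j \<or> v = cyc c (Suc (Suc j))" using j by auto
      then have "{u, v} \<in> F" using edge[of j] edge[of "Suc j"] i j by (auto simp: insert_commute)
      then show False using uv X by (auto simp: F_def F2_def)
    next
      case False
      then obtain i where i: "cyc c i \<in> branching_vertices B"
        using set_cyc[OF cycle_nonempty[OF c]] by auto
      obtain j where j: "i + length c = Suc j" using cycle_nonempty[OF c] by (cases "i + length c") auto
      have ij: "cyc c i = cyc c (Suc j)" using cyc_add_length[of c i] j by simp
      \<comment> \<open>The arc by which the cycle enters a vertex of live degree at least 3 has at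
        least two kids, so its edge was deleted.\<close>
      have "(cyc c j, cyc c (Suc j)) \<in> branching_arcs B"
        using i ij cyc_live[OF c, of j B] card_kids[OF cyc_live[OF c, of j B]]
        by (simp add: branching_arcs_def branching_vertices_def)
      then have "{cyc c j, cyc c (Suc j)} \<in> F1" unfolding F1_def by force
      then show False using edge[of j] by (simp add: F_def)
    qed
  qed
  moreover have "simple_graph n F" using simple by (auto simp: simple_graph_def F_def)
  ultimately have "\<epsilon> * real n * real d < real (card ((E - F) \<union> (F - E)))"
    using far by (simp add: far_from_forest_def)
  also have "(E - F) \<union> (F - E) \<subseteq> F1 \<union> F2" by (auto simp: F_def)
  then have "card ((E - F) \<union> (F - E)) \<le> card (F1 \<union> F2)"
    using finite_branching_arcs finite_isolated_cycles by (intro card_mono) (auto simp: F1_def F2_def)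
  also have "card (F1 \<union> F2) \<le> card F1 + card F2" by (rule card_Un_le)
  also have "\<dots> \<le> card (branching_arcs B) + card (isolated_cycles B)"
    unfolding F1_def F2_def by (intro add_mono card_image_le finite_branching_arcs finite_isolated_cycles)
  finally show ?thesis by simp
qed

definition short_cycle_arcs :: "nat \<Rightarrow> nat \<Rightarrow> arc set" where
  "short_cycle_arcs B K = {(u, v) \<in> live B. \<exists>X\<in>isolated_cycles B. card X < K \<and> u \<in> X \<and> v \<in> X}"

text \<open>Isolated cycles are disjoint, so at most \<open>n / K\<close> of them have
  \<open>K\<close> or more vertices; each of the others is charged to an arc of its own.\<close>

lemma card_short_cycle_arcs:
  assumes "0 < K"
  shows "real (card (isolated_cycles B)) \<le> real n / real K + real (card (short_cycle_arcs B K))"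
proof -
  define C1 where "C1 = {X \<in> isolated_cycles B. card X < K}"
  define C2 where "C2 = {X \<in> isolated_cycles B. \<not> card X < K}"
  have fin: "finite C1" "finite C2" using finite_isolated_cycles by (auto simp: C1_def C2_def)
  have un: "isolated_cycles B = C1 \<union> C2" "C1 \<inter> C2 = {}" by (auto simp: C1_def C2_def)
  have "card C2 * K = (\<Sum>X\<in>C2. K)" by simp
  also have "\<dots> \<le> (\<Sum>X\<in>C2. card X)" by (intro sum_mono) (auto simp: C2_def)
  also have "\<dots> = card (\<Union>C2)"
  proof (rule card_Union_disjoint[symmetric])
    show "pairwise disjnt C2"
      unfolding pairwise_def disjnt_def C2_def using isolated_cycles_eq by blast
    show "finite X" if "X \<in> C2" for X
      using that isolated_cycles_vertices finite_subset[of X vertices] by (auto simp: C2_def)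
  qed
  also have "\<dots> \<le> card vertices"
    using isolated_cycles_vertices by (intro card_mono) (auto simp: C2_def)
  finally have "card C2 * K \<le> n" by simp
  then have "real (card C2) * real K \<le> real n" by (metis of_nat_le_iff of_nat_mult)
  then have 2: "real (card C2) \<le> real n / real K" using assms by (simp add: field_simps)
  have "\<forall>X\<in>C1. \<exists>e. e \<in> short_cycle_arcs B K \<and> fst e \<in> X"
  proof
    fix X assume X: "X \<in> C1"
    then have Xi: "X \<in> isolated_cycles B" by (simp add: C1_def)
    then obtain u where u: "u \<in> X" using isolated_cycles_vertices by blast
    from isolated_cycle_closed[OF Xi u] obtain v where "v \<in> neighbours B u" "v \<in> X"
      by (metis card.empty equals0I subsetD zero_neq_numeral)
    then have "(u, v) \<in> short_cycle_arcs B K" using u X Xi by (auto simp: short_cycle_arcs_def neighbours_def C1_def)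
    then show "\<exists>e. e \<in> short_cycle_arcs B K \<and> fst e \<in> X" using u by (metis fst_conv)
  qed
  then obtain g where g: "\<And>X. X \<in> C1 \<Longrightarrow> g X \<in> short_cycle_arcs B K \<and> fst (g X) \<in> X" by metis
  have "inj_on g C1"
  proof (rule inj_onI)
    fix X Y assume XY: "X \<in> C1" "Y \<in> C1" "g X = g Y"
    then have "fst (g X) \<in> X \<inter> Y" using g by (metis IntI)
    then have "X \<inter> Y \<noteq> {}" by blast
    then show "X = Y" using XY isolated_cycles_eq by (auto simp: C1_def)
  qed
  moreover have "g ` C1 \<subseteq> short_cycle_arcs B K" using g by auto
  moreover have "finite (short_cycle_arcs B K)"
    by (rule finite_subset[OF _ finite_live[of B]]) (auto simp: short_cycle_arcs_def)
  ultimately have "card C1 \<le> card (short_cycle_arcs B K)" by (metis card_inj_on_le)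
  moreover have "card (isolated_cycles B) = card C1 + card C2" using un fin by (simp add: card_Un_disjoint)
  ultimately show ?thesis using 2 by simp
qed

text \<open>On an isolated cycle every arc has exactly one kid, so the random numbers have no
  influence.\<close>

lemma walk_short_cycle:
  assumes X: "X \<in> isolated_cycles B" and uv: "(u, v) \<in> live B" "u \<in> X" "v \<in> X"
    and len: "length rs = length rs'"
  shows "\<exists>p. walk B rs u v = Some p \<and> walk B rs' u v = Some p \<and> set p \<subseteq> X"
  using len uv
proof (induction rs rs' arbitrary: u v rule: list_induct2)
  case (Cons r rs r' rs')
  have "card (set (kids B u v)) = 1"
    using card_kids[OF Cons.prems(1)] isolated_cycle_closed[OF X Cons.prems(3)] by simp
  moreover have "(u, v) \<in> arcs" using Cons.prems live_arcs by auto
  ultimately have "length (kids B u v) = 1" using distinct_kids[of u v B] distinct_card by metis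
  then obtain w where w: "kids B u v = [w]" by (cases "kids B u v") auto
  then have "(v, w) \<in> live B" using kids_live[OF Cons.prems(1)] by auto
  moreover from this have "w \<in> X" using isolated_cycle_closed[OF X Cons.prems(3)] by (auto simp: neighbours_def)
  ultimately obtain p where "walk B rs v w = Some p" "walk B rs' v w = Some p" "set p \<subseteq> X"
    using Cons.IH[of v w] Cons.prems by blast
  then show ?case using w Cons.prems by (intro exI[of _ "u # p"]) auto
qed auto

lemma walk_short_cycle_arcs:
  assumes "(u, v) \<in> short_cycle_arcs B K" "length rs = length rs'" "K \<le> length rs"
  shows "\<exists>p. walk B rs u v = Some p \<and> walk B rs' u v = Some p \<and> \<not> distinct p"
proof -
  obtain X where X: "X \<in> isolated_cycles B" "card X < K" "u \<in> X" "v \<in> X" "(u, v) \<in> live B"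
    using assms(1) by (auto simp: short_cycle_arcs_def)
  from walk_short_cycle[OF X(1,5,3,4) assms(2)] obtain p where
    p: "walk B rs u v = Some p" "walk B rs' u v = Some p" "set p \<subseteq> X" by blast
  have "finite X" using isolated_cycles_vertices[OF X(1)] finite_subset[of X vertices] by auto
  then have "card (set p) < length p" using p(3) X(2) assms(3) walk_length[OF p(1)] card_mono[of X "set p"] by auto
  then have "\<not> distinct p" using distinct_card by fastforce
  then show ?thesis using p by blast
qed

end

section \<open>The success probability\<close>

locale tester = adjacency_graph +
  fixes e lg sq :: nat
  assumes n_pos: "0 < n" and d_pos: "0 < d" and e_pos: "0 < e"
    and lg: "n \<le> 2 ^ lg" and sq: "n \<le> sq * sq"
begin

text \<open>The constants are found backwards from \<open>birthday\<close> with
  \<open>\<alpha> = 1 / (16 * e)\<close>: \<open>(1 / 2) ^ lightness\<close> is at most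
  \<open>1 / (64 * e * n)\<close>, which is \<open>\<alpha> / (4 * n)\<close>, and
  \<open>half * \<alpha>\<close> is \<open>32 * sq\<close>, whose square is at least
  \<open>1024 * n\<close>. The values of \<open>len\<close> and \<open>budget\<close> are dictated
  by \<open>sum_light_prob\<close>. On a far graph a trial succeeds with probability at least
  \<open>1 / (32 * e)\<close>, so \<open>64 * e\<close> trials reduce the failure to
  \<open>exp (-2)\<close>.\<close>

definition lightness :: nat where "lightness = 6 + e + lg"
definition len :: nat where "len = 4 * e * lightness"
definition budget :: nat where "budget = 16 * e * len"
definition half :: nat where "half = 512 * e * sq"
definition walks :: nat where "walks = half + half"
definition trials :: nat where "trials = 64 * e"
definition block :: nat where "block = 1 + walks * len"
text \<open>Divisible by \<open>n * d\<close>, for the start arc, and by every possible number of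
  kids.\<close>

definition range_size :: nat where "range_size = n * fact d"

definition sample :: "nat pmf" where "sample = pmf_of_set {1..range_size}"

text \<open>One number encodes a uniform pair of a vertex and a list index. Indices beyond the end
  of a list waste the trial, but in return all arcs are equally likely.\<close>

definition start_arc :: "nat \<Rightarrow> arc" where
  "start_arc r = (r mod n + 1, neighbour n adj (r mod n + 1) ((r div n) mod d + 1))"

text \<open>The event that no pair of walks betrays a cycle. The requirement
  \<open>distinct p\<close> serves the isolated cycles, on which all walks coincide but repeat
  vertices.\<close>

definition silent :: "nat list list \<Rightarrow> arc \<Rightarrow> bool" where
  "silent rss a \<longleftrightarrow> (\<forall>j<length rss. \<forall>i<j. \<forall>p q.
     walk budget (rss ! i) (fst a) (snd a) = Some p \<and> walk budget (rss ! j) (fst a) (snd a) = Some q \<and>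
     last p = last q \<longrightarrow> p = q \<and> distinct p)"

text \<open>The answer 0 to the query for the end of the start arc means that the trial is void.\<close>

definition trial_silent :: "nat list \<Rightarrow> bool" where
  "trial_silent xs \<longleftrightarrow> snd (start_arc (hd xs)) = 0 \<or>
     silent (blocks len walks (tl xs)) (start_arc (hd xs))"

lemma range_size_pos: "0 < range_size"
  using n_pos by (simp add: range_size_def)

lemma dvd_range_size: "\<forall>c. 1 \<le> c \<longrightarrow> c \<le> d \<longrightarrow> c dvd range_size"
  by (simp add: range_size_def dvd_fact dvd_mult)

lemma finite_sample: "finite (set_pmf sample)"
  using range_size_pos by (simp add: sample_def)

lemma sq_pos: "0 < sq"
  using sq n_pos by (cases sq) auto

lemma walk_pmf_sample: "walk_pmf budget range_size len u v = map_pmf (\<lambda>rs. walk budget rs u v) (replicate_pmf len sample)"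
  by (simp add: walk_pmf_def sample_def)

lemma nd_pos: "0 < real (n * d)"
  using n_pos d_pos by simp

text \<open>Reduction modulo \<open>n * d\<close> gives a uniform number and does not change the
  start arc. The arc from \<open>u\<close> to its neighbour number \<open>i\<close>, counted from 0,
  is hit by \<open>(u - 1) + n * i\<close>.\<close>

lemma prob_start:
  assumes "A \<subseteq> arcs"
  shows "real (card A) / real (n * d) \<le> measure_pmf.prob sample (start_arc -` A)"
proof -
  let ?N = "n * d"
  have dN: "?N dvd range_size"
    unfolding range_size_def using d_pos by (intro mult_dvd_mono dvd_refl dvd_fact) auto
  have N: "0 < ?N" using n_pos d_pos by simp
  have mod1: "start_arc (r mod ?N) = start_arc r" for r
  proof -
    have "r mod ?N mod n = r mod n" by (simp add: mod_mod_cancel)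
    moreover have "r mod ?N div n mod d = r div n mod d"
      using mod_mult2_eq[of r n d] n_pos by simp
    ultimately show ?thesis by (simp add: start_arc_def)
  qed
  have "measure_pmf.prob sample (start_arc -` A)
      = measure_pmf.prob (map_pmf (\<lambda>r. r mod ?N) sample) (start_arc -` A)"
    by (simp add: vimage_def mod1)
  also have "map_pmf (\<lambda>r. r mod ?N) sample = pmf_of_set {..<?N}"
    unfolding sample_def by (rule map_mod_pmf_of_set[OF range_size_pos dN])
  also have "measure_pmf.prob (pmf_of_set {..<?N}) (start_arc -` A) = real (card ({..<?N} \<inter> start_arc -` A)) / real ?N"
    using N by (subst measure_pmf_of_set) (auto simp: lessThan_empty_iff)
  finally have eq: "measure_pmf.prob sample (start_arc -` A) = real (card ({..<?N} \<inter> start_arc -` A)) / real ?N" .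
  have "A \<subseteq> start_arc ` ({..<?N} \<inter> start_arc -` A)"
  proof
    fix a assume a: "a \<in> A"
    obtain u v where uv: "a = (u, v)" by fastforce
    then have arc: "u \<in> vertices" "v \<in> set (adj u)" using a assms by (auto simp: arcs_def)
    then obtain i where i: "i < length (adj u)" "adj u ! i = v" by (auto simp: in_set_conv_nth)
    have id: "i < d" using i length_adj[OF arc(1)] by simp
    define r where "r = (u - 1) + n * i"
    have u1: "u - 1 < n" using arc by auto
    have "r mod n = u - 1" "r div n = i" using u1 by (auto simp: r_def)
    then have "start_arc r = a" using arc i id by (simp add: start_arc_def neighbour_def uv)
    moreover have "r < ?N"
    proof -
      have "n * Suc i \<le> n * d" using id by (intro mult_le_mono2) simp
      then show ?thesis using u1 by (simp add: r_def)
    qed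
    ultimately show "a \<in> start_arc ` ({..<?N} \<inter> start_arc -` A)" using a by force
  qed
  then have "card A \<le> card (start_arc ` ({..<?N} \<inter> start_arc -` A))" by (intro card_mono) auto
  also have "\<dots> \<le> card ({..<?N} \<inter> start_arc -` A)" by (rule card_image_le) simp
  finally show ?thesis unfolding eq by (intro divide_right_mono) auto
qed

lemma not_silent_light:
  assumes uv: "(u, v) \<in> live budget"
    and light: "1 / (16 * real e) \<le> light_prob budget range_size len lightness u v"
  shows "1 / 2 \<le> measure_pmf.prob (replicate_pmf walks (replicate_pmf len sample)) {rss. \<not> silent rss (u, v)}"
proof -
  let ?w = "\<lambda>rs. walk budget rs u v" and ?p = "walk_pmf budget range_size len u v"
  \<comment> \<open>\<open>light_walks\<close> also contains lists that are no walks at all, since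
    their probability is 0; the support removes them, so that all ends are vertices.\<close>
  define G where "G = light_walks budget range_size len lightness u v \<inter> set_pmf ?p"
  define f where "f = (\<lambda>x :: nat list option. last (the x))"
  define \<alpha> where "\<alpha> = 1 / (16 * real e)"
  let ?C = "{xs. \<exists>x\<in>set xs. \<exists>y\<in>set xs. x \<in> G \<and> y \<in> G \<and> f x = f y \<and> x \<noteq> y}"
  have uva: "(u, v) \<in> arcs" using uv live_arcs by auto
  have "1 / 2 \<le> measure_pmf.prob (replicate_pmf (half + half) ?p) ?C"
  proof (rule birthday[where VV = vertices and N = n and \<alpha> = \<alpha>])
    show "finite (set_pmf ?p)" by (rule finite_walk_pmf[OF range_size_pos])
    show "f x \<in> vertices" if x: "x \<in> G" for x
    proof -
      obtain p where p: "x = Some p" "Some p \<in> set_pmf ?p" using x unfolding G_def light_walks_def by blast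
      then obtain rs where rs: "walk budget rs u v = Some p" by (auto simp: walk_pmf_def)
      have l: "length p = length rs + 2" and nb: "nb_walk p"
        using walk_length[OF rs] walk_nb[OF uva rs] by auto
      have "(p ! length rs, p ! Suc (length rs)) \<in> arcs" using nb l unfolding nb_walk_def by simp
      moreover have "last p = p ! Suc (length rs)" using l last_conv_nth[of p] by fastforce
      ultimately have "last p \<in> vertices" using arcs_vertices by simp
      then show ?thesis using p by (simp add: f_def)
    qed
    show "pmf ?p x \<le> \<alpha> / (4 * real n)" if "x \<in> G" for x
    proof -
      have "pmf ?p x \<le> (1 / 2) ^ lightness" using that by (auto simp: G_def light_walks_def)
      also have "\<dots> = 1 / (64 * (2 ^ e * 2 ^ lg))" by (simp add: lightness_def power_add power_one_over)
      also have "\<dots> \<le> 1 / (64 * (real e * real n))"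
      proof -
        have "real e \<le> 2 ^ e" using less_exp[of e] by (metis less_imp_le of_nat_le_iff of_nat_numeral of_nat_power)
        moreover have "real n \<le> 2 ^ lg" using lg by (metis of_nat_le_iff of_nat_numeral of_nat_power)
        ultimately have "real e * real n \<le> 2 ^ e * 2 ^ lg" by (intro mult_mono) auto
        then show ?thesis using e_pos n_pos by (intro divide_left_mono mult_left_mono) auto
      qed
      also have "\<dots> = \<alpha> / (4 * real n)" by (simp add: \<alpha>_def)
      finally show ?thesis .
    qed
    have "measure_pmf.prob ?p G = light_prob budget range_size len lightness u v"
      unfolding G_def light_prob_def by (rule measure_Int_set_pmf)
    then show "\<alpha> \<le> measure_pmf.prob ?p G" using light by (simp add: \<alpha>_def)
    show "0 < \<alpha>" using e_pos by (simp add: \<alpha>_def)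
    have ma: "real half * \<alpha> = 32 * real sq" using e_pos by (simp add: half_def \<alpha>_def)
    show "32 \<le> real half * \<alpha>" using sq_pos unfolding ma by simp
    have "real n \<le> real sq * real sq" using sq by (metis of_nat_le_iff of_nat_mult)
    then show "256 * real n \<le> (real half * \<alpha>)\<^sup>2" unfolding ma by (simp add: power2_eq_square)
  qed auto
  also have "replicate_pmf (half + half) ?p = map_pmf (map ?w) (replicate_pmf walks (replicate_pmf len sample))"
    unfolding walk_pmf_sample walks_def map_replicate_pmf ..
  also have "measure_pmf.prob (map_pmf (map ?w) (replicate_pmf walks (replicate_pmf len sample))) ?C
      \<le> measure_pmf.prob (replicate_pmf walks (replicate_pmf len sample)) {rss. \<not> silent rss (u, v)}"
  proof -
    have "map ?w -` ?C \<subseteq> {rss. \<not> silent rss (u, v)}"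
    proof
      fix rss assume "rss \<in> map ?w -` ?C"
      then obtain x y where xy: "x \<in> set (map ?w rss)" "y \<in> set (map ?w rss)" "x \<in> G" "y \<in> G" "f x = f y" "x \<noteq> y"
        by auto
      obtain p q where pq: "x = Some p" "y = Some q"
        using xy(3,4) unfolding G_def light_walks_def by blast
      obtain i where i: "i < length rss" "walk budget (rss ! i) u v = Some p"
        using xy(1) pq(1) by (auto simp: in_set_conv_nth)
      obtain j where j: "j < length rss" "walk budget (rss ! j) u v = Some q"
        using xy(2) pq(2) by (auto simp: in_set_conv_nth)
      note ij = i j
      have last: "last p = last q" "p \<noteq> q" using xy pq by (auto simp: f_def)
      show "rss \<in> {rss. \<not> silent rss (u, v)}"
      proof (cases "i < j")
        case True
        then show ?thesis using ij last unfolding silent_def fst_conv snd_conv by fastforce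
      next
        case False
        moreover have "i \<noteq> j" using ij last by auto
        ultimately have "j < i" by simp
        then show ?thesis using ij last unfolding silent_def fst_conv snd_conv by fastforce
      qed
    qed
    then show ?thesis unfolding measure_map_pmf by (intro measure_pmf.finite_measure_mono) auto
  qed
  finally show ?thesis .
qed

lemma len_pos: "0 < len" and walks_ge: "2 \<le> walks"
proof -
  show "0 < len" using e_pos by (simp add: len_def lightness_def)
  have "0 < half" using e_pos sq_pos by (simp add: half_def)
  then show "2 \<le> walks" by (simp add: walks_def)
qed

text \<open>Two walks suffice: they coincide and, being longer than the cycle, repeat a
  vertex.\<close>

lemma not_silent_short_cycle:
  assumes "(u, v) \<in> short_cycle_arcs budget (4 * e)"
    and "length rss = walks" "\<forall>rs\<in>set rss. length rs = len"
  shows "\<not> silent rss (u, v)"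
proof -
  have "length (rss ! 0) = len" "length (rss ! 1) = len"
    using assms(2,3) walks_ge nth_mem[of 0 rss] nth_mem[of 1 rss] by auto
  moreover have "4 * e \<le> len" by (simp add: len_def lightness_def)
  ultimately obtain p where "walk budget (rss ! 0) u v = Some p" "walk budget (rss ! 1) u v = Some p" "\<not> distinct p"
    using walk_short_cycle_arcs[OF assms(1)] by metis
  moreover have "1 < length rss" "(0::nat) < 1" using assms(2) walks_ge by auto
  ultimately show ?thesis unfolding silent_def fst_conv snd_conv by blast
qed

text \<open>The start arc lies in \<open>A\<close> with probability at least
  \<open>1 / (16 * e)\<close>; given such an arc, the walks betray a cycle with probability at least
  1/2.\<close>

lemma prob_trial:
  assumes A: "A \<subseteq> arcs" "finite A"
    and bad: "\<And>a. a \<in> A \<Longrightarrow> 1 / 2 \<le> measure_pmf.prob (replicate_pmf walks (replicate_pmf len sample)) {rss. \<not> silent rss a}"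
    and size: "real (n * d) / (16 * real e) \<le> real (card A)"
  shows "measure_pmf.prob (replicate_pmf block sample) {xs. trial_silent xs} \<le> 1 - 1 / (32 * real e)"
proof -
  let ?R = "replicate_pmf (walks * len) sample"
  have block: "replicate_pmf block sample = bind_pmf sample (\<lambda>r. map_pmf ((#) r) ?R)"
    by (simp add: block_def map_pmf_def)
  have "indicator (start_arc -` A) r / 2 \<le> measure_pmf.prob (map_pmf ((#) r) ?R) {xs. \<not> trial_silent xs}" for r
  proof (cases "start_arc r \<in> A")
    case True
    have nz: "snd (start_arc r) \<noteq> 0" using True A(1) arcs_vertices by (cases "start_arc r") force
    have "measure_pmf.prob (map_pmf ((#) r) ?R) {xs. \<not> trial_silent xs}
        = measure_pmf.prob ?R {xs. \<not> silent (blocks len walks xs) (start_arc r)}"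
      using nz by (simp add: trial_silent_def vimage_def)
    also have "\<dots> = measure_pmf.prob (map_pmf (blocks len walks) ?R) {rss. \<not> silent rss (start_arc r)}"
      by (simp add: vimage_def)
    also have "map_pmf (blocks len walks) ?R = replicate_pmf walks (replicate_pmf len sample)"
      by (rule map_blocks_replicate_pmf)
    also have "measure_pmf.prob \<dots> {rss. \<not> silent rss (start_arc r)} \<ge> 1 / 2" using bad True by simp
    finally show ?thesis using True by simp
  next
    case False
    then show ?thesis by simp
  qed
  then have "measure_pmf.expectation sample (\<lambda>r. indicator (start_arc -` A) r / 2)
      \<le> measure_pmf.expectation sample (\<lambda>r. measure_pmf.prob (map_pmf ((#) r) ?R) {xs. \<not> trial_silent xs})"
    by (intro expectation_mono_finite finite_sample)
  also have "\<dots> = measure_pmf.prob (replicate_pmf block sample) {xs. \<not> trial_silent xs}"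
    unfolding block using finite_sample by (intro prob_bind_finite[symmetric]) auto
  finally have "measure_pmf.prob sample (start_arc -` A) / 2
      \<le> measure_pmf.prob (replicate_pmf block sample) {xs. \<not> trial_silent xs}"
    by simp
  also have "\<dots> = 1 - measure_pmf.prob (replicate_pmf block sample) {xs. trial_silent xs}"
    using measure_pmf.prob_compl[of "{xs. trial_silent xs}" "replicate_pmf block sample"]
    by (simp add: Collect_neg_eq Compl_eq_Diff_UNIV)
  finally have 1: "measure_pmf.prob sample (start_arc -` A) / 2
      \<le> 1 - measure_pmf.prob (replicate_pmf block sample) {xs. trial_silent xs}" .
  have "1 / (16 * real e) = real (n * d) / (16 * real e) / real (n * d)"
    using n_pos d_pos by simp
  also have "\<dots> \<le> real (card A) / real (n * d)" using size nd_pos by (intro divide_right_mono) auto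
  also have "\<dots> \<le> measure_pmf.prob sample (start_arc -` A)" by (rule prob_start[OF A(1)])
  finally show ?thesis using 1 by simp
qed

lemma prob_trial_silent:
  assumes far: "far_from_forest n d \<epsilon> E" and \<epsilon>: "1 / real e \<le> \<epsilon>"
  shows "measure_pmf.prob (replicate_pmf block sample) {xs. trial_silent xs} \<le> 1 - 1 / (32 * real e)"
proof -
  let ?nd = "real (n * d)"
  have "?nd / real e = (1 / real e) * real n * real d" by simp
  also have "\<dots> \<le> \<epsilon> * real n * real d" using \<epsilon> by (intro mult_right_mono) auto
  also have "\<dots> < real (card (branching_arcs budget)) + real (card (isolated_cycles budget))"
    by (rule far_dichotomy[OF far])
  finally have dich: "?nd / real e < real (card (branching_arcs budget)) + real (card (isolated_cycles budget))" .
  show ?thesis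
  proof (cases "?nd / (2 * real e) \<le> real (card (branching_arcs budget))")
    case True
    \<comment> \<open>Averaging: the arcs outside \<open>A\<close> contribute at most
      \<open>n * d / (16 * e)\<close> to the sum of \<open>light_prob\<close>, half of its lower
      bound, and each arc of \<open>A\<close> contributes at most 1.\<close>
    define A where "A = {(u, v) \<in> live budget. 1 / (16 * real e) \<le> light_prob budget range_size len lightness u v}"
    have A: "A \<subseteq> arcs" using live_arcs by (auto simp: A_def)
    have finA: "finite A" using A finite_arcs by (rule finite_subset)
    have A_live: "A \<subseteq> live budget" by (auto simp: A_def)
    have "?nd / (8 * real e) \<le> (\<Sum>(u, v)\<in>live budget. light_prob budget range_size len lightness u v)"
      by (rule sum_light_prob[OF range_size_pos dvd_range_size e_pos _ _ _ True])
         (simp_all add: lightness_def len_def budget_def)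
    also have "\<dots> \<le> (\<Sum>a\<in>live budget. indicator A a + 1 / (16 * real e))"
    proof (rule sum_mono)
      fix a assume a: "a \<in> live budget"
      obtain u v where uv: "a = (u, v)" by fastforce
      have "light_prob budget range_size len lightness u v \<le> 1" by (simp add: light_prob_def)
      then show "(case a of (u, v) \<Rightarrow> light_prob budget range_size len lightness u v)
          \<le> indicator A a + 1 / (16 * real e)"
        using a uv by (auto simp: A_def indicator_def add_increasing2)
    qed
    also have "\<dots> = real (card A) + real (card (live budget)) / (16 * real e)"
    proof -
      have "(\<Sum>a\<in>live budget. indicator A a) = real (card A)"
        using A_live finite_live[of budget] by (simp add: indicator_def sum.If_cases Int_absorb1)
      then show ?thesis by (simp add: sum.distrib)
    qed
    also have "\<dots> \<le> real (card A) + ?nd / (16 * real e)"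
    proof -
      have "card (live budget) \<le> n * d"
        using card_mono[OF finite_arcs live_arcs[of budget]] card_arcs by linarith
      then have "real (card (live budget)) \<le> ?nd" by (simp only: of_nat_le_iff)
      then show ?thesis by (intro add_left_mono divide_right_mono) auto
    qed
    finally have "?nd / (8 * real e) \<le> real (card A) + ?nd / (16 * real e)" .
    moreover have "?nd / (8 * real e) = 2 * (?nd / (16 * real e))" by simp
    ultimately have size: "?nd / (16 * real e) \<le> real (card A)" by linarith
    show ?thesis
    proof (rule prob_trial[OF A finA _ size])
      fix a assume "a \<in> A"
      then show "1 / 2 \<le> measure_pmf.prob (replicate_pmf walks (replicate_pmf len sample)) {rss. \<not> silent rss a}"
        using not_silent_light by (auto simp: A_def)
    qed
  next
    case False
    \<comment> \<open>Cycles with \<open>4 * e\<close> or more vertices make up at most half of the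
      guaranteed number \<open>h = n * d / (2 * e)\<close> of isolated cycles; so at least
      \<open>h / 2\<close> arcs lie on short ones.\<close>
    let ?A = "short_cycle_arcs budget (4 * e)"
    have A: "?A \<subseteq> arcs" using live_arcs by (auto simp: short_cycle_arcs_def)
    define h where "h = ?nd / (2 * real e)"
    have "?nd / real e = 2 * h" by (simp add: h_def)
    then have "h \<le> real (card (isolated_cycles budget))" using dich False unfolding h_def[symmetric] by linarith
    also have "\<dots> \<le> real n / real (4 * e) + real (card ?A)"
      using e_pos by (intro card_short_cycle_arcs) simp
    also have "real n / real (4 * e) \<le> ?nd / (4 * real e)"
      using d_pos mult_left_mono[of 1 "real d" "real n"] e_pos by (auto intro!: divide_right_mono)
    also have "?nd / (4 * real e) = h / 2" by (simp add: h_def)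
    finally have "h / 2 \<le> real (card ?A)" by simp
    moreover have "0 \<le> h" by (simp add: h_def)
    moreover have "?nd / (16 * real e) = h / 8" by (simp add: h_def)
    ultimately have size: "?nd / (16 * real e) \<le> real (card ?A)" by linarith
    show ?thesis
    proof (rule prob_trial[OF A finite_subset[OF A finite_arcs] _ size])
      fix a assume a: "a \<in> ?A"
      have "measure_pmf.prob (replicate_pmf walks (replicate_pmf len sample)) {rss. \<not> silent rss a} = 1"
      proof (subst measure_pmf.prob_eq_1)
        show "AE rss in replicate_pmf walks (replicate_pmf len sample). rss \<in> {rss. \<not> silent rss a}"
          using not_silent_short_cycle a by (cases a) (auto simp: AE_measure_pmf_iff set_replicate_pmf in_lists_conv_set)
      qed simp
      then show "1 / 2 \<le> measure_pmf.prob (replicate_pmf walks (replicate_pmf len sample)) {rss. \<not> silent rss a}"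
        by simp
    qed
  qed
qed

lemma prob_all_silent:
  assumes far: "far_from_forest n d \<epsilon> E" and \<epsilon>: "1 / real e \<le> \<epsilon>"
  shows "measure_pmf.prob (replicate_pmf (trials * block) sample)
    {xs. \<forall>t<trials. trial_silent (take block (drop (t * block) xs))} \<le> 1 / 3"
proof -
  let ?A = "{xs. trial_silent xs}"
  let ?P = "measure_pmf.prob (replicate_pmf block sample) ?A"
  have "measure_pmf.prob (replicate_pmf (trials * block) sample)
      {xs. \<forall>t<trials. trial_silent (take block (drop (t * block) xs))}
    = measure_pmf.prob (map_pmf (blocks block trials) (replicate_pmf (trials * block) sample)) {yss. set yss \<subseteq> ?A}"
    by (simp add: vimage_def blocks_def image_subset_iff Ball_def)
  also have "\<dots> = ?P ^ trials"
    unfolding map_blocks_replicate_pmf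
    by (rule prob_replicate_all) (use finite_sample in auto)
  also have "\<dots> \<le> exp (- (1 / (32 * real e))) ^ trials"
    using prob_trial_silent[OF far \<epsilon>] exp_ge_add_one_self[of "- (1 / (32 * real e))"]
    by (intro power_mono) auto
  also have "\<dots> = exp (- (real trials * (1 / (32 * real e))))" by (simp flip: exp_of_nat_mult)
  also have "real trials * (1 / (32 * real e)) = 2" using e_pos by (simp add: trials_def)
  also have "exp (- 2) \<le> (1 / 3 :: real)"
    using exp_ge_add_one_self[of 2] by (simp add: exp_minus field_simps)
  finally show ?thesis .
qed

end

section \<open>The program\<close>

text \<open>\<open>qa[i]\<close> and \<open>qb[i]\<close> hold tail and head of arc number
  \<open>i\<close> of the search queue. An answer equal to the tail would be a step back, and 0
  marks an index past the end of the adjacency list.\<close>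

definition expand_body :: com where
  "expand_body =
    (Query ''y'' (Const 0) (Get ''qb'' (V ''hd'')) (V ''h'' \<oplus> Const 1) ;;
     If (Op Eq (V ''y'') (Get ''qa'' (V ''hd''))) Skip
       (If (V ''y'')
          (Put ''qa'' (V ''tl'') (Get ''qb'' (V ''hd'')) ;;
           Put ''qb'' (V ''tl'') (V ''y'') ;;
           Assign ''tl'' (V ''tl'' \<oplus> Const 1))
          Skip))"

text \<open>It idles on an empty queue, so a loop with a fixed number \<open>B\<close> of rounds
  implements \<open>explore B\<close>.\<close>

definition search_body :: com where
  "search_body =
    If (Op Less (V ''hd'') (V ''tl''))
      (For ''h'' (V ''d'') expand_body ;; Assign ''hd'' (V ''hd'' \<oplus> Const 1))
      Skip"

text \<open>Afterwards \<open>hd < tl\<close> iff the arc \<open>(b, w)\<close> is not dead.\<close>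

definition dead_test :: com where
  "dead_test =
    (Put ''qa'' (Const 0) (V ''b'') ;; Put ''qb'' (Const 0) (V ''w'') ;;
     Assign ''hd'' (Const 0) ;; Assign ''tl'' (Const 1) ;;
     For ''g'' (V ''B'') search_body)"

definition add_kid :: com where
  "add_kid =
    If (Op Less (V ''hd'') (V ''tl''))
      (Put ''kid'' (V ''c'') (V ''w'') ;; Assign ''c'' (V ''c'' \<oplus> Const 1))
      Skip"

definition kid_body :: com where
  "kid_body =
    (Query ''w'' (Const 0) (V ''b'') (V ''f'' \<oplus> Const 1) ;;
     If (Op Eq (V ''w'') (V ''a'')) Skip
       (If (V ''w'')
          (dead_test ;; add_kid)
          Skip))"

definition find_kids :: com where
  "find_kids = (Assign ''c'' (Const 0) ;; For ''f'' (V ''d'') kid_body)"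

definition choose_kid :: com where
  "choose_kid =
    If (V ''c'')
      (Put ''path'' (V ''base'' \<oplus> V ''i'' \<oplus> Const 2)
         (Get ''kid'' (Op Mod (Get ''rnd'' (V ''rb'' \<oplus> V ''i'')) (V ''c''))))
      (Assign ''ok'' (Const 0))"

definition walk_step :: com where
  "walk_step =
    If (V ''ok'')
      (Assign ''a'' (Get ''path'' (V ''base'' \<oplus> V ''i'')) ;;
       Assign ''b'' (Get ''path'' (V ''base'' \<oplus> V ''i'' \<oplus> Const 1)) ;;
       find_kids ;;
       choose_kid)
      Skip"

definition do_walk :: com where
  "do_walk =
    (Put ''path'' (V ''base'') (V ''u'') ;; Put ''path'' (V ''base'' \<oplus> Const 1) (V ''v'') ;;
     Assign ''ok'' (Const 1) ;; For ''i'' (V ''L'') walk_step)"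

definition copy_cycle :: com where
  "copy_cycle = Put ''cert'' (V ''s'' \<oplus> Const 1) (Get ''W'' (V ''r'' \<oplus> V ''s''))"

text \<open>Once the flag is set all further comparisons are skipped, which protects the certificate
  from being overwritten.\<close>

definition compare :: com where
  "compare =
    If (V ''reject'') Skip
      (If (Op Eq (Get ''W'' (V ''r'')) (Get ''W'' (V ''j'')))
         (Assign ''reject'' (Const 1) ;; Assign ''cert'' (V ''j'' \<ominus> V ''r'') ;;
          For ''s'' (V ''j'' \<ominus> V ''r'') copy_cycle)
         Skip)"

definition find_repeat :: com where
  "find_repeat = For ''j'' (V ''lz'') (For ''r'' (V ''j'') compare)"

text \<open>The two index expressions are those of \<open>nth_joined1\<close> and
  \<open>nth_joined2\<close> for walks with \<open>L + 2\<close> vertices, arranged so that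
  truncated subtraction does no harm.\<close>

definition fill :: com where
  "fill =
    If (Op Less (V ''l'') (V ''lw''))
      (Put ''W'' (V ''l'') (Get ''path'' (V ''xb'' \<oplus> (V ''L'' \<oplus> Const 1 \<ominus> V ''l''))))
      (Put ''W'' (V ''l'') (Get ''path'' (V ''base'' \<oplus> (V ''p'' \<oplus> V ''p'' \<oplus> V ''l'' \<ominus> (V ''L'' \<oplus> Const 1)))))"

text \<open>\<open>lw\<close> counts the vertices taken from the stored walk;
  \<open>2 * lw - 1\<close> is the total when the walks part after \<open>p\<close>, because the
  vertex at the turn is shared.\<close>

definition join_walks :: com where
  "join_walks =
    (Assign ''lw'' (V ''L'' \<oplus> Const 2 \<ominus> V ''p'') ;; Assign ''lz'' (V ''lw'') ;;
     If (Op Eq (Get ''path'' (V ''xb'' \<oplus> V ''p'')) (Get ''path'' (V ''base'' \<oplus> V ''p'')))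
       (If (Op Eq (Get ''path'' (V ''xb'' \<oplus> V ''p'' \<oplus> Const 1)) (Get ''path'' (V ''base'' \<oplus> V ''p'' \<oplus> Const 1)))
          Skip
          (Assign ''lz'' (V ''lw'' \<oplus> V ''lw'' \<ominus> Const 1)))
       Skip ;;
     For ''l'' (V ''lz'') fill ;;
     find_repeat)"

definition compare_walks :: com where
  "compare_walks = For ''p'' (V ''L'' \<oplus> Const 1) join_walks"

text \<open>The key contains the trial number, so entries of earlier trials are never met and the
  table needs no clearing.\<close>

definition process :: com where
  "process =
    If (V ''ok'')
      (Assign ''key'' (V ''t'' \<otimes> (V ''n'' \<oplus> Const 1) \<oplus> Get ''path'' (V ''base'' \<oplus> V ''L'' \<oplus> Const 1)) ;;
       If (Get ''slot'' (V ''key''))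
         (Assign ''xb'' (Get ''slot'' (V ''key'') \<otimes> (V ''L'' \<oplus> Const 2)) ;; compare_walks)
         (Put ''slot'' (V ''key'') (V ''id'')))
      Skip"

text \<open>Identifiers start from 1 because 0 marks an empty slot. Each identifier owns the segment
  of \<open>path\<close> that starts at \<open>base\<close>, so stored walks survive later
  ones.\<close>

definition one_walk :: com where
  "one_walk =
    (Assign ''id'' (V ''t'' \<otimes> V ''M'' \<oplus> V ''k'' \<oplus> Const 1) ;;
     Assign ''base'' (V ''id'' \<otimes> (V ''L'' \<oplus> Const 2)) ;;
     Assign ''rb'' (V ''t'' \<otimes> V ''S'' \<oplus> Const 1 \<oplus> V ''k'' \<otimes> V ''L'') ;;
     do_walk ;; process)"

definition one_trial :: com where
  "one_trial =
    (Assign ''r0'' (Get ''rnd'' (V ''t'' \<otimes> V ''S'')) ;;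
     Assign ''u'' (Op Mod (V ''r0'') (V ''n'') \<oplus> Const 1) ;;
     Query ''v'' (Const 0) (V ''u'') (Op Mod (Op Div (V ''r0'') (V ''n'')) (V ''d'') \<oplus> Const 1) ;;
     If (V ''v'') (For ''k'' (V ''M'') one_walk) Skip)"

definition run_trials :: com where
  "run_trials = For ''t'' (V ''T'') one_trial"

subsection \<open>Walks\<close>

lemma mods_dead_test [simp]: "mods dead_test = {''qa'', ''qb'', ''hd'', ''tl'', ''g'', ''h'', ''y''}"
  by (auto simp: dead_test_def search_body_def expand_body_def)

lemma mods_find_kids [simp]:
  "mods find_kids = {''c'', ''f'', ''w'', ''kid'', ''qa'', ''qb'', ''hd'', ''tl'', ''g'', ''h'', ''y''}"
  by (auto simp: find_kids_def kid_body_def add_kid_def)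

lemma mods_do_walk [simp]:
  "mods do_walk = {''path'', ''ok'', ''i'', ''a'', ''b'', ''c'', ''f'', ''w'', ''kid'', ''qa'', ''qb'', ''hd'', ''tl'', ''g'', ''h'', ''y''}"
  by (auto simp: do_walk_def walk_step_def choose_kid_def)

context adjacency_graph begin

abbreviation answer :: "nat \<Rightarrow> nat \<Rightarrow> nat" where "answer \<equiv> neighbour n adj"

lemma answer_nth: "v \<in> vertices \<Longrightarrow> answer v (Suc j) = (if j < length (adj v) then adj v ! j else 0)"
  by (auto simp: neighbour_def)

lemma answer_le: "answer v i \<le> n"
proof -
  have "adj v ! (i - 1) \<le> n" if "v \<in> vertices" "i \<in> {1..length (adj v)}"
    using adj_vertex[OF that(1), of "adj v ! (i - 1)"] that(2) by auto
  then show ?thesis by (auto simp: neighbour_def)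
qed

lemma explore_Nil [simp]: "explore k []"
  by (cases k) auto

definition queue :: "arc list \<Rightarrow> store \<Rightarrow> bool" where
  "queue es s \<longleftrightarrow> s ''tl'' 0 = length es \<and>
     (\<forall>i<length es. s ''qa'' i = fst (es ! i) \<and> s ''qb'' i = snd (es ! i))"

lemma queue_snoc:
  assumes "queue es s" "s' ''tl'' 0 = Suc (length es)"
    "s' ''qa'' = (s ''qa'')(length es := v)" "s' ''qb'' = (s ''qb'')(length es := w)"
  shows "queue (es @ [(v, w)]) s'"
  using assms by (auto simp: queue_def nth_append less_Suc_eq)

lemma wp_expand:
  assumes s: "bounded_store b s" "queue es s" "i < length es" "es ! i = (u, v)" "(u, v) \<in> arcs"
      "s ''hd'' 0 = i" "s ''d'' 0 = d"
    and b: "length es + d < 2 ^ b" "n < 2 ^ b"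
    and R: "\<And>s' k'. bounded_store b s' \<Longrightarrow> (\<forall>a. a \<notin> insert ''h'' (mods expand_body) \<longrightarrow> s' a = s a) \<Longrightarrow>
      queue (es @ children (u, v)) s' \<Longrightarrow> k' \<le> k + d * 15 + 3 \<Longrightarrow> R s' k'"
  shows "wp answer b (For ''h'' (V ''d'') expand_body) s k R"
proof -
  let ?l = "\<lambda>j. map (Pair v) (filter (\<lambda>w. w \<noteq> u) (take j (adj v)))"
  have v: "v \<in> vertices" "u \<in> vertices" using s(5) arcs_vertices by auto
  show ?thesis
  proof (rule wp_For[where m = d and N = 12 and I = "\<lambda>j s. queue (es @ ?l j) s"])
    show "queue (es @ ?l 0) (update s ''h'' 0 0)" using s by (simp add: queue_def update_def)
    show "bounded_store b s" by (rule s)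
    show "d < 2 ^ b" using b by simp
    show "''h'' \<notin> mods expand_body" by (simp add: expand_body_def)
    show "evaluate s1 (V ''d'') = d"
      if "\<forall>a. a \<notin> insert ''h'' (mods expand_body) \<longrightarrow> s1 a = s a" for s1
      using that s by (simp add: expand_body_def)
  next
    fix j s1 k1
    assume j: "j < d" and fr: "\<forall>a. a \<notin> insert ''h'' (mods expand_body) \<longrightarrow> s1 a = s a"
      and bs: "bounded_store b s1" and h: "s1 ''h'' 0 = j" and q: "queue (es @ ?l j) s1"
    have hd: "s1 ''hd'' 0 = i" using fr s by (simp add: expand_body_def)
    have qi: "s1 ''qa'' i = u" "s1 ''qb'' i = v"
      using q s(3,4) by (auto simp: queue_def nth_append)
    have tl: "s1 ''tl'' 0 = length es + length (?l j)" using q by (simp add: queue_def)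
    have ll: "length (?l j) \<le> j"
      by (metis length_filter_le length_map length_take min.bounded_iff)
    have v2: "v < 2 ^ b" using v b by simp
    show "wp answer b expand_body s1 k1 (\<lambda>s2 k2. k2 \<le> k1 + 12 \<and> queue (es @ ?l (Suc j)) (update s2 ''h'' 0 (Suc j)))"
    proof (cases "j < length (adj v)")
      case False
      then have "?l (Suc j) = ?l j" by simp
      then show ?thesis using False q v h hd qi
        by (simp add: expand_body_def answer_nth update_def queue_def)
    next
      case True
      have w: "adj v ! j \<in> vertices" using adj_vertex[OF v(1)] True by simp
      then have w2: "adj v ! j < 2 ^ b" "adj v ! j \<noteq> 0" using b by auto
      show ?thesis
      proof (cases "adj v ! j = u")
        case eq: True
        then have "?l (Suc j) = ?l j" using True by (simp add: take_Suc_conv_app_nth)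
        then show ?thesis using True eq q v h hd qi w2
          by (simp add: expand_body_def answer_nth update_def queue_def)
      next
        case neq: False
        then have l: "?l (Suc j) = ?l j @ [(v, adj v ! j)]" using True by (simp add: take_Suc_conv_app_nth)
        have "Suc (length es + length (?l j)) < 2 ^ b" using ll j b by linarith
        moreover define s2 where "s2 = update (update (update (update s1 ''y'' 0 (adj v ! j))
            ''qa'' (length es + length (?l j)) v) ''qb'' (length es + length (?l j)) (adj v ! j))
            ''tl'' 0 (length es + length (?l j) + 1)"
        moreover have "queue ((es @ ?l j) @ [(v, adj v ! j)]) (update s2 ''h'' 0 (Suc j))"
          by (rule queue_snoc[OF q]) (simp_all add: s2_def update_def)
        ultimately show ?thesis unfolding l using True neq v h hd qi w2 tl v2
          by (simp add: expand_body_def answer_nth update_def)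
      qed
    qed
  next
    fix s1 k1
    assume fr: "\<forall>a. a \<notin> insert ''h'' (mods expand_body) \<longrightarrow> s1 a = s a" "bounded_store b s1"
      "queue (es @ ?l d) s1" "k1 \<le> k + d * (12 + 3) + 3"
    have "?l d = children (u, v)" using length_adj[OF v(1)] by (simp add: children_def)
    then show "R s1 k1" using fr by (intro R) auto
  qed
qed

lemma wp_dead_test:
  assumes s: "bounded_store b s" "s ''d'' 0 = d" "s ''B'' 0 = B" "(s ''b'' 0, s ''w'' 0) \<in> arcs"
    and b: "1 + B * d + d + B < 2 ^ b" "n < 2 ^ b"
    and R: "\<And>s' k'. bounded_store b s' \<Longrightarrow> (\<forall>a. a \<notin> mods dead_test \<longrightarrow> s' a = s a) \<Longrightarrow>
      s' ''hd'' 0 < s' ''tl'' 0 \<longleftrightarrow> \<not> dead B (s ''b'' 0, s ''w'' 0) \<Longrightarrow>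
      k' \<le> k + B * (d * 15 + 10) + 11 \<Longrightarrow> R s' k'"
  shows "wp answer b dead_test s k R"
proof -
  let ?e = "(s ''b'' 0, s ''w'' 0)"
  define s0 where "s0 = update (update (update (update s ''qa'' 0 (s ''b'' 0)) ''qb'' 0 (s ''w'' 0)) ''hd'' 0 0) ''tl'' 0 1"
  have s0: "bounded_store b s0" "s0 ''d'' 0 = d" "s0 ''B'' 0 = B" "s0 ''hd'' 0 = 0" "queue [?e] s0"
    using s b by (auto simp: s0_def update_def bounded_store_def queue_def)
  have fr0: "\<forall>a. a \<notin> mods dead_test \<longrightarrow> s0 a = s a" by (simp add: s0_def update_def)
  \<comment> \<open>The answer of \<open>explore\<close> for the original arc equals the answer for
    the unprocessed part of the queue with the remaining budget. The length bound keeps all queue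
    positions below \<open>2 ^ b\<close>.\<close>
  define I where "I = (\<lambda>g s1. \<exists>es. queue es s1 \<and> s1 ''hd'' 0 \<le> length es \<and> set es \<subseteq> arcs \<and>
      length es \<le> 1 + g * d \<and> s1 ''hd'' 0 \<le> g \<and>
      explore B [?e] = explore (B - g) (drop (s1 ''hd'' 0) es))"
  have "wp answer b (For ''g'' (V ''B'') search_body) s0 (k + 8) R"
  proof (rule wp_For[where m = B and N = "d * 15 + 7" and I = I])
    show "bounded_store b s0" "B < 2 ^ b" using s0 b by auto
    show "''g'' \<notin> mods search_body" by (simp add: search_body_def expand_body_def)
    show "I 0 (update s0 ''g'' 0 0)" unfolding I_def
      by (rule exI[of _ "[?e]"]) (use s0 s in \<open>auto simp: update_def queue_def\<close>)
    show "evaluate s1 (V ''B'') = B"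
      if "\<forall>a. a \<notin> insert ''g'' (mods search_body) \<longrightarrow> s1 a = s0 a" for s1
      using that s0 by (simp add: search_body_def expand_body_def)
  next
    fix g s1 k1
    assume g: "g < B" and fr: "\<forall>a. a \<notin> insert ''g'' (mods search_body) \<longrightarrow> s1 a = s0 a"
      and bs: "bounded_store b s1" and "I g s1"
    then obtain es where es: "queue es s1" "s1 ''hd'' 0 \<le> length es" "set es \<subseteq> arcs"
      "length es \<le> 1 + g * d" "s1 ''hd'' 0 \<le> g"
      "explore B [?e] = explore (B - g) (drop (s1 ''hd'' 0) es)" unfolding I_def by auto
    have d1: "s1 ''d'' 0 = d" using fr s0 by (simp add: search_body_def expand_body_def)
    have tl: "s1 ''tl'' 0 = length es" using es by (simp add: queue_def)
    obtain B' where B': "B - g = Suc B'" using g by (metis Suc_diff_Suc)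
    then have Bs: "B - Suc g = B'" by simp
    show "wp answer b search_body s1 k1
        (\<lambda>s2 k2. k2 \<le> k1 + (d * 15 + 7) \<and> I (Suc g) (update s2 ''g'' 0 (Suc g)))"
    proof (cases "s1 ''hd'' 0 < length es")
      case False
      \<comment> \<open>On an empty queue \<open>explore\<close> is true for every budget, so an
        idle round preserves the invariant.\<close>
      then have "drop (s1 ''hd'' 0) es = []" by simp
      then have "I (Suc g) (update s1 ''g'' 0 (Suc g))" unfolding I_def
        by (intro exI[of _ es]) (use es Bs B' in \<open>auto simp: update_def queue_def\<close>)
      then show ?thesis using False tl by (simp add: search_body_def)
    next
      case True
      obtain u v where uv: "es ! (s1 ''hd'' 0) = (u, v)" by fastforce
      have uva: "(u, v) \<in> arcs" using True es(3) uv nth_mem by fastforce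
      have "g * d \<le> B * d" using g by (intro mult_le_mono1) simp
      then have lb: "length es + d < 2 ^ b" using es(4) b by linarith
      have "wp answer b (For ''h'' (V ''d'') expand_body) s1 (k1 + 2)
         (\<lambda>s' k'. s' ''hd'' 0 + 1 < 2 ^ b \<and> k' + 1 \<le> k1 + (d * 15 + 7) \<and>
            I (Suc g) (update (update s' ''hd'' 0 (s' ''hd'' 0 + 1)) ''g'' 0 (Suc g)))"
      proof (rule wp_expand[OF bs es(1) True uv uva refl d1 lb b(2)])
        fix s' k'
        assume s': "bounded_store b s'" "\<forall>a. a \<notin> insert ''h'' (mods expand_body) \<longrightarrow> s' a = s1 a"
          "queue (es @ children (u, v)) s'" "k' \<le> k1 + 2 + d * 15 + 3"
        have hd: "s' ''hd'' 0 = s1 ''hd'' 0" using s'(2) by (simp add: expand_body_def)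
        have lc: "length (children (u, v)) \<le> d"
          using length_adj[of v] arcs_vertices[OF uva] by (simp add: children_def) (meson le_trans length_filter_le)
        have sc: "set (children (u, v)) \<subseteq> arcs" using set_children[OF uva] by auto
        have "drop (s1 ''hd'' 0) es = (u, v) # drop (Suc (s1 ''hd'' 0)) es"
          using Cons_nth_drop_Suc[OF True] uv by simp
        then have ex: "explore B [?e] = explore (B - Suc g) (drop (Suc (s1 ''hd'' 0)) (es @ children (u, v)))"
          using es(6) B' Bs True by simp
        have "I (Suc g) (update (update s' ''hd'' 0 (s' ''hd'' 0 + 1)) ''g'' 0 (Suc g))"
          unfolding I_def
          by (intro exI[of _ "es @ children (u, v)"])
             (use s'(3) hd es True lc sc ex in \<open>auto simp: update_def queue_def\<close>)
        moreover have "s' ''hd'' 0 + 1 < 2 ^ b" using hd es(5) g b by linarith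
        ultimately show "s' ''hd'' 0 + 1 < 2 ^ b \<and> k' + 1 \<le> k1 + (d * 15 + 7) \<and>
            I (Suc g) (update (update s' ''hd'' 0 (s' ''hd'' 0 + 1)) ''g'' 0 (Suc g))" using s'(4) by simp
      qed
      then show ?thesis using True tl by (simp add: search_body_def)
    qed
  next
    fix s1 k1
    assume s1: "\<forall>a. a \<notin> insert ''g'' (mods search_body) \<longrightarrow> s1 a = s0 a" "bounded_store b s1" "I B s1"
      "k1 \<le> k + 8 + B * (d * 15 + 7 + 3) + 3"
    then obtain es where es: "queue es s1" "s1 ''hd'' 0 \<le> length es"
      "explore B [?e] = explore (B - B) (drop (s1 ''hd'' 0) es)" unfolding I_def by auto
    have dead: "s1 ''hd'' 0 < s1 ''tl'' 0 \<longleftrightarrow> \<not> dead B ?e"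
      using es by (auto simp: dead_def queue_def)
    have fr: "\<forall>a. a \<notin> mods dead_test \<longrightarrow> s1 a = s a"
      using s1(1) fr0 by (simp add: search_body_def expand_body_def)
    have "k1 \<le> k + B * (d * 15 + 10) + 11" using s1(4) by (simp add: algebra_simps)
    then show "R s1 k1" by (rule R[OF s1(2) fr dead])
  qed
  moreover have "s ''b'' 0 < 2 ^ b" "s ''w'' 0 < 2 ^ b" "(1::nat) < 2 ^ b"
    using s(1) b by (auto simp: bounded_store_def)
  ultimately show ?thesis
    by (simp add: dead_test_def s0_def) (simp add: update_def numeral_eq_Suc)
qed

definition kid_array :: "nat list \<Rightarrow> store \<Rightarrow> bool" where
  "kid_array ws s \<longleftrightarrow> s ''c'' 0 = length ws \<and> (\<forall>i<length ws. s ''kid'' i = ws ! i)"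

lemma wp_find_kids:
  assumes s: "bounded_store b s" "s ''d'' 0 = d" "s ''B'' 0 = B" "(s ''a'' 0, s ''b'' 0) \<in> arcs"
    and b: "1 + B * d + d + B < 2 ^ b" "n < 2 ^ b"
    and R: "\<And>s' k'. bounded_store b s' \<Longrightarrow> (\<forall>a. a \<notin> mods find_kids \<longrightarrow> s' a = s a) \<Longrightarrow>
      kid_array (kids B (s ''a'' 0) (s ''b'' 0)) s' \<Longrightarrow>
      k' \<le> k + d * (B * (d * 15 + 10) + 30) + 6 \<Longrightarrow> R s' k'"
  shows "wp answer b find_kids s k R"
proof -
  let ?u = "s ''a'' 0" and ?v = "s ''b'' 0"
  let ?l = "\<lambda>j. filter (\<lambda>w. w \<noteq> ?u \<and> \<not> dead B (?v, w)) (take j (adj ?v))"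
  have v: "?v \<in> vertices" "?u \<in> vertices" using s(4) arcs_vertices by auto
  define s0 where "s0 = update s ''c'' 0 0"
  have s0: "bounded_store b s0" "kid_array [] s0" "s0 ''d'' 0 = d"
    using s by (auto simp: s0_def update_def bounded_store_def kid_array_def)
  have fr0: "\<forall>a. a \<noteq> ''c'' \<longrightarrow> s0 a = s a" by (simp add: s0_def update_def)
  have "wp answer b (For ''f'' (V ''d'') kid_body) s0 (k + 2) R"
  proof (rule wp_For[where m = d and N = "B * (d * 15 + 10) + 25" and I = "\<lambda>j s. kid_array (?l j) s"])
    show "bounded_store b s0" "d < 2 ^ b" using s0 b by auto
    show "''f'' \<notin> mods kid_body" by (simp add: kid_body_def add_kid_def)
    show "kid_array (?l 0) (update s0 ''f'' 0 0)" using s0 by (simp add: kid_array_def update_def)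
    show "evaluate s1 (V ''d'') = d"
      if "\<forall>a. a \<notin> insert ''f'' (mods kid_body) \<longrightarrow> s1 a = s0 a" for s1
      using that s0 by (simp add: kid_body_def add_kid_def)
  next
    fix j s1 k1
    assume j: "j < d" and fr: "\<forall>a. a \<notin> insert ''f'' (mods kid_body) \<longrightarrow> s1 a = s0 a"
      and bs: "bounded_store b s1" and f: "s1 ''f'' 0 = j" and ka: "kid_array (?l j) s1"
    have s1: "s1 ''d'' 0 = d" "s1 ''B'' 0 = B" "s1 ''a'' 0 = ?u" "s1 ''b'' 0 = ?v"
      using fr fr0 s by (simp_all add: kid_body_def add_kid_def)
    have ll: "length (?l j) \<le> j"
      by (metis length_filter_le length_take min.bounded_iff)
    show "wp answer b kid_body s1 k1
        (\<lambda>s2 k2. k2 \<le> k1 + (B * (d * 15 + 10) + 25) \<and> kid_array (?l (Suc j)) (update s2 ''f'' 0 (Suc j)))"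
    proof (cases "j < length (adj ?v)")
      case False
      then have "?l (Suc j) = ?l j" by simp
      then show ?thesis using False ka v f s1
        by (auto simp: kid_body_def answer_nth update_def kid_array_def)
    next
      case True
      let ?w = "adj ?v ! j"
      have w: "?w \<in> vertices" "?w \<in> set (adj ?v)" using adj_vertex[OF v(1)] True by auto
      then have w2: "?w < 2 ^ b" "?w \<noteq> 0" using b by auto
      have vw: "(?v, ?w) \<in> arcs" using w v by (simp add: arcs_def)
      show ?thesis
      proof (cases "?w = ?u")
        case eq: True
        then have "?l (Suc j) = ?l j" using True by (simp add: take_Suc_conv_app_nth)
        then show ?thesis using True eq ka v f s1 w2
          by (simp add: kid_body_def answer_nth update_def kid_array_def)
      next
        case neq: False
        define s2 where "s2 = update s1 ''w'' 0 ?w"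
        have s2: "bounded_store b s2" "s2 ''d'' 0 = d" "s2 ''B'' 0 = B" "s2 ''b'' 0 = ?v" "s2 ''w'' 0 = ?w"
          "kid_array (?l j) s2"
          using bs s1 w2 ka by (auto simp: s2_def update_def bounded_store_def kid_array_def)
        have "wp answer b dead_test s2 (k1 + 5) (\<lambda>s3 k3. wp answer b add_kid s3 k3
             (\<lambda>s2 k2. k2 \<le> k1 + (B * (d * 15 + 10) + 25) \<and> kid_array (?l (Suc j)) (update s2 ''f'' 0 (Suc j))))"
        proof (rule wp_dead_test[OF s2(1,2,3) _ b])
          show "(s2 ''b'' 0, s2 ''w'' 0) \<in> arcs" using vw s2 by simp
          fix s3 k3
          assume s3: "bounded_store b s3" "\<forall>a. a \<notin> mods dead_test \<longrightarrow> s3 a = s2 a"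
            "s3 ''hd'' 0 < s3 ''tl'' 0 \<longleftrightarrow> \<not> dead B (s2 ''b'' 0, s2 ''w'' 0)"
            "k3 \<le> k1 + 5 + B * (d * 15 + 10) + 11"
          have s3': "s3 ''w'' 0 = ?w" "kid_array (?l j) s3"
            using s3(2) s2 by (auto simp: kid_array_def)
          show "wp answer b add_kid s3 k3
             (\<lambda>s2 k2. k2 \<le> k1 + (B * (d * 15 + 10) + 25) \<and> kid_array (?l (Suc j)) (update s2 ''f'' 0 (Suc j)))"
          proof (cases "dead B (?v, ?w)")
            case dead: True
            then have l: "?l (Suc j) = ?l j" using True by (simp add: take_Suc_conv_app_nth)
            show ?thesis unfolding l using s3 s3' s2 dead by (simp add: add_kid_def kid_array_def update_def)
          next
            case alive: False
            then have l: "?l (Suc j) = ?l j @ [?w]" using True neq by (simp add: take_Suc_conv_app_nth)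
            have c: "s3 ''c'' 0 = length (?l j)" using s3' by (simp add: kid_array_def)
            have "Suc (length (?l j)) < 2 ^ b" using ll j b by linarith
            then show ?thesis unfolding l using s3 s3' s2 alive w2 c
              by (auto simp: add_kid_def kid_array_def update_def nth_append less_Suc_eq)
          qed
        qed
        then show ?thesis using True neq v f s1 w2
          by (simp add: kid_body_def answer_nth s2_def) (simp add: update_def numeral_eq_Suc)
      qed
    qed
  next
    fix s1 k1
    assume s1: "\<forall>a. a \<notin> insert ''f'' (mods kid_body) \<longrightarrow> s1 a = s0 a" "bounded_store b s1"
      "kid_array (?l d) s1" "k1 \<le> k + 2 + d * (B * (d * 15 + 10) + 25 + 3) + 3"
    have "?l d = kids B ?u ?v" using length_adj[OF v(1)] by (simp add: kids_def)
    then have kids: "kid_array (kids B ?u ?v) s1" using s1(3) by (simp only:)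
    have fr: "\<forall>a. a \<notin> mods find_kids \<longrightarrow> s1 a = s a"
      using s1(1) fr0 by (simp add: kid_body_def add_kid_def)
    have "d * (B * (d * 15 + 10) + 25 + 3) \<le> d * (B * (d * 15 + 10) + 30)"
      by (intro mult_le_mono2) simp
    then have "k1 \<le> k + d * (B * (d * 15 + 10) + 30) + 6" using s1(4) by linarith
    then show "R s1 k1" by (rule R[OF s1(2) fr kids])
  qed
  then show ?thesis by (simp add: find_kids_def s0_def numeral_eq_Suc)
qed

definition stored_path :: "nat \<Rightarrow> nat list \<Rightarrow> store \<Rightarrow> bool" where
  "stored_path base p s \<longleftrightarrow> (\<forall>i<length p. s ''path'' (base + i) = p ! i)"

text \<open>After \<open>j\<close> rounds the segment holds the walk for the first \<open>j\<close>
  numbers, and \<open>walk_snoc\<close> extends it. A stuck walk clears \<open>ok\<close>, after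
  which the rounds are idle. The clause about \<open>path\<close> outside the segment protects the
  walks stored earlier.\<close>

lemma wp_do_walk:
  assumes s: "bounded_store b s" "s ''d'' 0 = d" "s ''B'' 0 = B" "s ''L'' 0 = L" "(s ''u'' 0, s ''v'' 0) \<in> arcs"
    and rs: "length rs = L" "\<And>i. i < L \<Longrightarrow> s ''rnd'' (s ''rb'' 0 + i) = rs ! i"
    and b: "1 + B * d + d + B < 2 ^ b" "n < 2 ^ b" "L < 2 ^ b"
    and R: "\<And>s' k'. bounded_store b s' \<Longrightarrow> (\<forall>a. a \<notin> mods do_walk \<longrightarrow> s' a = s a) \<Longrightarrow>
      (\<forall>i. i < s ''base'' 0 \<or> s ''base'' 0 + L + 2 \<le> i \<longrightarrow> s' ''path'' i = s ''path'' i) \<Longrightarrow>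
      s' ''ok'' 0 = (if walk B rs (s ''u'' 0) (s ''v'' 0) = None then 0 else 1) \<Longrightarrow>
      (\<And>p. walk B rs (s ''u'' 0) (s ''v'' 0) = Some p \<Longrightarrow> stored_path (s ''base'' 0) p s') \<Longrightarrow>
      k' \<le> k + L * (d * (B * (d * 15 + 10) + 30) + 20) + 9 \<Longrightarrow> R s' k'"
  shows "wp answer b do_walk s k R"
proof -
  let ?u = "s ''u'' 0" and ?v = "s ''v'' 0" and ?base = "s ''base'' 0"
  let ?N = "d * (B * (d * 15 + 10) + 30) + 17"
  have uv: "?u \<in> vertices" "?v \<in> vertices" using s(5) arcs_vertices by auto
  define s0 where "s0 = update (update (update s ''path'' ?base ?u) ''path'' (?base + 1) ?v) ''ok'' 0 1"
  have one: "(1::nat) < 2 ^ b" using b by simp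
  have uv2: "?u < 2 ^ b" "?v < 2 ^ b" using uv b by auto
  have s0: "bounded_store b s0" using s(1) uv2 one by (auto simp: s0_def update_def bounded_store_def)
  have fr0: "\<forall>a. a \<notin> {''path'', ''ok''} \<longrightarrow> s0 a = s a" by (simp add: s0_def update_def)
  define I where "I = (\<lambda>j s1. (\<forall>i. i < ?base \<or> ?base + L + 2 \<le> i \<longrightarrow> s1 ''path'' i = s ''path'' i) \<and>
      s1 ''ok'' 0 = (if walk B (take j rs) ?u ?v = None then 0 else 1) \<and>
      (\<forall>p. walk B (take j rs) ?u ?v = Some p \<longrightarrow> stored_path ?base p s1))"
  have mods_step: "mods walk_step = {''path'', ''ok'', ''a'', ''b'', ''c'', ''f'', ''w'', ''kid'', ''qa'', ''qb'', ''hd'', ''tl'', ''g'', ''h'', ''y''}"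
    by (auto simp: walk_step_def choose_kid_def)
  have "wp answer b (For ''i'' (V ''L'') walk_step) s0 (k + 6) R"
  proof (rule wp_For[where m = L and N = ?N and I = I])
    show "bounded_store b s0" "L < 2 ^ b" using s0 b by auto
    show "''i'' \<notin> mods walk_step" by (simp add: mods_step)
    show "I 0 (update s0 ''i'' 0 0)"
      by (auto simp: I_def s0_def update_def stored_path_def less_Suc_eq)
    show "evaluate s1 (V ''L'') = L"
      if "\<forall>a. a \<notin> insert ''i'' (mods walk_step) \<longrightarrow> s1 a = s0 a" for s1
      using that s fr0 by (simp add: mods_step)
  next
    fix j s1 k1
    assume j: "j < L" and fr: "\<forall>a. a \<notin> insert ''i'' (mods walk_step) \<longrightarrow> s1 a = s0 a"
      and bs: "bounded_store b s1" and i: "s1 ''i'' 0 = j" and Ij: "I j s1"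
    have s1: "s1 ''d'' 0 = d" "s1 ''B'' 0 = B" "s1 ''base'' 0 = ?base" "s1 ''rb'' 0 = s ''rb'' 0" "s1 ''rnd'' = s ''rnd''"
      using fr fr0 s by (simp_all add: mods_step)
    have tk: "take (Suc j) rs = take j rs @ [rs ! j]" using j rs(1) by (simp add: take_Suc_conv_app_nth)
    have ltk: "length (take j rs) = j" using j rs(1) by simp
    show "wp answer b walk_step s1 k1 (\<lambda>s2 k2. k2 \<le> k1 + ?N \<and> I (Suc j) (update s2 ''i'' 0 (Suc j)))"
    proof (cases "walk B (take j rs) ?u ?v")
      case None
      then have "s1 ''ok'' 0 = 0" "walk B (take (Suc j) rs) ?u ?v = None"
        using Ij by (auto simp: I_def tk walk_snoc)
      then show ?thesis using Ij by (simp add: walk_step_def I_def update_def)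
    next
      case (Some p)
      then have ok: "s1 ''ok'' 0 = 1" and st: "stored_path ?base p s1" using Ij by (auto simp: I_def)
      have lp: "length p = j + 2" using walk_length[OF Some] ltk by simp
      let ?a = "p ! j" and ?b = "p ! Suc j"
      have ab: "(?a, ?b) \<in> arcs" using walk_nb[OF s(5) Some] lp by (simp add: nb_walk_def)
      have pa: "s1 ''path'' (?base + j) = ?a" "s1 ''path'' (?base + j + 1) = ?b"
        using st lp by (auto simp: stored_path_def add.assoc)
      let ?ks = "kids B ?a ?b"
      have snoc: "walk B (take (Suc j) rs) ?u ?v
          = (if ?ks = [] then None else Some (p @ [?ks ! (rs ! j mod length ?ks)]))"
        using Some j rs(1) by (simp add: tk walk_snoc Let_def min_def)
      define s2 where "s2 = update (update s1 ''a'' 0 ?a) ''b'' 0 ?b"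
      have ab2: "?a < 2 ^ b" "?b < 2 ^ b" using arcs_vertices[OF ab] b by auto
      have s2: "bounded_store b s2" "s2 ''d'' 0 = d" "s2 ''B'' 0 = B" "s2 ''a'' 0 = ?a" "s2 ''b'' 0 = ?b"
        using bs s1 ab2 by (auto simp: s2_def update_def bounded_store_def)
      have "wp answer b find_kids s2 (k1 + 6) (\<lambda>s3 k3. wp answer b choose_kid s3 k3
          (\<lambda>s2 k2. k2 \<le> k1 + ?N \<and> I (Suc j) (update s2 ''i'' 0 (Suc j))))"
      proof (rule wp_find_kids[OF s2(1,2,3) _ b(1,2)])
        show "(s2 ''a'' 0, s2 ''b'' 0) \<in> arcs" using ab s2 by simp
        fix s3 k3
        assume s3: "bounded_store b s3" "\<forall>a. a \<notin> mods find_kids \<longrightarrow> s3 a = s2 a"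
          "kid_array (kids B (s2 ''a'' 0) (s2 ''b'' 0)) s3"
          "k3 \<le> k1 + 6 + d * (B * (d * 15 + 10) + 30) + 6"
        have ka: "kid_array ?ks s3" using s3(3) s2 by simp
        have s3': "s3 ''path'' = s1 ''path''" "s3 ''ok'' 0 = 1" "s3 ''i'' 0 = j" "s3 ''base'' 0 = ?base"
            "s3 ''rb'' 0 = s ''rb'' 0" "s3 ''rnd'' = s ''rnd''"
          using s3(2) s1 ok i by (auto simp: s2_def update_def)
        show "wp answer b choose_kid s3 k3
          (\<lambda>s2 k2. k2 \<le> k1 + ?N \<and> I (Suc j) (update s2 ''i'' 0 (Suc j)))"
        proof (cases "?ks = []")
          case True
          then show ?thesis using ka s3 s3' Ij snoc
            by (auto simp: choose_kid_def kid_array_def I_def update_def)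
        next
          case False
          let ?w = "?ks ! (rs ! j mod length ?ks)"
          have kid: "s3 ''kid'' (rs ! j mod length ?ks) = ?w" "s3 ''c'' 0 = length ?ks"
            using ka False by (auto simp: kid_array_def)
          have rnd: "s3 ''rnd'' (s ''rb'' 0 + j) = rs ! j" using s3' rs(2)[OF j] by simp
          have w2: "?w < 2 ^ b" using kid s3(1) unfolding bounded_store_def by metis
          have "stored_path ?base (p @ [?w]) (update (update s3 ''path'' (?base + j + 2) ?w) ''i'' 0 (Suc j))"
            using st lp s3' by (auto simp: stored_path_def update_def nth_append less_Suc_eq)
          moreover have "\<forall>i. i < ?base \<or> ?base + L + 2 \<le> i \<longrightarrow>
              (update (update s3 ''path'' (?base + j + 2) ?w) ''i'' 0 (Suc j)) ''path'' i = s ''path'' i"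
            using Ij s3' j by (auto simp: I_def update_def)
          ultimately have "I (Suc j) (update (update s3 ''path'' (?base + j + 2) ?w) ''i'' 0 (Suc j))"
            unfolding I_def using snoc False s3' by (simp add: update_def)
          then show ?thesis using False kid rnd w2 s3 s3' by (simp add: choose_kid_def)
        qed
      qed
      then show ?thesis using ok pa i s1 ab2
        by (simp add: walk_step_def s2_def) (simp add: update_def numeral_eq_Suc)
    qed
  next
    fix s1 k1
    assume s1: "\<forall>a. a \<notin> insert ''i'' (mods walk_step) \<longrightarrow> s1 a = s0 a" "bounded_store b s1" "I L s1"
      "k1 \<le> k + 6 + L * (?N + 3) + 3"
    show "R s1 k1"
    proof (rule R)
      show "\<forall>a. a \<notin> mods do_walk \<longrightarrow> s1 a = s a" using s1(1) fr0 by (auto simp: mods_step)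
      show "k1 \<le> k + L * (d * (B * (d * 15 + 10) + 30) + 20) + 9" using s1(4) by (simp add: algebra_simps)
    qed (use s1 rs in \<open>auto simp: I_def\<close>)
  qed
  then show ?thesis using uv2 one by (simp add: do_walk_def s0_def) (simp add: update_def numeral_eq_Suc)
qed

end

subsection \<open>Search for a cycle\<close>

lemma mods_find_repeat [simp]: "mods find_repeat = {''j'', ''r'', ''s'', ''reject'', ''cert''}"
  by (auto simp: find_repeat_def compare_def copy_cycle_def)

lemma mods_compare_walks [simp]:
  "mods compare_walks = {''p'', ''lw'', ''lz'', ''l'', ''W'', ''j'', ''r'', ''s'', ''reject'', ''cert''}"
  by (auto simp: compare_walks_def join_walks_def fill_def)

definition repeat_cost :: "nat \<Rightarrow> nat" where "repeat_cost K = K * (K * (4 * K + 20) + 6) + 3"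

definition compare_cost :: "nat \<Rightarrow> nat" where
  "compare_cost L = (L + 1) * ((2 * L + 3) * 5 + repeat_cost (2 * L + 3) + 30) + 3"

context adjacency_graph begin

text \<open>One-sided error as an invariant. The bound \<open>K\<close> will be the length of the
  longest joined walk.\<close>

definition certified :: "nat \<Rightarrow> store \<Rightarrow> bool" where
  "certified K s \<longleftrightarrow> (s ''reject'' 0 \<noteq> 0 \<longrightarrow>
     is_cycle E (map (s ''cert'') [1..<Suc (s ''cert'' 0)]) \<and> s ''cert'' 0 \<le> K)"

lemma certified_upd [simp]:
  "a \<noteq> ''reject'' \<Longrightarrow> a \<noteq> ''cert'' \<Longrightarrow> certified K (s(a := f)) \<longleftrightarrow> certified K s"
  by (simp add: certified_def)

lemma certified_cong:
  "s' ''reject'' = s ''reject'' \<Longrightarrow> s' ''cert'' = s ''cert'' \<Longrightarrow> certified K s' \<longleftrightarrow> certified K s"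
  by (simp add: certified_def)

lemma wp_copy_cycle:
  assumes s: "bounded_store b s" "s ''r'' 0 = r" "s ''j'' 0 = j" "r < j" "j < length ws" "length ws < 2 ^ b"
      "\<forall>i<length ws. s ''W'' i = ws ! i" "s ''reject'' 0 = 1" "s ''cert'' 0 = j - r"
    and R: "\<And>s' k'. bounded_store b s' \<Longrightarrow> (\<forall>a. a \<notin> {''s'', ''cert''} \<longrightarrow> s' a = s a) \<Longrightarrow>
      s' ''cert'' 0 = j - r \<Longrightarrow> map (s' ''cert'') [1..<Suc (s' ''cert'' 0)] = map ((!) ws) [r..<j] \<Longrightarrow>
      k' \<le> k + length ws * 4 + 3 \<Longrightarrow> R s' k'"
  shows "wp q b (For ''s'' (V ''j'' \<ominus> V ''r'') copy_cycle) s k R"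
proof (rule wp_For[where m = "j - r" and N = 1 and
    I = "\<lambda>i s1. s1 ''cert'' 0 = j - r \<and> (\<forall>i'<i. s1 ''cert'' (Suc i') = ws ! (r + i'))"])
  show "bounded_store b s" "j - r < 2 ^ b" "''s'' \<notin> mods copy_cycle"
    using s by (auto simp: copy_cycle_def)
  show "update s ''s'' 0 0 ''cert'' 0 = j - r \<and> (\<forall>i'<0. update s ''s'' 0 0 ''cert'' (Suc i') = ws ! (r + i'))"
    using s by (simp add: update_def)
  show "evaluate s1 (V ''j'' \<ominus> V ''r'') = j - r" if "\<forall>a. a \<notin> insert ''s'' (mods copy_cycle) \<longrightarrow> s1 a = s a" for s1
    using that s by (simp add: copy_cycle_def)
next
  fix i s1 k1
  assume i: "i < j - r" and fr: "\<forall>a. a \<notin> insert ''s'' (mods copy_cycle) \<longrightarrow> s1 a = s a"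
    and bs: "bounded_store b s1" and si: "s1 ''s'' 0 = i"
    and I: "s1 ''cert'' 0 = j - r \<and> (\<forall>i'<i. s1 ''cert'' (Suc i') = ws ! (r + i'))"
  have "s1 ''W'' (r + i) = ws ! (r + i)" "s1 ''r'' 0 = r"
    using fr s i by (simp_all add: copy_cycle_def)
  moreover have "s1 ''W'' (r + i) < 2 ^ b" using bs by (simp add: bounded_store_def)
  ultimately show "wp q b copy_cycle s1 k1 (\<lambda>s2 k2. k2 \<le> k1 + 1 \<and>
      update s2 ''s'' 0 (Suc i) ''cert'' 0 = j - r \<and>
      (\<forall>i'<Suc i. update s2 ''s'' 0 (Suc i) ''cert'' (Suc i') = ws ! (r + i')))"
    using I si by (simp add: copy_cycle_def update_def less_Suc_eq)
next
  fix s1 k1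
  assume fr: "\<forall>a. a \<notin> insert ''s'' (mods copy_cycle) \<longrightarrow> s1 a = s a" and bs: "bounded_store b s1"
    and I: "s1 ''cert'' 0 = j - r \<and> (\<forall>i'<j - r. s1 ''cert'' (Suc i') = ws ! (r + i'))"
    and k1: "k1 \<le> k + (j - r) * (1 + 3) + 3"
  have "map (s1 ''cert'') [1..<Suc (s1 ''cert'' 0)] = map ((!) ws) [r..<j]"
    using I by (intro nth_equalityI) (simp_all del: upt_Suc)
  moreover have "\<forall>a. a \<notin> {''s'', ''cert''} \<longrightarrow> s1 a = s a" using fr by (simp add: copy_cycle_def)
  moreover have "(j - r) * (1 + 3) \<le> length ws * 4" using s by (intro mult_le_mono) auto
  then have "k1 \<le> k + length ws * 4 + 3" using k1 by linarith
  ultimately show "R s1 k1" using I bs by (intro R) auto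
qed

text \<open>The outer loop runs over the later index, so when \<open>j\<close> is compared, the
  vertices before it are known to be distinct; under this premise \<open>cycle_of_repeat\<close>
  turns the segment into a cycle.\<close>

lemma wp_find_repeat:
  assumes s: "bounded_store b s" "s ''lz'' 0 = length ws" "\<forall>i<length ws. s ''W'' i = ws ! i"
      "certified K s" "length ws \<le> K"
    and b: "K + 2 < 2 ^ b" and nb: "nb_walk ws"
    and R: "\<And>s' k'. bounded_store b s' \<Longrightarrow> (\<forall>a. a \<notin> mods find_repeat \<longrightarrow> s' a = s a) \<Longrightarrow>
      certified K s' \<Longrightarrow> (s' ''reject'' 0 = 0 \<Longrightarrow> s ''reject'' 0 = 0 \<and> distinct ws) \<Longrightarrow>
      k' \<le> k + repeat_cost K \<Longrightarrow> R s' k'"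
  shows "wp q b find_repeat s k R"
proof -
  have lb: "length ws < 2 ^ b" "(1::nat) < 2 ^ b" using s b by auto
  define I where "I = (\<lambda>j s1. certified K s1 \<and> (s1 ''reject'' 0 = 0 \<longrightarrow> s ''reject'' 0 = 0 \<and> distinct (take j ws)))"
  have mods: "mods compare = {''reject'', ''cert'', ''s''}" by (auto simp: compare_def copy_cycle_def)
  have "wp q b (For ''j'' (V ''lz'') (For ''r'' (V ''j'') compare)) s k R"
  proof (rule wp_For[where m = "length ws" and N = "K * (4 * K + 20) + 3" and I = I])
    show "bounded_store b s" "length ws < 2 ^ b" using s lb by auto
    show "''j'' \<notin> mods (For ''r'' (V ''j'') compare)" by (simp add: mods)
    show "I 0 (update s ''j'' 0 0)" using s by (simp add: I_def update_def)
    show "evaluate s1 (V ''lz'') = length ws"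
      if "\<forall>a. a \<notin> insert ''j'' (mods (For ''r'' (V ''j'') compare)) \<longrightarrow> s1 a = s a" for s1
      using that s by (simp add: mods)
  next
    fix j s1 k1
    assume j: "j < length ws" and fr: "\<forall>a. a \<notin> insert ''j'' (mods (For ''r'' (V ''j'') compare)) \<longrightarrow> s1 a = s a"
      and bs: "bounded_store b s1" and sj: "s1 ''j'' 0 = j" and Ij: "I j s1"
    define I' where "I' = (\<lambda>r s2. certified K s2 \<and> (s2 ''reject'' 0 = 0 \<longrightarrow>
        s ''reject'' 0 = 0 \<and> distinct (take j ws) \<and> (\<forall>i<r. ws ! i \<noteq> ws ! j)))"
    show "wp q b (For ''r'' (V ''j'') compare) s1 k1
       (\<lambda>s2 k2. k2 \<le> k1 + (K * (4 * K + 20) + 3) \<and> I (Suc j) (update s2 ''j'' 0 (Suc j)))"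
    proof (rule wp_For[where m = j and N = "4 * K + 14" and I = I'])
      show "bounded_store b s1" "j < 2 ^ b" using bs j lb by auto
      show "''r'' \<notin> mods compare" by (simp add: mods)
      show "I' 0 (update s1 ''r'' 0 0)" using Ij by (simp add: I_def I'_def update_def)
      show "evaluate s2 (V ''j'') = j"
        if "\<forall>a. a \<notin> insert ''r'' (mods compare) \<longrightarrow> s2 a = s1 a" for s2
        using that sj by (simp add: mods)
    next
      fix r s2 k2
      assume r: "r < j" and fr2: "\<forall>a. a \<notin> insert ''r'' (mods compare) \<longrightarrow> s2 a = s1 a"
        and bs2: "bounded_store b s2" and sr: "s2 ''r'' 0 = r" and Ir: "I' r s2"
      have W: "\<forall>i<length ws. s2 ''W'' i = ws ! i" using fr2 fr s by (simp add: mods)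
      have sj2: "s2 ''j'' 0 = j" using fr2 sj by (simp add: mods)
      show "wp q b compare s2 k2 (\<lambda>s3 k3. k3 \<le> k2 + (4 * K + 14) \<and> I' (Suc r) (update s3 ''r'' 0 (Suc r)))"
      proof (cases "s2 ''reject'' 0 = 0")
        case False
        then show ?thesis using Ir by (simp add: compare_def I'_def update_def)
      next
        case rej: True
        show ?thesis
        proof (cases "ws ! r = ws ! j")
          case False
          then show ?thesis using Ir rej W r j sr sj2
            by (auto simp: compare_def I'_def update_def less_Suc_eq)
        next
          case True
          define s3 where "s3 = update (update s2 ''reject'' 0 1) ''cert'' 0 (j - r)"
          have jr: "j - r < 2 ^ b" using j lb by simp
          have s3: "bounded_store b s3" "s3 ''r'' 0 = r" "s3 ''j'' 0 = j" "\<forall>i<length ws. s3 ''W'' i = ws ! i"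
              "s3 ''reject'' 0 = 1" "s3 ''cert'' 0 = j - r"
            using bs2 sr sj2 W lb jr by (auto simp: s3_def update_def bounded_store_def)
          have cyc: "is_cycle E (map ((!) ws) [r..<j])"
            using cycle_of_repeat[OF nb r j True] Ir rej by (simp add: I'_def)
          have "wp q b (For ''s'' (V ''j'' \<ominus> V ''r'') copy_cycle) s3 (Suc (Suc (Suc (Suc (Suc (Suc k2))))))
              (\<lambda>s3 k3. k3 \<le> k2 + (4 * K + 14) \<and> I' (Suc r) (update s3 ''r'' 0 (Suc r)))"
          proof (rule wp_copy_cycle[OF s3(1,2,3) r j lb(1) s3(4,5,6)])
            fix s4 k4
            assume s4: "\<forall>a. a \<notin> {''s'', ''cert''} \<longrightarrow> s4 a = s3 a" "s4 ''cert'' 0 = j - r"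
              "map (s4 ''cert'') [1..<Suc (s4 ''cert'' 0)] = map ((!) ws) [r..<j]"
              "k4 \<le> Suc (Suc (Suc (Suc (Suc (Suc k2))))) + length ws * 4 + 3"
            have "j - r \<le> K" using j s(5) by linarith
            then have "certified K (update s4 ''r'' 0 (Suc r))"
              using s4(2,3) cyc j s(5) by (simp add: certified_def update_def del: upt_Suc)
            moreover have "update s4 ''r'' 0 (Suc r) ''reject'' 0 = 1" using s4(1) s3 by (simp add: update_def)
            ultimately have "I' (Suc r) (update s4 ''r'' 0 (Suc r))" by (simp add: I'_def)
            then show "k4 \<le> k2 + (4 * K + 14) \<and> I' (Suc r) (update s4 ''r'' 0 (Suc r))"
              using s4(4) s(5) by simp
          qed
          then show ?thesis using True rej W r j sr sj2 lb jr
            by (simp add: compare_def s3_def) (simp add: update_def)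
        qed
      qed
    next
      fix s2 k2
      assume "I' j s2" and k2: "k2 \<le> k1 + j * (4 * K + 14 + 3) + 3"
      then have "I (Suc j) (update s2 ''j'' 0 (Suc j))"
        using j by (auto simp: I_def I'_def update_def take_Suc_conv_app_nth in_set_conv_nth)
      moreover have "j * (4 * K + 14 + 3) \<le> K * (4 * K + 20)" using j s(5) by (intro mult_le_mono) auto
      ultimately show "k2 \<le> k1 + (K * (4 * K + 20) + 3) \<and> I (Suc j) (update s2 ''j'' 0 (Suc j))"
        using k2 by simp
    qed
  next
    fix s1 k1
    assume fr: "\<forall>a. a \<notin> insert ''j'' (mods (For ''r'' (V ''j'') compare)) \<longrightarrow> s1 a = s a"
      and bs: "bounded_store b s1" and I: "I (length ws) s1"
      and k1: "k1 \<le> k + length ws * (K * (4 * K + 20) + 3 + 3) + 3"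
    have fr': "\<forall>a. a \<notin> mods find_repeat \<longrightarrow> s1 a = s a" using fr by (simp add: mods)
    have "length ws * (K * (4 * K + 20) + 3 + 3) \<le> K * (K * (4 * K + 20) + 6)"
      using s(5) by (intro mult_le_mono) auto
    then have kk: "k1 \<le> k + repeat_cost K" using k1 by (simp add: repeat_cost_def)
    show "R s1 k1" by (rule R[OF bs fr' _ _ kk]) (use I in \<open>auto simp: I_def\<close>)
  qed
  then show ?thesis by (simp add: find_repeat_def)
qed

lemma wp_fill:
  assumes s: "bounded_store b s" "s ''L'' 0 = L" "s ''p'' 0 = p" "s ''lw'' 0 = L + 2 - p" "s ''lz'' 0 = length ws"
      "stored_path (s ''xb'' 0) x s" "stored_path (s ''base'' 0) y s" "length x = L + 2" "length y = L + 2" "p \<le> L"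
    and ws: "ws = joined x y p" and b: "2 * L + 5 < 2 ^ b"
    and R: "\<And>s' k'. bounded_store b s' \<Longrightarrow> (\<forall>a. a \<notin> {''l'', ''W''} \<longrightarrow> s' a = s a) \<Longrightarrow>
      (\<forall>i<length ws. s' ''W'' i = ws ! i) \<Longrightarrow> k' \<le> k + (2 * L + 3) * 5 + 3 \<Longrightarrow> R s' k'"
  shows "wp q b (For ''l'' (V ''lz'') fill) s k R"
proof -
  have lws: "length ws \<le> 2 * L + 3" "length ws = L + 2 - p \<or> length ws = 2 * L + 3 - 2 * p"
    using s ws by (auto simp: joined_def)
  have nth: "ws ! i = (if i < L + 2 - p then x ! (L + 1 - i) else y ! (p + p + i - (L + 1)))" if "i < length ws" for i
  proof (cases "x ! p = y ! p \<and> x ! Suc p \<noteq> y ! Suc p")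
    case True
    then have ws': "ws = rev (drop p x) @ drop (Suc p) y" by (simp add: ws joined_def)
    have l: "length ws = 2 * L + 3 - 2 * p" using ws' s by simp
    show ?thesis
    proof (cases "i < L + 2 - p")
      case True
      then show ?thesis unfolding ws' using nth_joined1[of p x i "drop (Suc p) y"] s by simp
    next
      case False
      have "ws ! i = y ! (2 * p + i + 1 - length x)"
        unfolding ws' by (rule nth_joined2) (use False s that l in auto)
      moreover have "2 * p + i + 1 - length x = p + p + i - (L + 1)" using s by simp
      ultimately show ?thesis using False by simp
    qed
  next
    case False
    then have ws': "ws = rev (drop p x)" by (auto simp: ws joined_def)
    then have "i < L + 2 - p" using that s by simp
    then show ?thesis unfolding ws' using nth_joined1[of p x i "[]"] s by simp
  qed
  show ?thesis
  proof (rule wp_For[where m = "length ws" and N = 2 and I = "\<lambda>l s1. \<forall>i<l. s1 ''W'' i = ws ! i"])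
    show "bounded_store b s" "length ws < 2 ^ b" "''l'' \<notin> mods fill" using s lws b by (auto simp: fill_def)
    show "\<forall>i<0. update s ''l'' 0 0 ''W'' i = ws ! i" by simp
    show "evaluate s1 (V ''lz'') = length ws"
      if "\<forall>a. a \<notin> insert ''l'' (mods fill) \<longrightarrow> s1 a = s a" for s1
      using that s by (simp add: fill_def)
  next
    fix l s1 k1
    assume l: "l < length ws" and fr: "\<forall>a. a \<notin> insert ''l'' (mods fill) \<longrightarrow> s1 a = s a"
      and bs: "bounded_store b s1" and sl: "s1 ''l'' 0 = l" and I: "\<forall>i<l. s1 ''W'' i = ws ! i"
    have s1: "s1 ''L'' 0 = L" "s1 ''p'' 0 = p" "s1 ''lw'' 0 = L + 2 - p" "s1 ''xb'' = s ''xb''" "s1 ''base'' = s ''base''"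
        "s1 ''path'' = s ''path''"
      using fr s by (simp_all add: fill_def)
    have px: "s1 ''path'' i < 2 ^ b" for i using bs by (simp add: bounded_store_def)
    show "wp q b fill s1 k1 (\<lambda>s2 k2. k2 \<le> k1 + 2 \<and> (\<forall>i<Suc l. update s2 ''l'' 0 (Suc l) ''W'' i = ws ! i))"
    proof (cases "l < L + 2 - p")
      case True
      have "s1 ''path'' (s ''xb'' 0 + (L + 1 - l)) = x ! (L + 1 - l)"
        using s s1 by (simp add: stored_path_def)
      then have "s1 ''path'' (s ''xb'' 0 + (L + 1 - l)) = ws ! l" using nth[OF l] True by simp
      then show ?thesis using True sl s1 I px[of "s ''xb'' 0 + (L + 1 - l)"]
        by (simp add: fill_def update_def less_Suc_eq)
    next
      case False
      have "p + p + l - (L + 1) < length y" using lws False l s by linarith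
      then have "s1 ''path'' (s ''base'' 0 + (p + p + l - (L + 1))) = y ! (p + p + l - (L + 1))"
        using s s1 by (simp add: stored_path_def)
      then have "s1 ''path'' (s ''base'' 0 + (p + p + l - (L + 1))) = ws ! l" using nth[OF l] False by simp
      then show ?thesis using False sl s1 I px[of "s ''base'' 0 + (p + p + l - (L + 1))"]
        by (simp add: fill_def update_def less_Suc_eq)
    qed
  next
    fix s1 k1
    assume fr: "\<forall>a. a \<notin> insert ''l'' (mods fill) \<longrightarrow> s1 a = s a" and bs: "bounded_store b s1"
      and I: "\<forall>i<length ws. s1 ''W'' i = ws ! i" and k1: "k1 \<le> k + length ws * (2 + 3) + 3"
    have fr': "\<forall>a. a \<notin> {''l'', ''W''} \<longrightarrow> s1 a = s a" using fr by (simp add: fill_def)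
    have "length ws * (2 + 3) \<le> (2 * L + 3) * 5" using lws(1) by (intro mult_le_mono) auto
    then have kk: "k1 \<le> k + (2 * L + 3) * 5 + 3" using k1 by linarith
    show "R s1 k1" by (rule R[OF bs fr' I kk])
  qed
qed

text \<open>An unset flag at the end means that all joined walks are free of repetitions, which is
  the premise of \<open>joined_repeat\<close>.\<close>

lemma wp_compare_walks:
  assumes s: "bounded_store b s" "s ''L'' 0 = L" "certified (2 * L + 3) s"
      "stored_path (s ''xb'' 0) x s" "stored_path (s ''base'' 0) y s" "length x = L + 2" "length y = L + 2"
    and nb: "nb_walk x" "nb_walk y" and b: "2 * L + 5 < 2 ^ b"
    and R: "\<And>s' k'. bounded_store b s' \<Longrightarrow> (\<forall>a. a \<notin> mods compare_walks \<longrightarrow> s' a = s a) \<Longrightarrow>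
      certified (2 * L + 3) s' \<Longrightarrow>
      (s' ''reject'' 0 = 0 \<Longrightarrow> s ''reject'' 0 = 0 \<and> (\<forall>p. Suc p < length x \<longrightarrow> distinct (joined x y p))) \<Longrightarrow>
      k' \<le> k + compare_cost L \<Longrightarrow> R s' k'"
  shows "wp q b compare_walks s k R"
proof -
  let ?N = "(2 * L + 3) * 5 + repeat_cost (2 * L + 3) + 27"
  have mods: "mods join_walks = {''lw'', ''lz'', ''l'', ''W'', ''j'', ''r'', ''s'', ''reject'', ''cert''}"
    by (auto simp: join_walks_def fill_def)
  define I where "I = (\<lambda>p s1. certified (2 * L + 3) s1 \<and>
      (s1 ''reject'' 0 = 0 \<longrightarrow> s ''reject'' 0 = 0 \<and> (\<forall>p'<p. distinct (joined x y p'))))"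
  have "wp q b (For ''p'' (V ''L'' \<oplus> Const 1) join_walks) s k R"
  proof (rule wp_For[where m = "L + 1" and N = ?N and I = I])
    show "bounded_store b s" "L + 1 < 2 ^ b" "''p'' \<notin> mods join_walks" using s b by (auto simp: mods)
    show "I 0 (update s ''p'' 0 0)" using s by (simp add: I_def update_def)
    show "evaluate s1 (V ''L'' \<oplus> Const 1) = L + 1"
      if "\<forall>a. a \<notin> insert ''p'' (mods join_walks) \<longrightarrow> s1 a = s a" for s1
      using that s by (simp add: mods)
  next
    fix p s1 k1
    assume p: "p < L + 1" and fr: "\<forall>a. a \<notin> insert ''p'' (mods join_walks) \<longrightarrow> s1 a = s a"
      and bs: "bounded_store b s1" and sp: "s1 ''p'' 0 = p" and Ip: "I p s1"
    let ?ws = "joined x y p"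
    have s1: "s1 ''L'' 0 = L" "s1 ''xb'' = s ''xb''" "s1 ''base'' = s ''base''" "s1 ''path'' = s ''path''"
      using fr s by (simp_all add: mods)
    have px: "s1 ''path'' (s ''xb'' 0 + p) = x ! p" "s1 ''path'' (s ''xb'' 0 + p + 1) = x ! Suc p"
      "s1 ''path'' (s ''base'' 0 + p) = y ! p" "s1 ''path'' (s ''base'' 0 + p + 1) = y ! Suc p"
      using s s1 p by (auto simp: stored_path_def add.assoc)
    define s2 where "s2 = update (update s1 ''lw'' 0 (L + 2 - p)) ''lz'' 0 (length ?ws)"
    have lws: "length ?ws \<le> 2 * L + 3" using s by (auto simp: joined_def)
    then have b2: "L + 2 - p < 2 ^ b" "length ?ws < 2 ^ b" using b by auto
    have s2: "bounded_store b s2" "s2 ''L'' 0 = L" "s2 ''p'' 0 = p" "s2 ''lw'' 0 = L + 2 - p" "s2 ''lz'' 0 = length ?ws"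
        "stored_path (s2 ''xb'' 0) x s2" "stored_path (s2 ''base'' 0) y s2" "certified (2 * L + 3) s2"
        "s2 ''reject'' = s1 ''reject''"
      using bs b2 s s1 sp Ip by (auto simp: s2_def update_def bounded_store_def stored_path_def I_def)
    have nbw: "nb_walk ?ws" using nb_walk_joined[OF nb] s p by simp
    let ?R = "\<lambda>s2 k2. k2 \<le> k1 + ?N \<and> I (Suc p) (update s2 ''p'' 0 (Suc p))"
    \<comment> \<open>Stated for every small enough step count, because the branches of the
      preceding conditionals differ in their numbers of steps.\<close>
    have main: "wp q b (For ''l'' (V ''lz'') fill) s2 k2 (\<lambda>s3 k3. wp q b find_repeat s3 k3 ?R)"
      if k2: "k2 \<le> k1 + 20" for k2
    proof (rule wp_fill[OF s2(1-7) s(6,7) _ refl b])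
      show "p \<le> L" using p by simp
      fix s3 k3
      assume s3: "bounded_store b s3" "\<forall>a. a \<notin> {''l'', ''W''} \<longrightarrow> s3 a = s2 a"
        "\<forall>i<length ?ws. s3 ''W'' i = ?ws ! i" "k3 \<le> k2 + (2 * L + 3) * 5 + 3"
      have s3': "s3 ''lz'' 0 = length ?ws" "certified (2 * L + 3) s3" "s3 ''reject'' = s1 ''reject''"
        using s3(2) s2 certified_cong[of s3 s2 "2 * L + 3"] by simp_all
      show "wp q b find_repeat s3 k3 ?R"
      proof (rule wp_find_repeat[OF s3(1) s3'(1) s3(3) s3'(2) lws _ nbw])
        show "2 * L + 3 + 2 < 2 ^ b" using b by simp
        fix s4 k4
        assume s4: "certified (2 * L + 3) s4" "s4 ''reject'' 0 = 0 \<Longrightarrow> s3 ''reject'' 0 = 0 \<and> distinct ?ws"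
          "k4 \<le> k3 + repeat_cost (2 * L + 3)"
        have "I (Suc p) (update s4 ''p'' 0 (Suc p))"
          using s4(1,2) s3'(3) Ip by (auto simp: I_def update_def less_Suc_eq)
        then show "?R s4 k4" using s4(3) s3(4) k2 by simp
      qed
    qed
    have lz: "length ?ws = (if x ! p = y ! p \<and> x ! Suc p \<noteq> y ! Suc p then (L + 2 - p) + (L + 2 - p) - 1 else L + 2 - p)"
      using s p by (auto simp: joined_def)
    define s1' where "s1' = update (update s1 ''lw'' 0 (L + 2 - p)) ''lz'' 0 (L + 2 - p)"
    \<comment> \<open>The program sets \<open>lz\<close> to \<open>lw\<close> and overwrites it only
      if the walks part after \<open>p\<close>; either way it arrives at the store
      \<open>s2\<close>.\<close>
    have s2_eq: "s2 = (if x ! p = y ! p \<and> x ! Suc p \<noteq> y ! Suc p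
        then update s1' ''lz'' 0 ((L + 2 - p) + (L + 2 - p) - 1) else s1')"
      unfolding s2_def lz s1'_def by (auto simp: update_def fun_eq_iff)
    have s1': "s1' ''xb'' 0 = s ''xb'' 0" "s1' ''base'' 0 = s ''base'' 0" "s1' ''path'' = s1 ''path''"
        "s1' ''p'' 0 = p" "s1' ''lw'' 0 = L + 2 - p"
      using s1 sp by (auto simp: s1'_def update_def)
    have dbl: "(L + 2 - p) + (L + 2 - p) - 1 < 2 ^ b" using b by linarith
    have "wp q b
     (If (Op Eq (Get ''path'' (V ''xb'' \<oplus> V ''p'')) (Get ''path'' (V ''base'' \<oplus> V ''p'')))
       (If (Op Eq (Get ''path'' (V ''xb'' \<oplus> V ''p'' \<oplus> Const 1)) (Get ''path'' (V ''base'' \<oplus> V ''p'' \<oplus> Const 1)))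
          Skip
          (Assign ''lz'' (V ''lw'' \<oplus> V ''lw'' \<ominus> Const 1)))
       Skip) s1' k2 (\<lambda>s2 k2. wp q b (For ''l'' (V ''lz'') fill) s2 (k2 + 1) (\<lambda>s3 k3. wp q b find_repeat s3 k3 ?R))"
      if k2: "k2 \<le> k1 + 15" for k2
    proof (cases "x ! p = y ! p")
      case False
      then have "s2 = s1'" using s2_eq by simp
      then show ?thesis using False main[of "Suc (Suc (Suc k2))"] k2 px s1' by simp
    next
      case eq: True
      show ?thesis
      proof (cases "x ! Suc p = y ! Suc p")
        case True
        then have "s2 = s1'" using s2_eq by simp
        then show ?thesis using True eq main[of "Suc (Suc (Suc (Suc k2)))"] k2 px s1' by simp
      next
        case False
        then have "s2 = update s1' ''lz'' 0 ((L + 2 - p) + (L + 2 - p) - 1)" using s2_eq eq by simp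
        then show ?thesis using False eq main[of "Suc (Suc (Suc (Suc k2)))"] k2 px s1' dbl by simp
      qed
    qed
    from this[of "Suc (Suc (Suc (Suc (Suc k1))))"]
    show "wp q b join_walks s1 k1 ?R"
      using s1 sp b2
      by (simp add: join_walks_def s1'_def del: wp.simps(6)) (simp add: update_def del: wp.simps(6))
  next
    fix s1 k1
    assume fr: "\<forall>a. a \<notin> insert ''p'' (mods join_walks) \<longrightarrow> s1 a = s a" and bs: "bounded_store b s1"
      and I: "I (L + 1) s1" and k1: "k1 \<le> k + (L + 1) * (?N + 3) + 3"
    have fr': "\<forall>a. a \<notin> mods compare_walks \<longrightarrow> s1 a = s a" using fr by (simp add: mods)
    have kk: "k1 \<le> k + compare_cost L" using k1 by (simp add: compare_cost_def)
    show "R s1 k1" by (rule R[OF bs fr' _ _ kk]) (use I s in \<open>auto simp: I_def\<close>)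
  qed
  then show ?thesis by (simp add: compare_walks_def)
qed

end

subsection \<open>Trials\<close>

lemma mods_process [simp]:
  "mods process = {''key'', ''slot'', ''xb'', ''p'', ''lw'', ''lz'', ''l'', ''W'', ''j'', ''r'', ''s'', ''reject'', ''cert''}"
  by (auto simp: process_def)

lemma mods_one_walk [simp]: "mods one_walk = {''id'', ''base'', ''rb''} \<union> mods do_walk \<union> mods process"
  by (auto simp: one_walk_def)

lemma mods_one_trial [simp]: "mods one_trial = {''r0'', ''u'', ''v'', ''k''} \<union> mods one_walk"
  by (auto simp: one_trial_def)

context tester begin

definition chunk :: "nat list \<Rightarrow> nat \<Rightarrow> nat list" where
  "chunk \<omega> t = take block (drop (t * block) \<omega>)"

definition digits :: "nat list \<Rightarrow> nat \<Rightarrow> nat list list" where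
  "digits \<omega> t = blocks len walks (tl (chunk \<omega> t))"

lemma chunk_bounds: "t < trials \<Longrightarrow> t * block + block \<le> trials * block"
  using mult_le_mono1[of "Suc t" trials block] by simp

lemma length_chunk: "length \<omega> = trials * block \<Longrightarrow> t < trials \<Longrightarrow> length (chunk \<omega> t) = block"
  using chunk_bounds[of t] by (simp add: chunk_def)

lemma hd_chunk:
  assumes "length \<omega> = trials * block" "t < trials"
  shows "hd (chunk \<omega> t) = \<omega> ! (t * block)"
proof -
  have "t * block < length \<omega>" using chunk_bounds[OF assms(2)] assms(1) by (simp add: block_def)
  then show ?thesis by (simp add: chunk_def hd_drop_conv_nth block_def)
qed

lemma length_digits [simp]: "length (digits \<omega> t) = walks"
  by (simp add: digits_def blocks_def)

lemma walk_bounds: "k < walks \<Longrightarrow> k * len + len \<le> walks * len"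
  using mult_le_mono1[of "Suc k" walks len] by simp

lemma digits_nth:
  assumes "length \<omega> = trials * block" "t < trials" "k < walks"
  shows "length (digits \<omega> t ! k) = len"
    and "i < len \<Longrightarrow> digits \<omega> t ! k ! i = \<omega> ! (t * block + 1 + k * len + i)"
proof -
  have l: "length (tl (chunk \<omega> t)) = walks * len" using length_chunk[OF assms(1,2)] by (simp add: block_def)
  have D: "digits \<omega> t ! k = take len (drop (k * len) (tl (chunk \<omega> t)))"
    using assms(3) by (simp add: digits_def blocks_def)
  show "length (digits \<omega> t ! k) = len" unfolding D using l walk_bounds[OF assms(3)] by simp
  assume i: "i < len"
  have ki: "k * len + i < walks * len" using i walk_bounds[OF assms(3)] by linarith
  have "digits \<omega> t ! k ! i = tl (chunk \<omega> t) ! (k * len + i)"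
  proof -
    have kl: "k * len \<le> length (tl (chunk \<omega> t))" using ki l by linarith
    show ?thesis unfolding D using i by (simp add: nth_drop[OF kl])
  qed
  also have "\<dots> = chunk \<omega> t ! Suc (k * len + i)" using ki l by (intro nth_tl) simp
  also have "\<dots> = \<omega> ! (t * block + Suc (k * len + i))"
  proof -
    have "Suc (k * len + i) < block" using ki by (simp add: block_def)
    moreover have "t * block \<le> length \<omega>" using chunk_bounds[OF assms(2)] assms(1) by linarith
    ultimately show ?thesis by (simp add: chunk_def)
  qed
  finally show "digits \<omega> t ! k ! i = \<omega> ! (t * block + 1 + k * len + i)" by (simp add: add.assoc)
qed

definition environment :: "nat list \<Rightarrow> store \<Rightarrow> bool" where
  "environment \<omega> s \<longleftrightarrow> length \<omega> = trials * block \<and> s ''n'' 0 = n \<and> s ''d'' 0 = d \<and> s ''B'' 0 = budget \<and>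
     s ''L'' 0 = len \<and> s ''M'' 0 = walks \<and> s ''S'' 0 = block \<and> s ''T'' 0 = trials \<and>
     (\<forall>i<trials * block. s ''rnd'' i = \<omega> ! i)"

text \<open>One inequality per kind of number that the trials write: queue positions, vertices,
  positions in joined walks, addresses in \<open>path\<close>, table keys and positions in the list
  of random numbers.\<close>

definition enough_bits :: "nat \<Rightarrow> bool" where
  "enough_bits b \<longleftrightarrow> 1 + budget * d + d + budget < 2 ^ b \<and> n < 2 ^ b \<and> 2 * len + 5 < 2 ^ b \<and>
     (trials * walks + 2) * (len + 2) < 2 ^ b \<and> (trials + 1) * (n + 1) < 2 ^ b \<and>
     trials * block + 1 < 2 ^ b"

lemma enough_bitsD:
  assumes "enough_bits b"
  shows "1 + budget * d + d + budget < 2 ^ b" "n < 2 ^ b" "2 * len + 5 < 2 ^ b" "len < 2 ^ b"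
    "(trials * walks + 2) * (len + 2) < 2 ^ b" "(trials + 1) * (n + 1) < 2 ^ b" "trials * block + 1 < 2 ^ b"
proof -
  note * = assms[unfolded enough_bits_def]
  show "1 + budget * d + d + budget < 2 ^ b" "n < 2 ^ b" and l: "2 * len + 5 < 2 ^ b" and
    "(trials * walks + 2) * (len + 2) < 2 ^ b" "(trials + 1) * (n + 1) < 2 ^ b" "trials * block + 1 < 2 ^ b"
    using * by blast+
  have "len \<le> 2 * len + 5" by simp
  then show "len < 2 ^ b" using l by (rule le_less_trans)
qed

text \<open>\<open>slot[t * (n + 1) + x]\<close> names the first walk of trial \<open>t\<close> that ends at \<open>x\<close>.\<close>

definition slots_ok :: "nat \<Rightarrow> nat \<Rightarrow> nat list list \<Rightarrow> arc \<Rightarrow> store \<Rightarrow> bool" where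
  "slots_ok t k rss a s \<longleftrightarrow> (\<forall>x\<in>vertices.
     (s ''slot'' (t * (n + 1) + x) = 0 \<and>
       (\<forall>k'<k. \<forall>p. walk budget (rss ! k') (fst a) (snd a) = Some p \<longrightarrow> last p \<noteq> x)) \<or>
     (\<exists>k'<k. \<exists>p. s ''slot'' (t * (n + 1) + x) = t * walks + k' + 1 \<and>
       walk budget (rss ! k') (fst a) (snd a) = Some p \<and> last p = x \<and>
       stored_path ((t * walks + k' + 1) * (len + 2)) p s))"

text \<open>Silence can be inferred only while the flag is unset. The last conjunct hands an empty
  part of the table to the trials to come.\<close>

definition trial_inv :: "nat list \<Rightarrow> nat \<Rightarrow> nat \<Rightarrow> arc \<Rightarrow> store \<Rightarrow> bool" where
  "trial_inv \<omega> t k a s \<longleftrightarrow> certified (2 * len + 3) s \<and>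
     (s ''reject'' 0 = 0 \<longrightarrow> (\<forall>t'<t. trial_silent (chunk \<omega> t')) \<and> silent (take k (digits \<omega> t)) a) \<and>
     slots_ok t k (digits \<omega> t) a s \<and> (\<forall>i\<ge>(t + 1) * (n + 1). s ''slot'' i = 0)"

lemma trial_inv_cong:
  assumes "s' ''reject'' = s ''reject''" "s' ''cert'' = s ''cert''" "s' ''slot'' = s ''slot''" "s' ''path'' = s ''path''"
  shows "trial_inv \<omega> t k a s' \<longleftrightarrow> trial_inv \<omega> t k a s"
  unfolding trial_inv_def certified_def slots_ok_def stored_path_def assms ..

lemma silent_snoc:
  assumes "k < length rss"
  shows "silent (take (Suc k) rss) a \<longleftrightarrow> silent (take k rss) a \<and>
    (\<forall>i<k. \<forall>p q. walk budget (rss ! i) (fst a) (snd a) = Some p \<and> walk budget (rss ! k) (fst a) (snd a) = Some q \<and>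
       last p = last q \<longrightarrow> p = q \<and> distinct p)"
proof -
  have "silent (take (Suc k) rss) a \<longleftrightarrow> (\<forall>j<Suc k. \<forall>i<j. \<forall>p q.
     walk budget (rss ! i) (fst a) (snd a) = Some p \<and> walk budget (rss ! j) (fst a) (snd a) = Some q \<and>
     last p = last q \<longrightarrow> p = q \<and> distinct p)"
    unfolding silent_def using assms by (auto simp: less_Suc_eq)
  moreover have "silent (take k rss) a \<longleftrightarrow> (\<forall>j<k. \<forall>i<j. \<forall>p q.
     walk budget (rss ! i) (fst a) (snd a) = Some p \<and> walk budget (rss ! j) (fst a) (snd a) = Some q \<and>
     last p = last q \<longrightarrow> p = q \<and> distinct p)"
    unfolding silent_def using assms by auto
  ultimately show ?thesis unfolding less_Suc_eq by blast
qed

text \<open>In a silent family all walks with the same end are equal, in whatever order they came,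
  so one representative stands for all of them.\<close>

lemma silent_takeD:
  assumes "silent (take k rss) a" "i < k" "j < k" "k \<le> length rss"
    and "walk budget (rss ! i) (fst a) (snd a) = Some p" "walk budget (rss ! j) (fst a) (snd a) = Some q" "last p = last q"
  shows "p = q"
proof -
  consider "i = j" | "i < j" | "j < i" by linarith
  then show ?thesis
  proof cases
    case 2
    then show ?thesis using assms unfolding silent_def by fastforce
  next
    case 3
    then show ?thesis using assms unfolding silent_def by fastforce
  qed (use assms in auto)
qed

lemma last_walk:
  assumes "(u, v) \<in> arcs" "walk B rs u v = Some p"
  shows "last p = p ! (length rs + 1)" "last p \<in> vertices" "length p = length rs + 2" "nb_walk p"
proof -
  show l: "length p = length rs + 2" using walk_length[OF assms(2)] by simp
  show nb: "nb_walk p" using walk_nb[OF assms] .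
  have "(p ! length rs, p ! Suc (length rs)) \<in> arcs" using nb l unfolding nb_walk_def by simp
  moreover show last: "last p = p ! (length rs + 1)" using l last_conv_nth[of p] by fastforce
  ultimately show "last p \<in> vertices" using arcs_vertices by simp
qed

lemma wp_process:
  assumes env: "environment \<omega> s" and bs: "bounded_store b s" and big: "enough_bits b"
    and tk: "t < trials" "k < walks" and a: "a \<in> arcs"
    and s: "s ''t'' 0 = t" "s ''id'' 0 = t * walks + k + 1" "s ''base'' 0 = (t * walks + k + 1) * (len + 2)"
      "s ''ok'' 0 = (if walk budget (digits \<omega> t ! k) (fst a) (snd a) = None then 0 else 1)"
      "\<And>p. walk budget (digits \<omega> t ! k) (fst a) (snd a) = Some p \<Longrightarrow> stored_path (s ''base'' 0) p s"
    and inv: "trial_inv \<omega> t k a s"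
    and R: "\<And>s' k'. bounded_store b s' \<Longrightarrow> trial_inv \<omega> t (Suc k) a s' \<Longrightarrow>
      k' \<le> k0 + compare_cost len + 7 \<Longrightarrow> R s' k'"
  shows "wp answer b process s k0 R"
proof -
  let ?rss = "digits \<omega> t" and ?id = "t * walks + k + 1"
  let ?w = "\<lambda>k'. walk budget (?rss ! k') (fst a) (snd a)"
  have a': "(fst a, snd a) \<in> arcs" using a by simp
  have len\<omega>: "length \<omega> = trials * block" using env by (simp add: environment_def)
  have lrs: "length (?rss ! k') = len" if "k' < walks" for k' using digits_nth(1)[OF len\<omega> tk(1) that] .
  have cert: "certified (2 * len + 3) s" using inv by (simp add: trial_inv_def)
  have idb: "?id * (len + 2) < 2 ^ b" "?id < 2 ^ b"
  proof -
    have "t * walks + walks \<le> trials * walks" using mult_le_mono1[of "Suc t" trials walks] tk by simp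
    then have "?id \<le> trials * walks + 2" using tk by linarith
    then have le: "?id * (len + 2) \<le> (trials * walks + 2) * (len + 2)" by (rule mult_le_mono1)
    then show "?id * (len + 2) < 2 ^ b" using enough_bitsD(5)[OF big] by (rule le_less_trans)
    then show "?id < 2 ^ b" by (rule le_less_trans[rotated]) simp
  qed
  show ?thesis
  proof (cases "?w k")
    case None
    have slots: "slots_ok t (Suc k) ?rss a s"
      unfolding slots_ok_def
    proof
      fix x assume x: "x \<in> vertices"
      have "(s ''slot'' (t * (n + 1) + x) = 0 \<and> (\<forall>k'<k. \<forall>p. ?w k' = Some p \<longrightarrow> last p \<noteq> x)) \<or>
         (\<exists>k'<k. \<exists>p. s ''slot'' (t * (n + 1) + x) = t * walks + k' + 1 \<and> ?w k' = Some p \<and> last p = x \<and>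
          stored_path ((t * walks + k' + 1) * (len + 2)) p s)"
        using inv x unfolding trial_inv_def slots_ok_def by blast
      then show "(s ''slot'' (t * (n + 1) + x) = 0 \<and> (\<forall>k'<Suc k. \<forall>p. ?w k' = Some p \<longrightarrow> last p \<noteq> x)) \<or>
         (\<exists>k'<Suc k. \<exists>p. s ''slot'' (t * (n + 1) + x) = t * walks + k' + 1 \<and> ?w k' = Some p \<and> last p = x \<and>
          stored_path ((t * walks + k' + 1) * (len + 2)) p s)"
        using None by (metis less_Suc_eq option.distinct(1))
    qed
    have "silent (take (Suc k) ?rss) a" if "silent (take k ?rss) a"
      using that None tk by (simp add: silent_snoc)
    then have "trial_inv \<omega> t (Suc k) a s" using inv slots by (simp add: trial_inv_def)
    then have "R s (Suc (Suc k0))" by (intro R bs) auto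
    then show ?thesis using None s by (simp add: process_def)
  next
    case (Some q)
    note lq = last_walk[OF a' Some] and lk = lrs[OF tk(2)]
    define key where "key = t * (n + 1) + last q"
    have st: "stored_path (?id * (len + 2)) q s" using s(3) s(5)[OF Some] by simp
    have pq: "s ''path'' (?id * (len + 2) + len + 1) = last q"
    proof -
      have "len + 1 < length q" "q ! (len + 1) = last q" using lq lk by simp_all
      then have "s ''path'' (?id * (len + 2) + (len + 1)) = last q" using st unfolding stored_path_def by metis
      then show ?thesis by (simp only: add.assoc)
    qed
    have keyb: "key < 2 ^ b"
    proof -
      have "t * (n + 1) \<le> trials * (n + 1)" using tk by (intro mult_le_mono1) simp
      then have "key < (trials + 1) * (n + 1)" using lq(2) by (simp add: key_def)
      then show ?thesis using enough_bitsD(6)[OF big] by (rule less_trans)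
    qed
    define s1 where "s1 = update s ''key'' 0 key"
    have s1: "bounded_store b s1" using bs keyb by (auto simp: s1_def update_def bounded_store_def)
    have inv1: "trial_inv \<omega> t k a s1" using inv by (subst trial_inv_cong) (simp_all add: s1_def update_def)
    have sx: "s ''t'' 0 = t" "s ''n'' 0 = n" "s ''L'' 0 = len" using s env by (simp_all add: environment_def)
    have key_slot: "(s ''slot'' key = 0 \<and> (\<forall>k'<k. \<forall>p. ?w k' = Some p \<longrightarrow> last p \<noteq> last q)) \<or>
         (\<exists>k'<k. \<exists>p. s ''slot'' key = t * walks + k' + 1 \<and> ?w k' = Some p \<and> last p = last q \<and>
          stored_path ((t * walks + k' + 1) * (len + 2)) p s)"
      using inv lq(2) unfolding trial_inv_def slots_ok_def key_def by blast
    show ?thesis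
    proof (cases "s ''slot'' key = 0")
      case zero: True
      then have none: "\<And>k' p. k' < k \<Longrightarrow> ?w k' = Some p \<Longrightarrow> last p \<noteq> last q" using key_slot by auto
      define s2 where "s2 = update s1 ''slot'' key ?id"
      have s2: "bounded_store b s2" using s1 idb by (auto simp: s2_def update_def bounded_store_def)
      have p2: "s2 ''path'' = s ''path''" "s2 ''reject'' = s ''reject''" "s2 ''cert'' = s ''cert''"
        "s2 ''slot'' = (s ''slot'')(key := ?id)"
        by (simp_all add: s2_def s1_def update_def)
      have stored2: "stored_path i p s2 = stored_path i p s" for i p by (simp add: stored_path_def p2)
      have slots: "slots_ok t (Suc k) ?rss a s2"
        unfolding slots_ok_def
      proof
        fix x assume x: "x \<in> vertices"
        show "(s2 ''slot'' (t * (n + 1) + x) = 0 \<and> (\<forall>k'<Suc k. \<forall>p. ?w k' = Some p \<longrightarrow> last p \<noteq> x)) \<or>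
         (\<exists>k'<Suc k. \<exists>p. s2 ''slot'' (t * (n + 1) + x) = t * walks + k' + 1 \<and> ?w k' = Some p \<and> last p = x \<and>
          stored_path ((t * walks + k' + 1) * (len + 2)) p s2)"
        proof (cases "x = last q")
          case True
          then have "s2 ''slot'' (t * (n + 1) + x) = ?id" by (simp add: p2 key_def)
          then show ?thesis using True Some st stored2 by (intro disjI2 exI[of _ k]) auto
        next
          case False
          then have eq: "s2 ''slot'' (t * (n + 1) + x) = s ''slot'' (t * (n + 1) + x)" by (simp add: p2 key_def)
          have "(s ''slot'' (t * (n + 1) + x) = 0 \<and> (\<forall>k'<k. \<forall>p. ?w k' = Some p \<longrightarrow> last p \<noteq> x)) \<or>
           (\<exists>k'<k. \<exists>p. s ''slot'' (t * (n + 1) + x) = t * walks + k' + 1 \<and> ?w k' = Some p \<and> last p = x \<and>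
            stored_path ((t * walks + k' + 1) * (len + 2)) p s)"
            using inv x unfolding trial_inv_def slots_ok_def by blast
          then show ?thesis unfolding eq stored2 using Some False by (metis less_Suc_eq option.inject)
        qed
      qed
      have "silent (take (Suc k) ?rss) a" if "silent (take k ?rss) a"
        using that Some none tk by (auto simp: silent_snoc)
      moreover have "\<forall>i\<ge>(t + 1) * (n + 1). s2 ''slot'' i = 0"
      proof (intro allI impI)
        fix i assume i: "(t + 1) * (n + 1) \<le> i"
        have "key < (t + 1) * (n + 1)" using lq(2) by (simp add: key_def)
        then have "i \<noteq> key" using i by linarith
        then show "s2 ''slot'' i = 0" using i inv by (simp add: p2 trial_inv_def)
      qed
      ultimately have "trial_inv \<omega> t (Suc k) a s2" using inv slots certified_cong[of s2 s] p2
        by (simp add: trial_inv_def)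
      then have "R s2 (Suc (Suc (Suc (Suc (Suc k0)))))" by (intro R s2) auto
      then show ?thesis using Some s sx pq keyb zero idb
        by (simp add: process_def s2_def s1_def key_def) (simp add: update_def)
    next
      case False
      then obtain k' p where k': "k' < k" "s ''slot'' key = t * walks + k' + 1" "?w k' = Some p" "last p = last q"
        "stored_path ((t * walks + k' + 1) * (len + 2)) p s" using key_slot by auto
      note lp = last_walk[OF a' k'(3)] and lk' = lrs[of k']
      have lp': "length p = len + 2" "length q = len + 2" using lp lq lk lk' k' tk by auto
      define s2 where "s2 = update s1 ''xb'' 0 ((t * walks + k' + 1) * (len + 2))"
      have xbb: "(t * walks + k' + 1) * (len + 2) < 2 ^ b"
        by (rule le_less_trans[OF mult_le_mono1 idb(1)]) (use k' in simp)
      have s2: "bounded_store b s2" using s1 xbb by (auto simp: s2_def update_def bounded_store_def)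
      have s2': "s2 ''L'' 0 = len" "certified (2 * len + 3) s2" "stored_path (s2 ''xb'' 0) p s2"
          "stored_path (s2 ''base'' 0) q s2" "s2 ''slot'' = s ''slot''" "s2 ''path'' = s ''path''"
          "s2 ''reject'' = s ''reject''"
        using sx cert certified_cong[of s2 s "2 * len + 3"] k'(5) st s(3)
        by (simp_all add: s2_def s1_def update_def stored_path_def)
      note lb = enough_bitsD(3)[OF big]
      have "wp answer b compare_walks s2 (Suc (Suc (Suc (Suc (Suc (Suc k0)))))) R"
      proof (rule wp_compare_walks[OF s2 s2'(1-4) lp' lp(4) lq(4) lb])
        fix s3 k3
        assume s3: "bounded_store b s3" "\<forall>a. a \<notin> mods compare_walks \<longrightarrow> s3 a = s2 a" "certified (2 * len + 3) s3"
          "s3 ''reject'' 0 = 0 \<Longrightarrow> s2 ''reject'' 0 = 0 \<and> (\<forall>i. Suc i < length p \<longrightarrow> distinct (joined p q i))"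
          "k3 \<le> Suc (Suc (Suc (Suc (Suc (Suc k0))))) + compare_cost len"
        have s3': "s3 ''slot'' = s ''slot''" "s3 ''path'' = s ''path''" using s3(2) s2' by simp_all
        have stored3: "stored_path i p s3 = stored_path i p s" for i p by (simp add: stored_path_def s3')
        have slots: "slots_ok t (Suc k) ?rss a s3"
          unfolding slots_ok_def
        proof
          fix x assume x: "x \<in> vertices"
          show "(s3 ''slot'' (t * (n + 1) + x) = 0 \<and> (\<forall>k'<Suc k. \<forall>p. ?w k' = Some p \<longrightarrow> last p \<noteq> x)) \<or>
           (\<exists>k'<Suc k. \<exists>p. s3 ''slot'' (t * (n + 1) + x) = t * walks + k' + 1 \<and> ?w k' = Some p \<and> last p = x \<and>
            stored_path ((t * walks + k' + 1) * (len + 2)) p s3)"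
          proof (cases "x = last q")
            case True
            then show ?thesis unfolding stored3 s3' using k' by (intro disjI2 exI[of _ k']) (auto simp: key_def)
          next
            case False
            have "(s ''slot'' (t * (n + 1) + x) = 0 \<and> (\<forall>k'<k. \<forall>p. ?w k' = Some p \<longrightarrow> last p \<noteq> x)) \<or>
             (\<exists>k'<k. \<exists>p. s ''slot'' (t * (n + 1) + x) = t * walks + k' + 1 \<and> ?w k' = Some p \<and> last p = x \<and>
              stored_path ((t * walks + k' + 1) * (len + 2)) p s)"
              using inv x unfolding trial_inv_def slots_ok_def by blast
            then show ?thesis unfolding stored3 s3' using Some False by (metis less_Suc_eq option.inject)
          qed
        qed
        have silent: "(\<forall>t'<t. trial_silent (chunk \<omega> t')) \<and> silent (take (Suc k) ?rss) a" if rej: "s3 ''reject'' 0 = 0"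
        proof -
          have r0: "s ''reject'' 0 = 0" using s3(4)[OF rej] s2' by simp
          then have old: "\<forall>t'<t. trial_silent (chunk \<omega> t')" "silent (take k ?rss) a"
            using inv by (auto simp: trial_inv_def)
          have "p = q \<and> distinct p"
          proof (rule joined_repeat)
            show "length q = length p" "2 \<le> length p" using lp' by auto
            show "p ! 0 = q ! 0" "p ! 1 = q ! 1" using walk_length[OF Some] walk_length[OF k'(3)] by auto
            show "p ! (length p - 1) = q ! (length p - 1)"
              using k'(4) lp(1) lq(1) lk lk' k' tk lp' by simp
          qed (use s3(4)[OF rej] in blast)
          then have eq: "p = q" "distinct p" by auto
          \<comment> \<open>Any earlier walk with this end equals the representative
            \<open>p\<close>, because the earlier family is silent; the single comparison with
            \<open>p\<close> therefore settles all new pairs.\<close>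
          have "p' = q' \<and> distinct p'" if "i < k" "?w i = Some p'" "?w k = Some q'" "last p' = last q'" for i p' q'
          proof -
            have "p' = p" by (rule silent_takeD[OF old(2) that(1) k'(1) _ that(2) k'(3)])
                (use that k' Some tk in auto)
            then show ?thesis using eq that Some by simp
          qed
          then have "silent (take (Suc k) ?rss) a" using old(2) tk by (subst silent_snoc) auto
          then show ?thesis using old by blast
        qed
        have "trial_inv \<omega> t (Suc k) a s3"
          using s3(3) silent slots inv s3' by (simp add: trial_inv_def)
        then show "R s3 k3" using s3 by (intro R) auto
      qed
      then show ?thesis using Some s sx pq keyb False k' xbb
        by (simp add: process_def s2_def s1_def key_def) (simp add: update_def)
    qed
  qed
qed

definition walk_cost :: nat where
  "walk_cost = len * (d * (budget * (d * 15 + 10) + 30) + 20) + compare_cost len + 35"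

lemma environment_cong:
  assumes "s' ''n'' = s ''n''" "s' ''d'' = s ''d''" "s' ''B'' = s ''B''" "s' ''L'' = s ''L''"
    "s' ''M'' = s ''M''" "s' ''S'' = s ''S''" "s' ''T'' = s ''T''" "s' ''rnd'' = s ''rnd''"
  shows "environment \<omega> s' \<longleftrightarrow> environment \<omega> s"
  unfolding environment_def by (simp add: assms)

lemma wp_one_walk:
  assumes env: "environment \<omega> s" and bs: "bounded_store b s" and big: "enough_bits b"
    and tk: "t < trials" "k < walks" and a: "(s ''u'' 0, s ''v'' 0) \<in> arcs"
    and s: "s ''t'' 0 = t" "s ''k'' 0 = k"
    and inv: "trial_inv \<omega> t k (s ''u'' 0, s ''v'' 0) s"
    and R: "\<And>s' k'. trial_inv \<omega> t (Suc k) (s ''u'' 0, s ''v'' 0) s' \<Longrightarrow>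
      k' \<le> k0 + walk_cost \<Longrightarrow> R s' k'"
  shows "wp answer b one_walk s k0 R"
proof -
  let ?a = "(s ''u'' 0, s ''v'' 0)" and ?rs = "digits \<omega> t ! k" and ?id = "t * walks + k + 1"
  let ?rb = "t * block + 1 + k * len"
  have len\<omega>: "length \<omega> = trials * block" using env by (simp add: environment_def)
  have e: "s ''n'' 0 = n" "s ''d'' 0 = d" "s ''B'' 0 = budget" "s ''L'' 0 = len" "s ''M'' 0 = walks" "s ''S'' 0 = block"
    and rnd: "\<And>i. i < trials * block \<Longrightarrow> s ''rnd'' i = \<omega> ! i"
    using env by (simp_all add: environment_def)
  have idle: "?id \<le> trials * walks + 2"
  proof -
    have "t * walks + walks \<le> trials * walks" using mult_le_mono1[of "Suc t" trials walks] tk by simp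
    then show ?thesis using tk by linarith
  qed
  have baseb: "?id * (len + 2) < 2 ^ b"
    using mult_le_mono1[OF idle, of "len + 2"] enough_bitsD(5)[OF big] by (rule le_less_trans)
  have idb: "?id < 2 ^ b" by (rule le_less_trans[OF _ baseb]) simp
  have rb: "?rb + i < trials * block" if "i < len" for i
    using that walk_bounds[OF tk(2)] chunk_bounds[OF tk(1)] by (simp add: block_def)
  have rbb: "?rb < 2 ^ b"
  proof -
    have "?rb \<le> trials * block + 1" using rb[of 0] len_pos by simp
    then show ?thesis using enough_bitsD(7)[OF big] by (rule le_less_trans)
  qed
  define s1 where "s1 = update (update (update s ''id'' 0 ?id) ''base'' 0 (?id * (len + 2))) ''rb'' 0 ?rb"
  have s1: "bounded_store b s1" using bs idb baseb rbb by (auto simp: s1_def update_def bounded_store_def)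
  have s1': "s1 ''d'' 0 = d" "s1 ''B'' 0 = budget" "s1 ''L'' 0 = len" "(s1 ''u'' 0, s1 ''v'' 0) \<in> arcs"
      "s1 ''u'' 0 = s ''u'' 0" "s1 ''v'' 0 = s ''v'' 0" "s1 ''base'' 0 = ?id * (len + 2)" "s1 ''id'' 0 = ?id"
      "s1 ''t'' 0 = t"
    using e a s by (simp_all add: s1_def update_def)
  have env1: "environment \<omega> s1" using env by (subst environment_cong) (simp_all add: s1_def update_def)
  have inv1: "trial_inv \<omega> t k ?a s1" using inv by (subst trial_inv_cong) (simp_all add: s1_def update_def)
  have digs: "s1 ''rnd'' (s1 ''rb'' 0 + i) = ?rs ! i" if "i < len" for i
    using rnd[OF rb[OF that]] digits_nth(2)[OF len\<omega> tk that] by (simp add: s1_def update_def)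
  have lrs: "length ?rs = len" using digits_nth(1)[OF len\<omega> tk] .
  note bb = enough_bitsD(1,2,4)[OF big]
  have "wp answer b do_walk s1 (k0 + 7) (\<lambda>s2 k2. wp answer b process s2 k2 R)"
  proof (rule wp_do_walk[where L = len and B = budget and rs = ?rs])
    show "bounded_store b s1" "s1 ''d'' 0 = d" "s1 ''B'' 0 = budget" "s1 ''L'' 0 = len"
      "(s1 ''u'' 0, s1 ''v'' 0) \<in> arcs" "length ?rs = len"
      by (fact s1 s1' lrs)+
    show "s1 ''rnd'' (s1 ''rb'' 0 + i) = ?rs ! i" if "i < len" for i by (rule digs[OF that])
    show "1 + budget * d + d + budget < 2 ^ b" "n < 2 ^ b" "len < 2 ^ b" by (fact bb)+
  next
    fix s2 k2
    assume s2: "bounded_store b s2" "\<forall>a. a \<notin> mods do_walk \<longrightarrow> s2 a = s1 a"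
      "\<forall>i. i < s1 ''base'' 0 \<or> s1 ''base'' 0 + len + 2 \<le> i \<longrightarrow> s2 ''path'' i = s1 ''path'' i"
      "s2 ''ok'' 0 = (if walk budget ?rs (s1 ''u'' 0) (s1 ''v'' 0) = None then 0 else 1)"
      "\<And>p. walk budget ?rs (s1 ''u'' 0) (s1 ''v'' 0) = Some p \<Longrightarrow> stored_path (s1 ''base'' 0) p s2"
      "k2 \<le> k0 + 7 + len * (d * (budget * (d * 15 + 10) + 30) + 20) + 9"
    have env2: "environment \<omega> s2" using env1 by (subst environment_cong[where s = s1]) (simp_all add: s2(2))
    have s2': "s2 ''slot'' = s1 ''slot''" "s2 ''reject'' = s1 ''reject''" "s2 ''cert'' = s1 ''cert''"
        "s2 ''t'' 0 = t" "s2 ''id'' 0 = ?id" "s2 ''base'' 0 = ?id * (len + 2)"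
      using s2(2) s1' by simp_all
    \<comment> \<open>The segments of earlier walks lie entirely below the current
      \<open>base\<close>.\<close>
    have keep: "stored_path ((t * walks + k' + 1) * (len + 2)) p s2"
      if "stored_path ((t * walks + k' + 1) * (len + 2)) p s1" "k' < k" "length p = len + 2" for k' p
      unfolding stored_path_def
    proof (intro allI impI)
      fix i assume i: "i < length p"
      have "Suc (t * walks + k' + 1) * (len + 2) \<le> ?id * (len + 2)" using that(2) by (intro mult_le_mono1) simp
      then have "(t * walks + k' + 1) * (len + 2) + i < ?id * (len + 2)" using i that(3) by simp
      then show "s2 ''path'' ((t * walks + k' + 1) * (len + 2) + i) = p ! i"
        using s2(3) s1'(7) that(1) i by (simp add: stored_path_def)
    qed
    have "slots_ok t k (digits \<omega> t) ?a s2"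
      unfolding slots_ok_def fst_conv snd_conv
    proof
      fix x assume x: "x \<in> vertices"
      let ?w = "\<lambda>k'. walk budget (digits \<omega> t ! k') (s ''u'' 0) (s ''v'' 0)"
      have "(s1 ''slot'' (t * (n + 1) + x) = 0 \<and> (\<forall>k'<k. \<forall>p. ?w k' = Some p \<longrightarrow> last p \<noteq> x)) \<or>
           (\<exists>k'<k. \<exists>p. s1 ''slot'' (t * (n + 1) + x) = t * walks + k' + 1 \<and> ?w k' = Some p \<and> last p = x \<and>
            stored_path ((t * walks + k' + 1) * (len + 2)) p s1)"
        using inv1 x unfolding trial_inv_def slots_ok_def fst_conv snd_conv by blast
      moreover have "length p = len + 2" if "k' < k" "?w k' = Some p" for k' p
        using last_walk(3)[OF a that(2)] digits_nth(1)[OF len\<omega> tk(1), of k'] that tk by simp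
      ultimately show "(s2 ''slot'' (t * (n + 1) + x) = 0 \<and> (\<forall>k'<k. \<forall>p. ?w k' = Some p \<longrightarrow> last p \<noteq> x)) \<or>
           (\<exists>k'<k. \<exists>p. s2 ''slot'' (t * (n + 1) + x) = t * walks + k' + 1 \<and> ?w k' = Some p \<and> last p = x \<and>
            stored_path ((t * walks + k' + 1) * (len + 2)) p s2)"
        unfolding s2' using keep by metis
    qed
    then have inv2: "trial_inv \<omega> t k ?a s2"
      using inv1 certified_cong[of s2 s1] s2' by (simp add: trial_inv_def)
    show "wp answer b process s2 k2 R"
    proof (rule wp_process[OF env2 s2(1) big tk a s2'(4-6) _ _ inv2])
      show "s2 ''ok'' 0 = (if walk budget ?rs (fst ?a) (snd ?a) = None then 0 else 1)"
        using s2(4) s1' by simp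
      show "stored_path (s2 ''base'' 0) p s2" if "walk budget ?rs (fst ?a) (snd ?a) = Some p" for p
        using that s2(5) s2' s1' by simp
      show "R s3 k3" if "trial_inv \<omega> t (Suc k) ?a s3" "k3 \<le> k2 + compare_cost len + 7" for s3 k3
        by (rule R[OF that(1)]) (use that(2) s2(6) in \<open>simp add: walk_cost_def\<close>)
    qed
  qed
  then show ?thesis using e s idb baseb rbb
    by (simp add: one_walk_def s1_def) (simp add: update_def numeral_eq_Suc)
qed

lemma start_arc_arcs: "snd (start_arc r) \<noteq> 0 \<Longrightarrow> start_arc r \<in> arcs"
proof -
  assume nz: "snd (start_arc r) \<noteq> 0"
  let ?u = "r mod n + 1" and ?i = "(r div n) mod d + 1"
  have v: "?u \<in> vertices" "?i \<in> {1..length (adj ?u)}" "snd (start_arc r) = adj ?u ! (?i - 1)"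
    using nz unfolding start_arc_def neighbour_def by (auto split: if_splits)
  then have "snd (start_arc r) \<in> set (adj ?u)" by auto
  then show ?thesis using v(1) by (simp add: arcs_def start_arc_def)
qed

definition trial_cost :: nat where "trial_cost = walks * (walk_cost + 3) + 15"

definition run_inv :: "nat list \<Rightarrow> nat \<Rightarrow> store \<Rightarrow> bool" where
  "run_inv \<omega> t s \<longleftrightarrow> certified (2 * len + 3) s \<and>
     (s ''reject'' 0 = 0 \<longrightarrow> (\<forall>t'<t. trial_silent (chunk \<omega> t'))) \<and> (\<forall>i\<ge>t * (n + 1). s ''slot'' i = 0)"

lemma wp_one_trial:
  assumes env: "environment \<omega> s" and bs: "bounded_store b s" and big: "enough_bits b"
    and t: "t < trials" "s ''t'' 0 = t" and inv: "run_inv \<omega> t s"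
    and R: "\<And>s' k'. run_inv \<omega> (Suc t) s' \<Longrightarrow> k' \<le> k0 + trial_cost \<Longrightarrow> R s' k'"
  shows "wp answer b one_trial s k0 R"
proof -
  have len\<omega>: "length \<omega> = trials * block" using env by (simp add: environment_def)
  have e: "s ''n'' 0 = n" "s ''d'' 0 = d" "s ''M'' 0 = walks" "s ''S'' 0 = block"
    and rnd: "\<And>i. i < trials * block \<Longrightarrow> s ''rnd'' i = \<omega> ! i"
    using env by (simp_all add: environment_def)
  let ?r = "hd (chunk \<omega> t)"
  let ?u = "?r mod n + 1" and ?v = "snd (start_arc (hd (chunk \<omega> t)))"
  have "t * block < trials * block" using chunk_bounds[OF t(1)] by (simp add: block_def)
  then have r: "s ''rnd'' (t * block) = ?r" using rnd hd_chunk[OF len\<omega> t(1)] by simp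
  have r_b: "?r < 2 ^ b" using bs r unfolding bounded_store_def by metis
  have v: "?v = answer ?u (?r div n mod d + 1)" by (simp add: start_arc_def)
  have vb: "?v < 2 ^ b" using answer_le[of ?u] enough_bitsD(2)[OF big] unfolding v by (meson le_less_trans)
  have ub: "?u < 2 ^ b"
  proof -
    have "?u \<le> n" using n_pos mod_less_divisor[of n ?r] by linarith
    then show ?thesis using enough_bitsD(2)[OF big] by (rule le_less_trans)
  qed
  define s1 where "s1 = update (update (update s ''r0'' 0 ?r) ''u'' 0 ?u) ''v'' 0 ?v"
  have s1: "bounded_store b s1" using bs r_b ub vb by (auto simp: s1_def update_def bounded_store_def)
  have s1': "s1 ''M'' 0 = walks" "s1 ''t'' 0 = t" "s1 ''u'' 0 = ?u" "s1 ''v'' 0 = ?v"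
    "s1 ''slot'' = s ''slot''" "s1 ''reject'' = s ''reject''" "s1 ''cert'' = s ''cert''"
    using e t by (simp_all add: s1_def update_def)
  have env1: "environment \<omega> s1" using env by (subst environment_cong) (simp_all add: s1_def update_def)
  have arc: "start_arc ?r = (?u, ?v)" by (simp add: start_arc_def)
  have slot_later: "\<forall>i\<ge>(t + 1) * (n + 1). s1 ''slot'' i = 0" using inv s1' by (simp add: run_inv_def)
  have cert1: "certified (2 * len + 3) s1" using inv certified_cong[of s1 s] s1' by (simp add: run_inv_def)
  have "wp answer b (If (V ''v'') (For ''k'' (V ''M'') one_walk) Skip) s1 (k0 + 6) R"
  proof (cases "?v = 0")
    case True
    then have "trial_silent (chunk \<omega> t)" by (simp add: trial_silent_def)
    then have "run_inv \<omega> (Suc t) s1"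
      using inv cert1 slot_later s1' by (auto simp: run_inv_def less_Suc_eq)
    then have "R s1 (k0 + 8)" by (rule R) (simp add: trial_cost_def)
    then show ?thesis using True s1' by (simp add: numeral_eq_Suc)
  next
    case False
    then have uv: "(?u, ?v) \<in> arcs" using start_arc_arcs[of ?r] arc by simp
    have "wp answer b (For ''k'' (V ''M'') one_walk) s1 (k0 + 7) R"
    proof (rule wp_For[where m = walks and N = walk_cost and I = "\<lambda>k s2. trial_inv \<omega> t k (?u, ?v) s2"])
      show "bounded_store b s1" by (rule s1)
      show "walks < 2 ^ b"
      proof -
        have "1 \<le> trials" using e_pos by (simp add: trials_def)
        then have "walks \<le> trials * walks + 2" using mult_le_mono1[of 1 trials walks] by linarith
        also have "\<dots> \<le> (trials * walks + 2) * (len + 2)" by simp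
        finally show ?thesis using enough_bitsD(5)[OF big] by (rule le_less_trans)
      qed
      show "''k'' \<notin> mods one_walk" by simp
      show "trial_inv \<omega> t 0 (?u, ?v) (update s1 ''k'' 0 0)"
        using inv s1' cert1 slot_later
        by (simp add: trial_inv_def slots_ok_def run_inv_def silent_def update_def)
      show "evaluate s2 (V ''M'') = walks"
        if "\<forall>a. a \<notin> insert ''k'' (mods one_walk) \<longrightarrow> s2 a = s1 a" for s2
        using that s1' by simp
    next
      fix k s2 k2
      assume k: "k < walks" and fr: "\<forall>a. a \<notin> insert ''k'' (mods one_walk) \<longrightarrow> s2 a = s1 a"
        and bs2: "bounded_store b s2" and sk: "s2 ''k'' 0 = k" and inv2: "trial_inv \<omega> t k (?u, ?v) s2"
      have s2: "s2 ''u'' 0 = ?u" "s2 ''v'' 0 = ?v" "s2 ''t'' 0 = t" using fr s1' by simp_all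
      have env2: "environment \<omega> s2" using env1 by (subst environment_cong[where s = s1]) (simp_all add: fr)
      show "wp answer b one_walk s2 k2 (\<lambda>s3 k3. k3 \<le> k2 + walk_cost \<and> trial_inv \<omega> t (Suc k) (?u, ?v) (update s3 ''k'' 0 (Suc k)))"
      proof (rule wp_one_walk[OF env2 bs2 big t(1) k _ s2(3) sk])
        show "(s2 ''u'' 0, s2 ''v'' 0) \<in> arcs" "trial_inv \<omega> t k (s2 ''u'' 0, s2 ''v'' 0) s2"
          using uv inv2 s2 by simp_all
        fix s3 k3
        assume "trial_inv \<omega> t (Suc k) (s2 ''u'' 0, s2 ''v'' 0) s3" "k3 \<le> k2 + walk_cost"
        moreover have "trial_inv \<omega> t (Suc k) (?u, ?v) (update s3 ''k'' 0 (Suc k)) = trial_inv \<omega> t (Suc k) (?u, ?v) s3"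
          by (rule trial_inv_cong) (simp_all add: update_def)
        ultimately show "k3 \<le> k2 + walk_cost \<and> trial_inv \<omega> t (Suc k) (?u, ?v) (update s3 ''k'' 0 (Suc k))"
          using s2 by simp
      qed
    next
      fix s2 k2
      assume inv2: "trial_inv \<omega> t walks (?u, ?v) s2" and k2: "k2 \<le> k0 + 7 + walks * (walk_cost + 3) + 3"
      have "trial_silent (chunk \<omega> t)" if "silent (take walks (digits \<omega> t)) (?u, ?v)"
        using that arc by (simp add: trial_silent_def digits_def blocks_def)
      then have "run_inv \<omega> (Suc t) s2" using inv2 by (auto simp: trial_inv_def run_inv_def less_Suc_eq)
      then show "R s2 k2" by (rule R) (use k2 in \<open>simp add: trial_cost_def\<close>)
    qed
    then show ?thesis using False s1' by (simp add: numeral_eq_Suc)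
  qed
  moreover have "start_arc ?r = (?u, answer ?u (?r div n mod d + 1))" by (simp add: start_arc_def)
  ultimately show ?thesis using e t r r_b ub vb v
    by (simp add: one_trial_def s1_def del: wp.simps(6)) (simp add: update_def numeral_eq_Suc del: wp.simps(6))
qed

definition run_cost :: nat where "run_cost = trials * (trial_cost + 3) + 3"

lemma wp_run_trials:
  assumes env: "environment \<omega> s" and bs: "bounded_store b s" and big: "enough_bits b"
    and s: "s ''reject'' 0 = 0" "s ''slot'' = (\<lambda>i. 0)"
    and R: "\<And>s' k'. run_inv \<omega> trials s' \<Longrightarrow> k' \<le> k0 + run_cost \<Longrightarrow> R s' k'"
  shows "wp answer b run_trials s k0 R"
  unfolding run_trials_def
proof (rule wp_For[where m = trials and N = trial_cost and I = "run_inv \<omega>"])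
  show "bounded_store b s" by (rule bs)
  show "trials < 2 ^ b"
  proof -
    have "trials \<le> (trials + 1) * (n + 1)" by simp
    then show ?thesis using enough_bitsD(6)[OF big] by (rule le_less_trans)
  qed
  show "''t'' \<notin> mods one_trial" by simp
  show "run_inv \<omega> 0 (update s ''t'' 0 0)" using s by (simp add: run_inv_def update_def certified_def)
  show "evaluate s1 (V ''T'') = trials"
    if "\<forall>a. a \<notin> insert ''t'' (mods one_trial) \<longrightarrow> s1 a = s a" for s1
    using that env by (simp add: environment_def)
next
  fix t s1 k1
  assume t: "t < trials" and fr: "\<forall>a. a \<notin> insert ''t'' (mods one_trial) \<longrightarrow> s1 a = s a"
    and bs1: "bounded_store b s1" and st: "s1 ''t'' 0 = t" and inv: "run_inv \<omega> t s1"
  have env1: "environment \<omega> s1" using env by (subst environment_cong[where s = s]) (simp_all add: fr)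
  show "wp answer b one_trial s1 k1 (\<lambda>s2 k2. k2 \<le> k1 + trial_cost \<and> run_inv \<omega> (Suc t) (update s2 ''t'' 0 (Suc t)))"
    by (rule wp_one_trial[OF env1 bs1 big t st inv]) (simp add: run_inv_def update_def)
next
  fix s1 k1 assume "run_inv \<omega> trials s1" "k1 \<le> k0 + trials * (trial_cost + 3) + 3"
  then show "R s1 k1" by (intro R) (simp_all add: run_cost_def)
qed

end

subsection \<open>Initialisation\<close>

text \<open>A rule for the searches by doubling: the exact number \<open>m\<close> of rounds is
  supplied from outside, and the test must hold before each of these rounds and fail after them. The
  invariant can then name the value reached after \<open>j\<close> rounds.\<close>

lemma wp_While:
  assumes bnd: "bounded_store b s" and init: "I 0 s"
    and step: "\<And>j s1 k1. j < m \<Longrightarrow> (\<forall>a. a \<notin> mods c \<longrightarrow> s1 a = s a) \<Longrightarrow> I j s1 \<Longrightarrow>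
       evaluate s1 e \<noteq> 0 \<and> wp q b c s1 k1 (\<lambda>s2 k2. k2 \<le> k1 + N \<and> I (Suc j) s2)"
    and last: "\<And>s1. (\<forall>a. a \<notin> mods c \<longrightarrow> s1 a = s a) \<Longrightarrow> I m s1 \<Longrightarrow> evaluate s1 e = 0"
    and fin: "\<And>s1 k1. (\<forall>a. a \<notin> mods c \<longrightarrow> s1 a = s a) \<Longrightarrow> bounded_store b s1 \<Longrightarrow> I m s1 \<Longrightarrow>
       k1 \<le> k + m * (N + 1) + 1 \<Longrightarrow> R s1 k1"
  shows "wp q b (While e c) s k R"
proof -
  define J where "J = (\<lambda>j' s1 k1. \<exists>j\<le>m. j' = m - j \<and> (\<forall>a. a \<notin> mods c \<longrightarrow> s1 a = s a) \<and>
     bounded_store b s1 \<and> I j s1 \<and> k1 \<le> k + j * (N + 1))"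
  show ?thesis
    unfolding wp.simps
  proof (rule exI[of _ J], rule exI[of _ m], intro conjI allI impI)
    show "J m s k" unfolding J_def using bnd init by (intro exI[of _ 0]) auto
    fix j' s1 k1 assume "J j' s1 k1"
    then obtain j where j: "j \<le> m" "j' = m - j" "\<forall>a. a \<notin> mods c \<longrightarrow> s1 a = s a"
      "bounded_store b s1" "I j s1" "k1 \<le> k + j * (N + 1)" unfolding J_def by blast
    show "if evaluate s1 e \<noteq> 0 then wp q b c s1 (k1 + 1) (\<lambda>s' k'. \<exists>j''<j'. J j'' s' k') else R s1 (k1 + 1)"
    proof (cases "j < m")
      case True
      have "wp q b c s1 (k1 + 1) (\<lambda>s' k'. (k' \<le> k1 + 1 + N \<and> I (Suc j) s') \<and>
          bounded_store b s' \<and> (\<forall>a. a \<notin> mods c \<longrightarrow> s' a = s1 a))"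
        by (intro wp_frame j(4)) (use step[OF True j(3,5)] in blast)
      then have "wp q b c s1 (k1 + 1) (\<lambda>s' k'. \<exists>j''<j'. J j'' s' k')"
      proof (rule wp_mono)
        fix s' k' assume *: "(k' \<le> k1 + 1 + N \<and> I (Suc j) s') \<and>
          bounded_store b s' \<and> (\<forall>a. a \<notin> mods c \<longrightarrow> s' a = s1 a)"
        have "k' \<le> k + Suc j * (N + 1)" using * j(6) by simp
        then have "J (m - Suc j) s' k'" unfolding J_def
          by (intro exI[of _ "Suc j"]) (use True * j(3) in simp)
        moreover have "m - Suc j < j'" using True j by simp
        ultimately show "\<exists>j''<j'. J j'' s' k'" by blast
      qed
      then show ?thesis using step[OF True j(3,5)] by simp
    next
      case False
      then have jm: "j = m" using j by simp
      have "R s1 (k1 + 1)" by (rule fin[OF j(3,4)]) (use j jm in auto)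
      then show ?thesis using last[OF j(3)] j(5) jm by simp
    qed
  qed
qed

lemma wp_Assign_seq:
  "evaluate s e = v \<Longrightarrow> v < 2 ^ b \<Longrightarrow> wp q b c (update s x 0 v) (k + 2) R \<Longrightarrow> wp q b (Assign x e ;; c) s k R"
  by simp

definition find_log :: com where
  "find_log =
    (Assign ''pw'' (Const 1) ;; Assign ''lg'' (Const 0) ;;
     While (Op Less (V ''pw'') (V ''n'')) (Assign ''pw'' (V ''pw'' \<oplus> V ''pw'') ;; Assign ''lg'' (V ''lg'' \<oplus> Const 1)))"

text \<open>Doubling overshoots the square root by less than a factor of 2 and needs only
  logarithmically many rounds.\<close>

definition find_sqrt :: com where
  "find_sqrt =
    (Assign ''sq'' (Const 1) ;;
     While (Op Less (V ''sq'' \<otimes> V ''sq'') (V ''n'')) (Assign ''sq'' (V ''sq'' \<oplus> V ''sq'')))"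

definition find_range :: com where
  "find_range =
    (Assign ''Q'' (V ''n'') ;; For ''i'' (V ''d'') (Assign ''Q'' (V ''Q'' \<otimes> (V ''i'' \<oplus> Const 1))))"

definition set_parameters :: com where
  "set_parameters =
    (Assign ''L'' (Const 4 \<otimes> V ''inv_eps'' \<otimes> (Const 6 \<oplus> V ''inv_eps'' \<oplus> V ''lg'')) ;;
     Assign ''B'' (Const 16 \<otimes> V ''inv_eps'' \<otimes> V ''L'') ;;
     Assign ''m'' (Const 512 \<otimes> V ''inv_eps'' \<otimes> V ''sq'') ;;
     Assign ''M'' (V ''m'' \<oplus> V ''m'') ;;
     Assign ''T'' (Const 64 \<otimes> V ''inv_eps'') ;;
     Assign ''S'' (Const 1 \<oplus> V ''M'' \<otimes> V ''L'') ;;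
     Assign ''X'' (V ''T'' \<otimes> V ''S'') ;;
     Assign ''x'' (Const 0))"

definition initialise :: com where
  "initialise = (find_log ;; find_sqrt ;; find_range ;; set_parameters)"

text \<open>Minimality determines where the doubling loops stop, so that the computed values are
  exactly these parameters; it also bounds them from above.\<close>

locale minimal_tester = tester +
  fixes sj :: nat
  assumes lg_min: "\<And>i. i < lg \<Longrightarrow> 2 ^ i < n"
    and sq_eq: "sq = 2 ^ sj" and sq_min: "\<And>i. i < sj \<Longrightarrow> 2 ^ i * 2 ^ i < n"
begin

definition parameters_set :: "store \<Rightarrow> bool" where
  "parameters_set s \<longleftrightarrow> s ''n'' 0 = n \<and> s ''d'' 0 = d \<and> s ''B'' 0 = budget \<and> s ''L'' 0 = len \<and>
     s ''M'' 0 = walks \<and> s ''S'' 0 = block \<and> s ''T'' 0 = trials \<and>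
     s ''Q'' 0 = range_size \<and> s ''X'' 0 = trials * block \<and> s ''x'' 0 = 0 \<and>
     s ''reject'' = (\<lambda>i. 0) \<and> s ''slot'' = (\<lambda>i. 0)"

definition init_bits :: "nat \<Rightarrow> bool" where
  "init_bits b \<longleftrightarrow> 2 * n < 2 ^ b \<and> lg < 2 ^ b \<and> sq < 2 ^ b \<and> range_size < 2 ^ b \<and> d < 2 ^ b \<and>
     len < 2 ^ b \<and> budget < 2 ^ b \<and> half < 2 ^ b \<and> walks < 2 ^ b \<and> trials < 2 ^ b \<and>
     block < 2 ^ b \<and> trials * block < 2 ^ b"

lemma wp_find_log:
  assumes s: "bounded_store b s" "s ''n'' 0 = n" and b: "init_bits b"
    and R: "\<And>s' k'. (\<forall>a. a \<notin> {''pw'', ''lg''} \<longrightarrow> s' a = s a) \<Longrightarrow> bounded_store b s' \<Longrightarrow> s' ''lg'' 0 = lg \<Longrightarrow>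
      k' \<le> k + lg * 6 + 8 \<Longrightarrow> R s' k'"
  shows "wp q b find_log s k R"
proof -
  define s0 where "s0 = update (update s ''pw'' 0 1) ''lg'' 0 0"
  have b': "2 * n < 2 ^ b" "lg < 2 ^ b" using b unfolding init_bits_def by blast+
  then have one: "(1::nat) < 2 ^ b" using n_pos by linarith
  have s0: "bounded_store b s0" using s one by (auto simp: s0_def update_def bounded_store_def)
  let ?c = "Assign ''pw'' (V ''pw'' \<oplus> V ''pw'') ;; Assign ''lg'' (V ''lg'' \<oplus> Const 1)"
  have "wp q b (While (Op Less (V ''pw'') (V ''n'')) ?c) s0 (k + 4) R"
  proof (rule wp_While[where m = lg and N = 3 and I = "\<lambda>j s1. s1 ''pw'' 0 = 2 ^ j \<and> s1 ''lg'' 0 = j"])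
    show "bounded_store b s0" by (rule s0)
    show "s0 ''pw'' 0 = 2 ^ 0 \<and> s0 ''lg'' 0 = 0" by (simp add: s0_def update_def)
  next
    fix j s1 k1
    assume j: "j < lg" and fr: "\<forall>a. a \<notin> mods ?c \<longrightarrow> s1 a = s0 a" and I: "s1 ''pw'' 0 = 2 ^ j \<and> s1 ''lg'' 0 = j"
    have n1: "s1 ''n'' 0 = n" using fr s by (simp add: s0_def update_def)
    have "2 ^ j < n" by (rule lg_min[OF j])
    moreover from this have "2 ^ j + 2 ^ j < (2::nat) ^ b" using b' by linarith
    moreover have "Suc j < 2 ^ b" using j b' by linarith
    ultimately show "evaluate s1 (Op Less (V ''pw'') (V ''n'')) \<noteq> 0 \<and>
       wp q b ?c s1 k1 (\<lambda>s2 k2. k2 \<le> k1 + 3 \<and> s2 ''pw'' 0 = 2 ^ Suc j \<and> s2 ''lg'' 0 = Suc j)"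
      using n1 I by (simp add: update_def)
  next
    fix s1
    assume "\<forall>a. a \<notin> mods ?c \<longrightarrow> s1 a = s0 a" "s1 ''pw'' 0 = 2 ^ lg \<and> s1 ''lg'' 0 = lg"
    then show "evaluate s1 (Op Less (V ''pw'') (V ''n'')) = 0"
      using s lg by (simp add: s0_def update_def)
  next
    fix s1 k1
    assume fr: "\<forall>a. a \<notin> mods ?c \<longrightarrow> s1 a = s0 a" and s1: "bounded_store b s1"
      "s1 ''pw'' 0 = 2 ^ lg \<and> s1 ''lg'' 0 = lg" "k1 \<le> k + 4 + lg * (3 + 1) + 1"
    have "\<forall>a. a \<notin> {''pw'', ''lg''} \<longrightarrow> s1 a = s a" using fr by (simp add: s0_def update_def)
    then show "R s1 k1" by (rule R) (use s1 in auto)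
  qed
  then show ?thesis using one by (simp add: find_log_def s0_def del: wp.simps(7)) (simp add: update_def numeral_eq_Suc del: wp.simps(7))
qed

lemma wp_find_sqrt:
  assumes s: "bounded_store b s" "s ''n'' 0 = n" and b: "init_bits b"
    and R: "\<And>s' k'. (\<forall>a. a \<noteq> ''sq'' \<longrightarrow> s' a = s a) \<Longrightarrow> bounded_store b s' \<Longrightarrow> s' ''sq'' 0 = sq \<Longrightarrow>
      k' \<le> k + sj * 2 + 6 \<Longrightarrow> R s' k'"
  shows "wp q b find_sqrt s k R"
proof -
  define s0 where "s0 = update s ''sq'' 0 1"
  have b': "2 * n < 2 ^ b" "sq < 2 ^ b" using b unfolding init_bits_def by blast+
  then have one: "(1::nat) < 2 ^ b" using n_pos by linarith
  have s0: "bounded_store b s0" using s one by (auto simp: s0_def update_def bounded_store_def)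
  let ?c = "Assign ''sq'' (V ''sq'' \<oplus> V ''sq'')"
  have "wp q b (While (Op Less (V ''sq'' \<otimes> V ''sq'') (V ''n'')) ?c) s0 (k + 2) R"
  proof (rule wp_While[where m = sj and N = 1 and I = "\<lambda>j s1. s1 ''sq'' 0 = 2 ^ j"])
    show "bounded_store b s0" by (rule s0)
    show "s0 ''sq'' 0 = 2 ^ 0" by (simp add: s0_def update_def)
  next
    fix j s1 k1
    assume j: "j < sj" and fr: "\<forall>a. a \<notin> mods ?c \<longrightarrow> s1 a = s0 a" and I: "s1 ''sq'' 0 = 2 ^ j"
    have n1: "s1 ''n'' 0 = n" using fr s by (simp add: s0_def update_def)
    have "(2::nat) ^ Suc j \<le> 2 ^ sj" using j by (intro power_increasing) auto
    then have "(2::nat) ^ j + 2 ^ j \<le> sq" using sq_eq by simp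
    then have "(2::nat) ^ j + 2 ^ j < 2 ^ b" using b'(2) by (rule le_less_trans)
    then show "evaluate s1 (Op Less (V ''sq'' \<otimes> V ''sq'') (V ''n'')) \<noteq> 0 \<and>
       wp q b ?c s1 k1 (\<lambda>s2 k2. k2 \<le> k1 + 1 \<and> s2 ''sq'' 0 = 2 ^ Suc j)"
      using n1 I sq_min[OF j] by (simp add: update_def)
  next
    fix s1
    assume "\<forall>a. a \<notin> mods ?c \<longrightarrow> s1 a = s0 a" "s1 ''sq'' 0 = 2 ^ sj"
    then show "evaluate s1 (Op Less (V ''sq'' \<otimes> V ''sq'') (V ''n'')) = 0"
      using s sq sq_eq by (simp add: s0_def update_def)
  next
    fix s1 k1
    assume fr: "\<forall>a. a \<notin> mods ?c \<longrightarrow> s1 a = s0 a" and s1: "bounded_store b s1"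
      "s1 ''sq'' 0 = 2 ^ sj" "k1 \<le> k + 2 + sj * (1 + 1) + 1"
    have "\<forall>a. a \<noteq> ''sq'' \<longrightarrow> s1 a = s a" using fr by (simp add: s0_def update_def)
    then show "R s1 k1" by (rule R) (use s1 sq_eq in auto)
  qed
  then show ?thesis using one by (simp add: find_sqrt_def s0_def del: wp.simps(7))
qed

lemma wp_find_range:
  assumes s: "bounded_store b s" "s ''n'' 0 = n" "s ''d'' 0 = d" and b: "init_bits b"
    and R: "\<And>s' k'. (\<forall>a. a \<notin> {''Q'', ''i''} \<longrightarrow> s' a = s a) \<Longrightarrow> bounded_store b s' \<Longrightarrow> s' ''Q'' 0 = range_size \<Longrightarrow>
      k' \<le> k + d * 4 + 6 \<Longrightarrow> R s' k'"
  shows "wp q b find_range s k R"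
proof -
  define s0 where "s0 = update s ''Q'' 0 n"
  have b': "2 * n < 2 ^ b" "range_size < 2 ^ b" "d < 2 ^ b" using b unfolding init_bits_def by blast+
  then have nb: "n < 2 ^ b" by linarith
  have s0: "bounded_store b s0" using s nb by (auto simp: s0_def update_def bounded_store_def)
  let ?c = "Assign ''Q'' (V ''Q'' \<otimes> (V ''i'' \<oplus> Const 1))"
  have "wp q b (For ''i'' (V ''d'') ?c) s0 (k + 2) R"
  proof (rule wp_For[where m = d and N = 1 and I = "\<lambda>j s1. s1 ''Q'' 0 = n * fact j"])
    show "bounded_store b s0" "d < 2 ^ b" "''i'' \<notin> mods ?c" using s0 b' by auto
    show "update s0 ''i'' 0 0 ''Q'' 0 = n * fact 0" by (simp add: s0_def update_def)
    show "evaluate s1 (V ''d'') = d" if "\<forall>a. a \<notin> insert ''i'' (mods ?c) \<longrightarrow> s1 a = s0 a" for s1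
      using that s by (simp add: s0_def update_def)
  next
    fix j k1 and s1 :: store
    assume j: "j < d" and I: "s1 ''i'' 0 = j" "s1 ''Q'' 0 = n * fact j"
    have "n * fact (Suc j) \<le> range_size" unfolding range_size_def using j by (intro mult_le_mono2 fact_mono_nat) simp
    then have "n * fact (Suc j) < 2 ^ b" using b'(2) by (rule le_less_trans)
    moreover have "n * fact j * (j + 1) = n * fact (Suc j)" by (simp add: algebra_simps)
    ultimately show "wp q b ?c s1 k1 (\<lambda>s2 k2. k2 \<le> k1 + 1 \<and> update s2 ''i'' 0 (Suc j) ''Q'' 0 = n * fact (Suc j))"
      using I by (simp add: update_def)
  next
    fix s1 k1
    assume fr: "\<forall>a. a \<notin> insert ''i'' (mods ?c) \<longrightarrow> s1 a = s0 a" and s1: "bounded_store b s1"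
      "s1 ''Q'' 0 = n * fact d" "k1 \<le> k + 2 + d * (1 + 3) + 3"
    have "\<forall>a. a \<notin> {''Q'', ''i''} \<longrightarrow> s1 a = s a" using fr by (simp add: s0_def update_def)
    then show "R s1 k1" by (rule R) (use s1 in \<open>auto simp: range_size_def\<close>)
  qed
  then show ?thesis using s nb by (simp add: find_range_def s0_def)
qed

lemma wp_set_parameters:
  assumes s: "s ''n'' 0 = n" "s ''d'' 0 = d" "s ''inv_eps'' 0 = e" "s ''lg'' 0 = lg"
      "s ''sq'' 0 = sq" "s ''Q'' 0 = range_size" "s ''reject'' = (\<lambda>i. 0)" "s ''slot'' = (\<lambda>i. 0)"
    and b: "init_bits b"
    and R: "\<And>s' k'. parameters_set s' \<Longrightarrow> k' \<le> k + 15 \<Longrightarrow> R s' k'"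
  shows "wp q b set_parameters s k R"
proof -
  have b': "2 * n < 2 ^ b" "len < 2 ^ b" "budget < 2 ^ b" "half < 2 ^ b" "walks < 2 ^ b" "trials < 2 ^ b"
    "block < 2 ^ b" "trials * block < 2 ^ b" using b unfolding init_bits_def by blast+
  have z: "(0::nat) < 2 ^ b" by simp
  have eq: "4 * e * (6 + e + lg) = len" "16 * e * len = budget" "512 * e * sq = half" "half + half = walks"
      "64 * e = trials" "1 + walks * len = block"
    by (simp_all add: len_def lightness_def budget_def half_def walks_def trials_def block_def)
  define s' where "s' = update (update (update (update (update (update (update (update s ''L'' 0 len) ''B'' 0 budget)
    ''m'' 0 half) ''M'' 0 walks) ''T'' 0 trials) ''S'' 0 block) ''X'' 0 (trials * block)) ''x'' 0 0"
  have "parameters_set s'" using s by (simp add: s'_def parameters_set_def update_def)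
  then have R': "R s' (k + 2 + 2 + 2 + 2 + 2 + 2 + 2 + 1)" by (rule R) simp
  show ?thesis unfolding set_parameters_def
    apply (rule wp_Assign_seq[where v = len], simp add: s eq, fact)
    apply (rule wp_Assign_seq[where v = budget], simp add: s eq update_def, fact)
    apply (rule wp_Assign_seq[where v = half], simp add: s eq update_def, fact)
    apply (rule wp_Assign_seq[where v = walks], simp add: s eq update_def, fact)
    apply (rule wp_Assign_seq[where v = trials], simp add: s eq update_def, fact)
    apply (rule wp_Assign_seq[where v = block], simp add: s eq[simplified] update_def, fact)
    apply (rule wp_Assign_seq[where v = "trials * block"], simp add: s update_def, fact)
    using R' unfolding s'_def by (simp only: wp.simps evaluate.simps z simp_thms)
qed

definition init_cost :: nat where "init_cost = lg * 6 + sj * 2 + d * 4 + 40"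

lemma wp_initialise:
  assumes s: "bounded_store b s" "s ''n'' 0 = n" "s ''d'' 0 = d" "s ''inv_eps'' 0 = e"
      "s ''reject'' = (\<lambda>i. 0)" "s ''slot'' = (\<lambda>i. 0)"
    and b: "init_bits b"
    and R: "\<And>s' k'. parameters_set s' \<Longrightarrow> k' \<le> k + init_cost \<Longrightarrow> R s' k'"
  shows "wp q b initialise s k R"
proof -
  have "wp q b find_log s (k + 1) (\<lambda>s1 k1. wp q b find_sqrt s1 (k1 + 1) (\<lambda>s2 k2.
      wp q b find_range s2 (k2 + 1) (\<lambda>s3 k3. wp q b set_parameters s3 k3 R)))"
  proof (rule wp_find_log[OF s(1,2) b])
    fix s1 k1
    assume s1: "\<forall>a. a \<notin> {''pw'', ''lg''} \<longrightarrow> s1 a = s a" "bounded_store b s1" "s1 ''lg'' 0 = lg"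
      "k1 \<le> k + 1 + lg * 6 + 8"
    show "wp q b find_sqrt s1 (k1 + 1) (\<lambda>s2 k2.
      wp q b find_range s2 (k2 + 1) (\<lambda>s3 k3. wp q b set_parameters s3 k3 R))"
    proof (rule wp_find_sqrt[OF s1(2) _ b])
      show "s1 ''n'' 0 = n" using s1(1) s by simp
      fix s2 k2
      assume s2: "\<forall>a. a \<noteq> ''sq'' \<longrightarrow> s2 a = s1 a" "bounded_store b s2" "s2 ''sq'' 0 = sq" "k2 \<le> k1 + 1 + sj * 2 + 6"
      show "wp q b find_range s2 (k2 + 1) (\<lambda>s3 k3. wp q b set_parameters s3 k3 R)"
      proof (rule wp_find_range[OF s2(2) _ _ b])
        show "s2 ''n'' 0 = n" "s2 ''d'' 0 = d" using s2(1) s1(1) s by simp_all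
        fix s3 k3
        assume s3: "\<forall>a. a \<notin> {''Q'', ''i''} \<longrightarrow> s3 a = s2 a" "bounded_store b s3" "s3 ''Q'' 0 = range_size"
          "k3 \<le> k2 + 1 + d * 4 + 6"
        show "wp q b set_parameters s3 k3 R"
        proof (rule wp_set_parameters)
          show "s3 ''Q'' 0 = range_size" "init_bits b" by fact+
          show "s3 ''n'' 0 = n" "s3 ''d'' 0 = d" "s3 ''inv_eps'' 0 = e" "s3 ''lg'' 0 = lg" "s3 ''sq'' 0 = sq"
            "s3 ''reject'' = (\<lambda>i. 0)" "s3 ''slot'' = (\<lambda>i. 0)"
            using s3(1) s2(1,3) s1(1,3) s by simp_all
          fix s4 k4 assume "parameters_set s4" "k4 \<le> k3 + 15"
          then show "R s4 k4" using s3(4) s2(4) s1(4) by (intro R) (simp_all add: init_cost_def)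
        qed
      qed
    qed
  qed
  then show ?thesis by (simp add: initialise_def)
qed

end

subsection \<open>Drawing the random numbers\<close>

definition draw_body :: com where
  "draw_body = (Random ''rnd'' (V ''x'') (V ''Q'') ;; Assign ''x'' (V ''x'' \<oplus> Const 1))"

definition draw :: com where
  "draw = While (Op Less (V ''x'') (V ''X'')) draw_body"

text \<open>The store that results from a given outcome of the draws; it separates the effect of the
  loop from its distribution.\<close>

fun drawn :: "store \<Rightarrow> nat list \<Rightarrow> store" where
  "drawn s [] = s"
| "drawn s (r # rs) = drawn (update (update s ''rnd'' (s ''x'' 0) r) ''x'' 0 (s ''x'' 0 + 1)) rs"

fun draw_time :: "store \<Rightarrow> nat list \<Rightarrow> nat" where
  "draw_time s [] = 1 + expr_cost s (Op Less (V ''x'') (V ''X''))"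
| "draw_time s (r # rs) =
     (let s1 = update s ''rnd'' (s ''x'' 0) r
      in 2 + expr_cost s (Op Less (V ''x'') (V ''X''))
        + (expr_cost s (V ''x'') + expr_cost s (V ''Q'') + bits (s ''x'' 0) + bits (s ''Q'' 0))
        + (expr_cost s1 (Const 0) + expr_cost s1 (V ''x'' \<oplus> Const 1) + bits 0 + bits (s ''x'' 0 + 1))
        + draw_time (update s1 ''x'' 0 (s ''x'' 0 + 1)) rs)"

text \<open>Each number takes four steps: loop test, sequencing, draw and increment; the last step
  is the failing test. Since all outcomes take equally many steps, one equation for
  \<open>steps\<close> describes the whole distribution.\<close>

lemma steps_draw:
  assumes "s ''X'' 0 = s ''x'' 0 + m" "s ''Q'' 0 = Q" "0 < Q"
  shows "steps q (4 * m + 1) (draw # K, s, t) =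
    map_pmf (\<lambda>\<omega>. (K, drawn s \<omega>, t + draw_time s \<omega>)) (replicate_pmf m (pmf_of_set {1..Q}))"
  using assms
proof (induction m arbitrary: s t)
  case 0
  then show ?case by (simp add: draw_def bind_return_pmf bind_return_pmf')
next
  case (Suc m)
  let ?U = "pmf_of_set {1..Q}"
  let ?s1 = "\<lambda>r. update s ''rnd'' (s ''x'' 0) r"
  let ?s2 = "\<lambda>r. update (?s1 r) ''x'' 0 (s ''x'' 0 + 1)"
  let ?t1 = "t + 1 + expr_cost s (Op Less (V ''x'') (V ''X'')) + 1"
  let ?t2 = "?t1 + expr_cost s (V ''x'') + expr_cost s (V ''Q'') + bits (s ''x'' 0) + bits (s ''Q'' 0)"
  let ?t3 = "\<lambda>r. ?t2 + expr_cost (?s1 r) (Const 0) + expr_cost (?s1 r) (V ''x'' \<oplus> Const 1) + bits 0 + bits (s ''x'' 0 + 1)"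
  have cnt: "4 * Suc m + 1 = Suc (Suc (Suc (Suc (4 * m + 1))))" by simp
  have st1: "step q (draw # K, s, t) = return_pmf (draw_body # draw # K, s, t + 1 + expr_cost s (Op Less (V ''x'') (V ''X'')))"
    using Suc.prems by (simp add: draw_def)
  have st2: "step q (draw_body # draw # K, s, t') =
     return_pmf (Random ''rnd'' (V ''x'') (V ''Q'') # Assign ''x'' (V ''x'' \<oplus> Const 1) # draw # K, s, t' + 1)" for t'
    by (simp add: draw_body_def)
  have st3: "step q (Random ''rnd'' (V ''x'') (V ''Q'') # K', s, t') =
     map_pmf (\<lambda>r. (K', ?s1 r, t' + expr_cost s (V ''x'') + expr_cost s (V ''Q'') + bits (s ''x'' 0) + bits (s ''Q'' 0))) ?U" for t' K'
    using Suc.prems by simp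
  have st4: "step q (Assign ''x'' (V ''x'' \<oplus> Const 1) # K', ?s1 r, t') =
     return_pmf (K', ?s2 r, t' + expr_cost (?s1 r) (Const 0) + expr_cost (?s1 r) (V ''x'' \<oplus> Const 1)
        + bits 0 + bits (s ''x'' 0 + 1))" for t' K' r
    by (simp add: update_def)
  have "steps q (4 * Suc m + 1) (draw # K, s, t) = bind_pmf ?U (\<lambda>r. steps q (4 * m + 1) (draw # K, ?s2 r, ?t3 r))"
    unfolding cnt steps.simps(2) st1 st2 st3 bind_return_pmf bind_map_pmf st4 ..
  also have "\<dots> = bind_pmf ?U (\<lambda>r. map_pmf (\<lambda>\<omega>. (K, drawn (?s2 r) \<omega>, ?t3 r + draw_time (?s2 r) \<omega>)) (replicate_pmf m ?U))"
    by (intro bind_pmf_cong refl Suc.IH) (use Suc.prems in \<open>simp_all add: update_def\<close>)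
  also have "\<dots> = map_pmf (\<lambda>\<omega>. (K, drawn s \<omega>, t + draw_time s \<omega>)) (replicate_pmf (Suc m) ?U)"
    by (simp add: map_bind_pmf map_pmf_def bind_assoc_pmf bind_return_pmf Let_def add.assoc)
  finally show ?case .
qed

lemma drawn_props:
  "bounded_store b s \<Longrightarrow> (\<forall>r\<in>set \<omega>. r < 2 ^ b) \<Longrightarrow> s ''x'' 0 + length \<omega> < 2 ^ b \<Longrightarrow>
    bounded_store b (drawn s \<omega>) \<and> (\<forall>a. a \<notin> {''rnd'', ''x''} \<longrightarrow> drawn s \<omega> a = s a) \<and>
    (\<forall>i<length \<omega>. drawn s \<omega> ''rnd'' (s ''x'' 0 + i) = \<omega> ! i) \<and>
    (\<forall>i<s ''x'' 0. drawn s \<omega> ''rnd'' i = s ''rnd'' i)"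
proof (induction \<omega> arbitrary: s)
  case (Cons r rs)
  let ?s = "update (update s ''rnd'' (s ''x'' 0) r) ''x'' 0 (s ''x'' 0 + 1)"
  have x: "?s ''x'' 0 = s ''x'' 0 + 1" by (simp add: update_def)
  have "bounded_store b ?s" using Cons.prems by (auto simp: update_def bounded_store_def)
  then have IH: "bounded_store b (drawn ?s rs)" "\<forall>a. a \<notin> {''rnd'', ''x''} \<longrightarrow> drawn ?s rs a = ?s a"
    "\<forall>i<length rs. drawn ?s rs ''rnd'' (s ''x'' 0 + 1 + i) = rs ! i"
    "\<forall>i<s ''x'' 0 + 1. drawn ?s rs ''rnd'' i = ?s ''rnd'' i"
    using Cons.IH[of ?s] Cons.prems x by auto
  have "drawn s (r # rs) ''rnd'' (s ''x'' 0 + i) = (r # rs) ! i" if "i < Suc (length rs)" for i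
  proof (cases i)
    case 0
    then show ?thesis using IH(4) by (simp add: update_def)
  next
    case (Suc j)
    then show ?thesis using IH(3) that by simp
  qed
  moreover have "drawn s (r # rs) ''rnd'' i = s ''rnd'' i" if "i < s ''x'' 0" for i
    using IH(4) that by (simp add: update_def)
  moreover have "drawn s (r # rs) a = s a" if "a \<notin> {''rnd'', ''x''}" for a
    using IH(2) that by (simp add: update_def)
  ultimately show ?case using IH(1) by simp
qed simp

lemma draw_time_le:
  assumes "0 < b"
  shows "bounded_store b s \<Longrightarrow> (\<forall>r\<in>set \<omega>. r < 2 ^ b) \<Longrightarrow> s ''x'' 0 + length \<omega> < 2 ^ b \<Longrightarrow>
    draw_time s \<omega> \<le> (4 * length \<omega> + 1) * (com_weight draw * b)"
proof (induction \<omega> arbitrary: s)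
  case Nil
  have "expr_cost s (Op Less (V ''x'') (V ''X'')) \<le> expr_weight (Op Less (V ''x'') (V ''X'')) * b"
    by (rule expr_cost_le[OF Nil.prems(1) assms])
  then show ?case using assms by (simp add: draw_def draw_body_def algebra_simps)
next
  case (Cons r rs)
  let ?s1 = "update s ''rnd'' (s ''x'' 0) r"
  let ?s = "update ?s1 ''x'' 0 (s ''x'' 0 + 1)"
  let ?w = "com_weight draw * b"
  have bs1: "bounded_store b ?s1" using Cons.prems by (auto simp: update_def bounded_store_def)
  have bs: "bounded_store b ?s" using Cons.prems by (auto simp: update_def bounded_store_def)
  have IH: "draw_time ?s rs \<le> (4 * length rs + 1) * ?w"
  proof -
    have "?s ''x'' 0 = s ''x'' 0 + 1" by (simp add: update_def)
    then show ?thesis using Cons.IH[OF bs] Cons.prems by simp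
  qed
  note c = expr_cost_le[OF Cons.prems(1) assms] and c1 = expr_cost_le[OF bs1 assms]
    and v = bits_evaluate_le[OF Cons.prems(1) assms] and v1 = bits_evaluate_le[OF bs1 assms]
  have ev: "evaluate ?s1 (V ''x'' \<oplus> Const 1) = s ''x'' 0 + 1" by (simp add: update_def)
  have w: "2 + expr_cost s (Op Less (V ''x'') (V ''X''))
        + (expr_cost s (V ''x'') + expr_cost s (V ''Q'') + bits (s ''x'' 0) + bits (s ''Q'' 0))
        + (expr_cost ?s1 (Const 0) + expr_cost ?s1 (V ''x'' \<oplus> Const 1) + bits 0 + bits (s ''x'' 0 + 1)) \<le> 4 * ?w"
    using c[of "Op Less (V ''x'') (V ''X'')"] c[of "V ''x''"] c[of "V ''Q''"] c1[of "Const 0"]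
      c1[of "V ''x'' \<oplus> Const 1"] v[of "V ''x''"] v[of "V ''Q''"] v1[of "Const 0"] v1[of "V ''x'' \<oplus> Const 1"] assms
    unfolding ev by (simp add: draw_def draw_body_def del: expr_cost.simps)
  have "draw_time s (r # rs) \<le> 4 * ?w + (4 * length rs + 1) * ?w"
    using w IH by (simp only: draw_time.simps Let_def)
  also have "\<dots> = (4 * length (r # rs) + 1) * ?w" by (simp add: algebra_simps)
  finally show ?case .
qed

subsection \<open>Output and running time\<close>

lemma steps_terminal: "steps q k ([], s, t) = return_pmf ([], s, t)"
  by (induction k) (auto simp: bind_return_pmf)

lemma steps_all_terminal:
  assumes "\<forall>C\<in>set_pmf (steps q k C0). terminal C"
  shows "steps q (k + j) C0 = steps q k C0"
proof -
  have "steps q (k + j) C0 = bind_pmf (steps q k C0) (steps q j)" by (rule steps_add)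
  also have "\<dots> = bind_pmf (steps q k C0) return_pmf"
    using assms by (intro bind_pmf_cong refl) (auto simp: terminal_def steps_terminal)
  finally show ?thesis by (simp add: bind_return_pmf')
qed

text \<open>The least sufficient number of steps may be smaller than \<open>N\<close>, but terminal
  configurations stay as they are, so both give the same distribution.\<close>

lemma final_store_eq:
  assumes "steps q N ([P], s, 0) = map_pmf (\<lambda>\<omega>. ([], f \<omega>, \<tau> \<omega>)) D"
  shows "final_store P q s = map_pmf f D"
proof -
  let ?T = "\<lambda>k. \<forall>C\<in>set_pmf (steps q k ([P], s, 0)). terminal C"
  have N: "?T N" unfolding assms by (auto simp: terminal_def)
  define k where "k = (LEAST k. ?T k)"
  have k: "?T k" "k \<le> N" unfolding k_def by (rule LeastI[of ?T, OF N], rule Least_le[of ?T, OF N])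
  have "steps q k ([P], s, 0) = steps q N ([P], s, 0)"
    using steps_all_terminal[OF k(1), of "N - k"] k(2) by simp
  then show ?thesis
    unfolding final_store_def Let_def k_def[symmetric] by (simp add: assms pmf.map_comp o_def)
qed

lemma runs_in_time_eq:
  assumes "steps q N ([P], s, 0) = map_pmf (\<lambda>\<omega>. ([], f \<omega>, \<tau> \<omega>)) D"
    and "\<And>\<omega>. \<omega> \<in> set_pmf D \<Longrightarrow> real (\<tau> \<omega>) \<le> T"
  shows "runs_in_time P q s T"
  unfolding runs_in_time_def
  by (rule exI[of _ N]) (use assms in \<open>auto simp: terminal_def time_def\<close>)

definition main_program :: com where
  "main_program = (initialise ;; (draw ;; run_trials))"

definition program :: com where
  "program = If (Op Less (Const 1) (V ''n'')) (If (V ''d'') main_program Skip) Skip"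

context minimal_tester begin

definition total_cost :: nat where
  "total_cost = init_cost + (4 * (trials * block) + 1) + run_cost + 4"

text \<open>Initialisation does not depend on chance, drawing has a fixed number of steps, and for
  each list drawn the trials are deterministic. So the final store is a function \<open>f\<close> of
  the list.\<close>

lemma program_steps:
  assumes s: "bounded_store b s" "s ''n'' 0 = n" "s ''d'' 0 = d" "s ''inv_eps'' 0 = e"
      "s ''reject'' = (\<lambda>i. 0)" "s ''slot'' = (\<lambda>i. 0)"
    and b: "init_bits b" "enough_bits b" "0 < b" and n2: "1 < n"
  shows "\<exists>N f \<tau>. steps answer N ([program], s, 0) =
      map_pmf (\<lambda>\<omega>. ([], f \<omega>, \<tau> \<omega>)) (replicate_pmf (trials * block) sample) \<and>
    (\<forall>\<omega>\<in>set_pmf (replicate_pmf (trials * block) sample).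
       run_inv \<omega> trials (f \<omega>) \<and> \<tau> \<omega> \<le> total_cost * (com_weight program * b))"
proof -
  let ?X = "trials * block" and ?D = "replicate_pmf (trials * block) sample" and ?w = "com_weight program * b"
  have weights: "com_weight initialise * b \<le> ?w" "com_weight draw * b \<le> ?w" "com_weight run_trials * b \<le> ?w"
    by (intro mult_le_mono1; simp add: program_def main_program_def)+
  have "wp answer b initialise s 0 (\<lambda>s' k'. parameters_set s' \<and> k' \<le> init_cost)"
    by (rule wp_initialise[OF s b(1)]) simp
  from wp_sound[OF this s(1) b(3)] obtain N1 s1 where
    1: "runs answer (com_weight initialise * b) initialise s N1 s1" "bounded_store b s1" "parameters_set s1" "N1 \<le> init_cost"
    by auto
  obtain t1 where t1: "t1 \<le> N1 * ?w" "\<And>K t. steps answer N1 (initialise # K, s, t) = return_pmf (K, s1, t + t1)"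
    by (rule runsE[OF 1(1) weights(1)]) blast
  have x: "s1 ''X'' 0 = s1 ''x'' 0 + ?X" "s1 ''Q'' 0 = range_size" "s1 ''x'' 0 = 0"
    using 1(3) by (auto simp: parameters_set_def)
  note draw_steps = steps_draw[where s = s1 and m = "trials * block" and Q = range_size, OF x(1) x(2) range_size_pos, folded sample_def]
  have range_b: "range_size < 2 ^ b" "?X < 2 ^ b" using b(1) unfolding init_bits_def by blast+
  have drawn: "bounded_store b (drawn s1 \<omega>) \<and> environment \<omega> (drawn s1 \<omega>) \<and>
      drawn s1 \<omega> ''reject'' 0 = 0 \<and> drawn s1 \<omega> ''slot'' = (\<lambda>i. 0) \<and> draw_time s1 \<omega> \<le> (4 * ?X + 1) * ?w"
    if \<omega>: "\<omega> \<in> set_pmf ?D" for \<omega>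
  proof -
    have l: "length \<omega> = ?X" and small: "\<forall>r\<in>set \<omega>. r < 2 ^ b"
      using \<omega> range_b range_size_pos by (auto simp: set_replicate_pmf sample_def in_lists_conv_set)
    have xl: "s1 ''x'' 0 + length \<omega> < 2 ^ b" using x(3) l range_b by simp
    note p = drawn_props[OF 1(2) small xl]
    have "environment \<omega> (drawn s1 \<omega>)" using p 1(3) l x(3) by (simp add: environment_def parameters_set_def)
    moreover have "draw_time s1 \<omega> \<le> (4 * ?X + 1) * (com_weight draw * b)"
      using draw_time_le[OF b(3) 1(2) small xl] l by simp
    then have "draw_time s1 \<omega> \<le> (4 * ?X + 1) * ?w"
      by (rule order_trans) (intro mult_le_mono2 weights)
    ultimately show ?thesis using p 1(3) by (simp add: parameters_set_def)
  qed
  have "\<exists>s2 t2. steps answer run_cost ([run_trials], drawn s1 \<omega>, t) = return_pmf ([], s2, t + t2) \<and>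
      run_inv \<omega> trials s2 \<and> t2 \<le> run_cost * ?w" if \<omega>: "\<omega> \<in> set_pmf ?D" for \<omega> t
  proof -
    note d = drawn[OF \<omega>]
    have "wp answer b run_trials (drawn s1 \<omega>) 0 (\<lambda>s' k'. run_inv \<omega> trials s' \<and> k' \<le> run_cost)"
      by (rule wp_run_trials[of \<omega>]) (use d b(2) in auto)
    from wp_sound[OF this _ b(3)] d obtain N2 s2 where
      2: "runs answer (com_weight run_trials * b) run_trials (drawn s1 \<omega>) N2 s2" "run_inv \<omega> trials s2" "N2 \<le> run_cost"
      by auto
    obtain t2 where t2: "t2 \<le> N2 * ?w"
      "\<And>K t. steps answer N2 (run_trials # K, drawn s1 \<omega>, t) = return_pmf (K, s2, t + t2)"
      by (rule runsE[OF 2(1) weights(3)]) blast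
    \<comment> \<open>The number of steps depends on the list; idling in the terminal configuration
      pads it to the common bound \<open>run_cost\<close>.\<close>
    have "steps answer (N2 + (run_cost - N2)) ([run_trials], drawn s1 \<omega>, t) = return_pmf ([], s2, t + t2)"
      unfolding steps_add t2(2) by (simp add: bind_return_pmf steps_terminal)
    moreover have "t2 \<le> run_cost * ?w" using t2(1) mult_le_mono1[OF 2(3), of ?w] by linarith
    ultimately show ?thesis using 2 by auto
  qed
  define t0 where "t0 = 1 + expr_cost s (Op Less (Const 1) (V ''n'')) + 1 + expr_cost s (V ''d'') + 1"
  let ?t = "\<lambda>\<omega>. t0 + t1 + 1 + draw_time s1 \<omega>"
  have "\<forall>\<omega>. \<exists>s2 t2. \<omega> \<in> set_pmf ?D \<longrightarrow>
      steps answer run_cost ([run_trials], drawn s1 \<omega>, ?t \<omega>) = return_pmf ([], s2, ?t \<omega> + t2) \<and>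
      run_inv \<omega> trials s2 \<and> t2 \<le> run_cost * ?w"
    using \<open>\<And>t \<omega>. \<omega> \<in> set_pmf ?D \<Longrightarrow> \<exists>s2 t2. steps answer run_cost ([run_trials], drawn s1 \<omega>, t) = return_pmf ([], s2, t + t2) \<and>
      run_inv \<omega> trials s2 \<and> t2 \<le> run_cost * ?w\<close> by blast
  then obtain f t2 where f: "\<And>\<omega>. \<omega> \<in> set_pmf ?D \<Longrightarrow>
      steps answer run_cost ([run_trials], drawn s1 \<omega>, ?t \<omega>) = return_pmf ([], f \<omega>, ?t \<omega> + t2 \<omega>) \<and>
      run_inv \<omega> trials (f \<omega>) \<and> t2 \<omega> \<le> run_cost * ?w" by metis
  have begin_steps: "steps answer 3 ([program], s, 0) = return_pmf ([initialise, draw ;; run_trials], s, t0)"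
    using s n2 d_pos
    by (simp add: program_def main_program_def numeral_3_eq_3 bind_return_pmf bind_return_pmf' t0_def)
  have mid: "steps answer 1 ([draw ;; run_trials], s', t') = return_pmf ([draw, run_trials], s', t' + 1)" for s' t'
    by (simp add: bind_return_pmf bind_return_pmf')
  have "steps answer (3 + (N1 + (1 + ((4 * ?X + 1) + run_cost)))) ([program], s, 0) =
      bind_pmf ?D (\<lambda>\<omega>. steps answer run_cost ([run_trials], drawn s1 \<omega>, ?t \<omega>))"
    unfolding steps_add[of _ 3] begin_steps bind_return_pmf
    unfolding steps_add[of _ N1] t1(2) bind_return_pmf
    unfolding steps_add[of _ 1] mid bind_return_pmf
    unfolding steps_add[of _ "4 * ?X + 1"] draw_steps bind_map_pmf ..
  also have "\<dots> = bind_pmf ?D (\<lambda>\<omega>. return_pmf ([], f \<omega>, ?t \<omega> + t2 \<omega>))"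
    using f by (intro bind_pmf_cong refl) blast
  also have "\<dots> = map_pmf (\<lambda>\<omega>. ([], f \<omega>, ?t \<omega> + t2 \<omega>)) ?D" by (simp add: map_pmf_def)
  finally have st: "steps answer (3 + (N1 + (1 + ((4 * ?X + 1) + run_cost)))) ([program], s, 0) =
      map_pmf (\<lambda>\<omega>. ([], f \<omega>, ?t \<omega> + t2 \<omega>)) ?D" .
  have t0: "t0 \<le> 3 * ?w"
  proof -
    have "t0 \<le> (3 + expr_weight (Op Less (Const 1) (V ''n'')) + expr_weight (V ''d'')) * b"
      using expr_cost_le[OF s(1) b(3), of "Op Less (Const 1) (V ''n'')"] expr_cost_le[OF s(1) b(3), of "V ''d''"] b(3)
      unfolding t0_def add_mult_distrib by linarith
    also have "\<dots> \<le> (3 * com_weight program) * b"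
      by (intro mult_le_mono1) (simp add: program_def)
    finally show ?thesis by simp
  qed
  have "?t \<omega> + t2 \<omega> \<le> total_cost * ?w" if "\<omega> \<in> set_pmf ?D" for \<omega>
  proof -
    have "1 \<le> ?w" using b(3) by (simp add: program_def)
    moreover have "N1 * ?w \<le> init_cost * ?w" using 1(4) by (rule mult_le_mono1)
    moreover have "total_cost * ?w = init_cost * ?w + (4 * ?X + 1) * ?w + run_cost * ?w + 4 * ?w"
      unfolding total_cost_def add_mult_distrib by simp
    ultimately show ?thesis using t0 t1(1) drawn[OF that] f[OF that] by linarith
  qed
  then have "\<forall>\<omega>\<in>set_pmf ?D. run_inv \<omega> trials (f \<omega>) \<and> ?t \<omega> + t2 \<omega> \<le> total_cost * ?w" using f by simp
  then show ?thesis
    by (intro exI[of _ "3 + (N1 + (1 + ((4 * ?X + 1) + run_cost)))"] exI[of _ f] exI[of _ "\<lambda>\<omega>. ?t \<omega> + t2 \<omega>"] conjI st)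
qed

end

subsection \<open>Polynomial bounds\<close>

text \<open>The exponent \<open>i\<close> counts the leaves of an arithmetic expression whose leaves are at most \<open>w\<close>.\<close>

definition poly_le :: "nat \<Rightarrow> nat \<Rightarrow> nat \<Rightarrow> nat \<Rightarrow> bool" where
  "poly_le c w i a \<longleftrightarrow> a \<le> c * w ^ i \<and> 0 < i \<and> 2 \<le> w \<and> 1 \<le> c"

lemma poly_le_leaf: "a \<le> w \<Longrightarrow> 2 \<le> w \<Longrightarrow> 1 \<le> c \<Longrightarrow> poly_le c w 1 a"
proof -
  assume "a \<le> w" "2 \<le> w" "1 \<le> c"
  moreover from this have "1 * w \<le> c * w" by (intro mult_le_mono1)
  ultimately show "poly_le c w 1 a" unfolding poly_le_def power_one_right by linarith
qed

lemma poly_le_scale: "2 \<le> w \<Longrightarrow> 1 \<le> c \<Longrightarrow> poly_le c w 1 c"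
  unfolding poly_le_def by simp

text \<open>Both powers are at least 2, so their sum is at most their product; this is why exponents
  add up even for sums.\<close>

lemma poly_le_add:
  assumes "poly_le c w i a" "poly_le c w j b"
  shows "poly_le c w (i + j) (a + b)"
proof -
  have w: "2 \<le> w" "0 < i" "0 < j" "1 \<le> c" using assms by (auto simp: poly_le_def)
  have "2 \<le> w ^ i" "2 \<le> w ^ j"
    using w self_le_power[of w i] self_le_power[of w j] by linarith+
  then have "w ^ i + w ^ j \<le> w ^ i * w ^ j"
    by (metis add_mono mult_2 mult_2_right mult_le_mono1 mult_le_mono2 nat_le_linear order_trans)
  then have "c * (w ^ i + w ^ j) \<le> c * w ^ (i + j)" unfolding power_add by (rule mult_le_mono2)
  then show ?thesis using assms by (auto simp: poly_le_def algebra_simps)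
qed

text \<open>Only one factor may carry the coefficient \<open>c\<close>. With \<open>c = sq\<close>
  this keeps the total cost linear in \<open>sq\<close>, hence in the square root of
  \<open>n\<close>.\<close>

lemma poly_le_mult:
  assumes "poly_le c w i a" "poly_le 1 w j b"
  shows "poly_le c w (i + j) (a * b)"
  using assms mult_le_mono[of a "c * w ^ i" b "w ^ j"] by (auto simp: poly_le_def power_add mult.assoc)

lemma poly_le_mult':
  assumes "poly_le 1 w i a" "poly_le c w j b"
  shows "poly_le c w (i + j) (a * b)"
  using poly_le_mult[OF assms(2,1)] by (simp add: ac_simps)

lemma poly_le_weaken: "poly_le 1 w i a \<Longrightarrow> 1 \<le> c \<Longrightarrow> poly_le c w i a"
proof -
  assume "poly_le 1 w i a" "1 \<le> c"
  moreover from this have "1 * w ^ i \<le> c * w ^ i" by (intro mult_le_mono1)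
  ultimately show "poly_le c w i a" unfolding poly_le_def by linarith
qed

lemma poly_le_cast: "poly_le c w i a \<Longrightarrow> i \<le> j \<Longrightarrow> poly_le c w j a"
proof -
  assume *: "poly_le c w i a" "i \<le> j"
  then have "c * w ^ i \<le> c * w ^ j" by (intro mult_le_mono2 power_increasing) (auto simp: poly_le_def)
  then show "poly_le c w j a" using * unfolding poly_le_def by linarith
qed

lemma poly_le_less_power:
  assumes "poly_le c w i a" "c \<le> 2 ^ w" "w * (i + 1) < b"
  shows "a < 2 ^ b"
proof -
  have "w < 2 ^ w" by (rule less_exp)
  then have "w ^ i \<le> (2 ^ w) ^ i" by (intro power_mono) auto
  then have "c * w ^ i \<le> 2 ^ w * (2 ^ w) ^ i" using assms(2) by (intro mult_le_mono) auto
  also have "\<dots> = 2 ^ (w * (i + 1))" by (simp add: power_mult power_add)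
  also have "\<dots> < 2 ^ b" using assms(3) by (intro power_strict_increasing) auto
  finally show ?thesis using assms(1) by (auto simp: poly_le_def)
qed

context minimal_tester begin

text \<open>A quantity of degree at most 100 in \<open>w\<close>, even with the coefficient
  \<open>sq\<close>, has at most \<open>101 * w\<close> digits. The summand \<open>w * w\<close> is
  for \<open>range_size\<close>, since \<open>fact d\<close> is at most \<open>w ^ w\<close>.
  Because \<open>w\<close> is at least 4096, all numerals that occur count as leaves.\<close>

lemma bounds:
  assumes w: "d \<le> w" "e \<le> w" "lg \<le> w" "sj \<le> w" "4096 \<le> w"
  shows "init_bits (200 * w + w * w)" "enough_bits (200 * w + w * w)"
    "total_cost \<le> sq * w ^ 115" "n < 2 ^ (200 * w + w * w)" "d < 2 ^ (200 * w + w * w)" "e < 2 ^ (200 * w + w * w)"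
proof -
  let ?b = "200 * w + w * w"
  have w2: "2 \<le> w" using w by simp
  have sq1: "1 \<le> sq" using sq_pos by simp
  have sqw: "sq \<le> 2 ^ w" unfolding sq_eq using w by (intro power_increasing) auto
  have c: "poly_le 1 w 1 a" if "a \<le> w" for a using poly_le_leaf[OF that w2] by simp
  note leaf = c[OF w(1)] c[OF w(2)] c[OF w(3)] c[OF w(4)]
  have k: "poly_le 1 w 1 (numeral v)" if "numeral v \<le> (4096::nat)" for v
    by (rule c) (use that w in linarith)
  have k1: "poly_le 1 w 1 1" by (rule c) (use w in simp)
  note up = poly_le_weaken[OF _ sq1]
  have len: "poly_le 1 w 5 len"
  proof -
    have "poly_le 1 w (1 + 1 + (1 + 1 + 1)) (4 * e * (6 + e + lg))"
      by (intro poly_le_mult poly_le_add leaf k) simp_all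
    then show ?thesis unfolding len_def lightness_def by (rule poly_le_cast) simp
  qed
  have budget: "poly_le 1 w 7 budget"
  proof -
    have "poly_le 1 w (1 + 1 + 5) (16 * e * len)" by (intro poly_le_mult leaf k len) simp_all
    then show ?thesis unfolding budget_def by (rule poly_le_cast) simp
  qed
  have half: "poly_le sq w 3 half"
  proof -
    have "poly_le sq w (1 + 1 + 1) (512 * e * sq)"
      by (intro poly_le_mult' poly_le_mult leaf k poly_le_scale w2 sq1) simp_all
    then show ?thesis unfolding half_def by (rule poly_le_cast) simp
  qed
  have walks: "poly_le sq w 6 walks"
    unfolding walks_def by (rule poly_le_cast[OF poly_le_add[OF half half]]) simp
  have trials: "poly_le 1 w 2 trials"
    unfolding trials_def by (rule poly_le_cast[OF poly_le_mult[OF k leaf(2)]]) simp_all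
  have block: "poly_le sq w 12 block"
    unfolding block_def by (rule poly_le_cast[OF poly_le_add[OF up[OF k1] poly_le_mult[OF walks len]]]) simp
  have X: "poly_le sq w 14 (trials * block)"
    by (rule poly_le_cast[OF poly_le_mult'[OF trials block]]) simp
  have K: "poly_le 1 w 7 (2 * len + 3)"
    by (rule poly_le_cast[OF poly_le_add[OF poly_le_mult[OF k len] k]]) simp_all
  have repeat: "poly_le 1 w 25 (repeat_cost (2 * len + 3))"
  proof -
    have "poly_le 1 w (7 + (7 + (1 + 7 + 1) + 1) + 1)
        ((2 * len + 3) * ((2 * len + 3) * (4 * (2 * len + 3) + 20) + 6) + 3)"
      by (intro poly_le_mult poly_le_add K k) simp_all
    then show ?thesis unfolding repeat_cost_def by (rule poly_le_cast) simp
  qed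
  have compare: "poly_le 1 w 41 (compare_cost len)"
  proof -
    have "poly_le 1 w (5 + 1 + (7 + 1 + 25 + 1) + 1)
        ((len + 1) * ((2 * len + 3) * 5 + repeat_cost (2 * len + 3) + 30) + 3)"
      by (intro poly_le_mult poly_le_add K k k1 len repeat) simp_all
    then show ?thesis unfolding compare_cost_def by (rule poly_le_cast) simp
  qed
  have walk: "poly_le 1 w 60 walk_cost"
  proof -
    have "poly_le 1 w (5 + (1 + (7 + (1 + 1 + 1) + 1) + 1) + 41 + 1)
        (len * (d * (budget * (d * 15 + 10) + 30) + 20) + compare_cost len + 35)"
      by (intro poly_le_mult poly_le_add k leaf len budget compare) simp_all
    then show ?thesis unfolding walk_cost_def by (rule poly_le_cast) simp
  qed
  have trial: "poly_le sq w 68 trial_cost"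
  proof -
    have "poly_le sq w (6 + (60 + 1) + 1) (walks * (walk_cost + 3) + 15)"
      by (intro poly_le_add[of sq] poly_le_mult[OF walks] poly_le_add walk k up[OF k]) simp_all
    then show ?thesis unfolding trial_cost_def by (rule poly_le_cast) simp
  qed
  have run: "poly_le sq w 72 run_cost"
  proof -
    have "poly_le sq w (2 + (68 + 1) + 1) (trials * (trial_cost + 3) + 3)"
      by (intro poly_le_add[of sq] poly_le_mult'[OF trials] trial up[OF k]) simp_all
    then show ?thesis unfolding run_cost_def by (rule poly_le_cast) simp
  qed
  have init: "poly_le 1 w 7 init_cost"
  proof -
    have "poly_le 1 w (1 + 1 + (1 + 1) + (1 + 1) + 1) (lg * 6 + sj * 2 + d * 4 + 40)"
      by (intro poly_le_mult poly_le_add k leaf) simp_all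
    then show ?thesis unfolding init_cost_def by (rule poly_le_cast) simp
  qed
  have total: "poly_le sq w (7 + (1 + 14 + 1) + 72 + 1) total_cost"
    unfolding total_cost_def
    by (intro poly_le_add up[OF init] up[OF k1] poly_le_mult'[OF k X] run up[OF k]) simp_all
  then have "total_cost \<le> sq * w ^ 96" by (simp add: poly_le_def)
  also have "\<dots> \<le> sq * w ^ 115" using w2 by (intro mult_le_mono2 power_increasing) auto
  finally show "total_cost \<le> sq * w ^ 115" .
  have lt: "a < 2 ^ ?b" if "poly_le sq w i a" "i \<le> 100" for a i
  proof (rule poly_le_less_power[OF that(1) sqw])
    have "w * (i + 1) \<le> w * 101" using that(2) by (intro mult_le_mono2) simp
    also have "\<dots> < ?b" using w2 by simp
    finally show "w * (i + 1) < ?b" .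
  qed
  have lt1: "a < 2 ^ ?b" if "poly_le 1 w i a" "i \<le> 100" for a i
    by (rule lt[OF up[OF that(1)] that(2)])
  have "(2::nat) ^ lg \<le> 2 ^ w" using w by (intro power_increasing) auto
  then have nw: "n \<le> 2 ^ w" using lg by (rule order_trans[rotated])
  have n2: "2 * n < 2 ^ ?b"
  proof -
    have "2 * n \<le> 2 ^ (w + 1)" using nw by simp
    also have "\<dots> < 2 ^ ?b" using w2 by (intro power_strict_increasing) auto
    finally show ?thesis .
  qed
  then show n_b: "n < 2 ^ ?b" by simp
  show d_b: "d < 2 ^ ?b" "e < 2 ^ ?b" by (rule lt1[OF leaf(1)], simp, rule lt1[OF leaf(2)], simp)
  have range: "range_size < 2 ^ ?b"
  proof -
    have "fact d \<le> d ^ d" using fact_le_power[of d, where 'a = nat] by simp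
    also have "\<dots> \<le> w ^ w" using w(1) w2 by (intro order_trans[OF power_mono power_increasing]) auto
    also have "\<dots> \<le> (2 ^ w) ^ w" using less_exp[of w] by (intro power_mono) auto
    finally have "range_size \<le> 2 ^ w * (2 ^ w) ^ w" unfolding range_size_def using nw by (intro mult_le_mono) auto
    also have "\<dots> = 2 ^ (w + w * w)" by (simp add: power_add power_mult)
    also have "\<dots> < 2 ^ ?b" using w2 by (intro power_strict_increasing) auto
    finally show ?thesis .
  qed
  show "init_bits ?b"
    unfolding init_bits_def
  proof (intro conjI)
    show "2 * n < 2 ^ ?b" "d < 2 ^ ?b" "range_size < 2 ^ ?b" by (fact n2 d_b range)+
    show "lg < 2 ^ ?b" by (rule lt1[OF leaf(3)]) simp
    show "sq < 2 ^ ?b" by (rule lt[OF poly_le_scale[OF w2 sq1]]) simp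
    show "len < 2 ^ ?b" by (rule lt1[OF len]) simp
    show "budget < 2 ^ ?b" by (rule lt1[OF budget]) simp
    show "half < 2 ^ ?b" by (rule lt[OF half]) simp
    show "walks < 2 ^ ?b" by (rule lt[OF walks]) simp
    show "trials < 2 ^ ?b" by (rule lt1[OF trials]) simp
    show "block < 2 ^ ?b" by (rule lt[OF block]) simp
    show "trials * block < 2 ^ ?b" by (rule lt[OF X]) simp
  qed
  show "enough_bits ?b"
    unfolding enough_bits_def
  proof (intro conjI)
    have "poly_le 1 w (1 + (7 + 1) + 1 + 7) (1 + budget * d + d + budget)"
      by (intro poly_le_mult poly_le_add k1 leaf budget)
    then show "1 + budget * d + d + budget < 2 ^ ?b" by (rule lt1) simp
    show "n < 2 ^ ?b" by (rule n_b)
    have "poly_le 1 w (1 + 5 + 1) (2 * len + 5)" by (intro poly_le_mult poly_le_add k len) simp_all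
    then show "2 * len + 5 < 2 ^ ?b" by (rule lt1) simp
    have "poly_le sq w (2 + 6 + 1 + (5 + 1)) ((trials * walks + 2) * (len + 2))"
      by (intro poly_le_mult[of sq] poly_le_add[of sq] poly_le_mult'[OF trials walks] poly_le_add len k up[OF k]) simp_all
    then show "(trials * walks + 2) * (len + 2) < 2 ^ ?b" by (rule lt) simp
    have "poly_le sq w (14 + 1) (trials * block + 1)" by (intro poly_le_add X up[OF k1])
    then show "trials * block + 1 < 2 ^ ?b" by (rule lt) simp
    have n1: "n + 1 \<le> 2 ^ (w + 1)"
    proof -
      have "n + 1 \<le> 2 ^ w + 2 ^ w" by (intro add_mono nw one_le_power) simp
      then show ?thesis by simp
    qed
    have "poly_le 1 w (2 + 1) (trials + 1)" by (intro poly_le_add trials k1)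
    then have "trials + 1 \<le> w ^ 3" by (simp add: poly_le_def)
    also have "\<dots> \<le> (2 ^ w) ^ 3" using less_exp[of w] by (intro power_mono) auto
    finally have "(trials + 1) * (n + 1) \<le> (2 ^ w) ^ 3 * 2 ^ (w + 1)"
      using n1 by (rule mult_le_mono)
    also have "\<dots> = 2 ^ (w * 4 + 1)" by (simp add: power_mult[symmetric] power_add[symmetric])
    also have "\<dots> < 2 ^ ?b" using w2 by (intro power_strict_increasing) auto
    finally show "(trials + 1) * (n + 1) < 2 ^ ?b" .
  qed
qed

end

text \<open>For \<open>d = 0\<close> or \<open>n = 1\<close> the argument of the time polynomial is
  0 and only its constant term is left. Reading \<open>n\<close> must then be paid for by the factor
  \<open>sqrt (real n)\<close>.\<close>

lemma bits_le_sqrt: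
  assumes "1 \<le> n"
  shows "real (bits n) \<le> 2 * sqrt (real n)"
proof -
  have pos: "0 < floorlog 2 n" using assms by (simp add: floorlog_eq_zero_iff neq0_conv[symmetric] del: neq0_conv)
  define K where "K = floorlog 2 n - 1"
  have K: "2 ^ K \<le> n" unfolding K_def using pos by (intro floorlog_geD) auto
  have b: "bits n = K + 1" using pos by (simp add: bits_def K_def)
  let ?k = "K div 2"
  have "(2 ^ ?k)\<^sup>2 = (2::nat) ^ (?k * 2)" by (simp add: power_mult)
  also have "\<dots> \<le> 2 ^ K" by (intro power_increasing) auto
  finally have "(2 ^ ?k)\<^sup>2 \<le> n" using K by linarith
  then have "(2 ^ ?k)\<^sup>2 \<le> real n" by (metis of_nat_le_iff of_nat_numeral of_nat_power)
  then have s: "2 ^ ?k \<le> sqrt (real n)" by (rule real_le_rsqrt)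
  have "Suc ?k \<le> 2 ^ ?k" by (rule Suc_leI[OF less_exp])
  then have "real (Suc ?k) \<le> 2 ^ ?k" by (metis of_nat_le_iff of_nat_numeral of_nat_power)
  moreover have "K + 1 \<le> 2 * Suc ?k" by presburger
  then have "real (K + 1) \<le> real (2 * Suc ?k)" by (simp only: of_nat_le_iff)
  then have "real (K + 1) \<le> 2 * real (Suc ?k)" by (simp only: of_nat_mult of_nat_numeral)
  ultimately show ?thesis using s b by simp
qed

lemma tester_output_eq:
  assumes "steps (neighbour n adj) N ([P], input n d \<epsilon>, 0) = map_pmf (\<lambda>\<omega>. ([], f \<omega>, \<tau> \<omega>)) D"
  shows "tester_output P n d \<epsilon> adj = map_pmf (\<lambda>\<omega>. verdict (f \<omega>)) D"
  unfolding tester_output_def final_store_eq[OF assms] by (simp add: pmf.map_comp o_def)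

text \<open>The exponent is 115 from \<open>bounds\<close> plus 3 for the number of digits, 12288 =
  3 * 4096 comes from rounding in the choice of \<open>w\<close>, and the factor 2 from the
  overshoot of \<open>sq\<close>. The constant 20 pays for the degenerate inputs.\<close>

definition time_poly :: "real poly" where
  "time_poly = monom (real (com_weight program) * 2 * 12288 ^ 118) 118 + [:20:]"

text \<open>A certificate has at most \<open>2 * len + 3\<close> vertices, and \<open>len\<close> is
  at most 80 times the square of the argument; 2 * 80 + 3 = 163.\<close>

definition length_poly :: "real poly" where
  "length_poly = monom 163 2"

lemma trivial_steps:
  assumes "\<not> 1 < n \<or> d = 0" "1 \<le> n"
  shows "\<exists>N \<tau>. steps q N ([program], input n d \<epsilon>, 0) = map_pmf (\<lambda>_. ([], input n d \<epsilon>, \<tau>)) (return_pmf ()) \<and>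
    real \<tau> \<le> 20 * sqrt (real n)"
proof -
  let ?s = "input n d \<epsilon>"
  have s: "?s ''n'' 0 = n" "?s ''d'' 0 = d" by (auto simp: input_def)
  have b: "bits 0 \<le> 1" "bits 1 \<le> 1" by (auto intro!: bits_le)
  let ?e = "expr_cost ?s (Op Less (Const 1) (V ''n''))" and ?d = "expr_cost ?s (V ''d'')"
  have e: "?e \<le> 4 + 2 * bits n" using s b by simp
  have sq: "1 \<le> sqrt (real n)" using assms(2) by simp
  note bn = bits_le_sqrt[OF assms(2)]
  show ?thesis
  proof (cases "1 < n")
    case False
    have "steps q 2 ([program], ?s, 0) = return_pmf ([], ?s, 1 + ?e + 1)"
      using False s by (simp add: numeral_2_eq_2 program_def bind_return_pmf bind_return_pmf')
    moreover have "real (1 + ?e + 1) \<le> 20 * sqrt (real n)"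
    proof -
      have "real (1 + ?e + 1) \<le> real (6 + 2 * bits n)" using e by (intro of_nat_mono) linarith
      also have "\<dots> \<le> 20 * sqrt (real n)" using bn sq unfolding of_nat_add of_nat_mult of_nat_numeral by linarith
      finally show ?thesis .
    qed
    ultimately show ?thesis by (metis map_return_pmf)
  next
    case True
    then have d: "d = 0" using assms by simp
    have dd: "?d \<le> 3" using s d b by simp
    have "steps q 3 ([program], ?s, 0) = return_pmf ([], ?s, 1 + ?e + 1 + ?d + 1)"
      using True s d by (simp add: numeral_3_eq_3 program_def bind_return_pmf bind_return_pmf')
    moreover have "real (1 + ?e + 1 + ?d + 1) \<le> 20 * sqrt (real n)"
    proof -
      have "real (1 + ?e + 1 + ?d + 1) \<le> real (10 + 2 * bits n)" using e dd by (intro of_nat_mono) linarith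
      also have "\<dots> \<le> 20 * sqrt (real n)" using bn sq unfolding of_nat_add of_nat_mult of_nat_numeral by linarith
      finally show ?thesis .
    qed
    ultimately show ?thesis by (metis map_return_pmf)
  qed
qed

lemma forest_empty: "forest {}"
  unfolding forest_def is_cycle_def by (metis empty_iff le_trans not_numeral_le_zero not_gr_zero linorder_not_less le_zero_eq)

text \<open>With at most one vertex or degree bound 0 there are no edges, so the graph is itself a
  forest at distance 0.\<close>

lemma trivial_not_far:
  assumes "adjacency_graph n d adj E" "\<not> 1 < n \<or> d = 0" "0 < \<epsilon>"
  shows "\<not> far_from_forest n d \<epsilon> E"
proof
  interpret adjacency_graph n d adj E by fact
  assume far: "far_from_forest n d \<epsilon> E"
  have "E = {}"
  proof (rule ccontr)
    assume "E \<noteq> {}"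
    then obtain x where "x \<in> E" by blast
    then obtain u v where uv: "u \<in> vertices" "v \<in> vertices" "u \<noteq> v" "x = {u, v}" by (rule edge_cases)
    then have "1 < n" by auto
    then have "d = 0" using assms by simp
    then have "adj u = []" using length_adj[OF uv(1)] by simp
    then show False using adj_iff[OF uv(1), of v] \<open>x \<in> E\<close> uv by simp
  qed
  moreover have "simple_graph n {}" by (simp add: simple_graph_def)
  ultimately have "\<epsilon> * real n * real d < 0" using far forest_empty by (auto simp: far_from_forest_def)
  moreover have "0 \<le> \<epsilon> * real n * real d" using assms(3) by simp
  ultimately show False by simp
qed

lemma verdict_Reject:
  "verdict s = Reject c \<longleftrightarrow> s ''reject'' 0 \<noteq> 0 \<and> c = map (s ''cert'') [1..<Suc (s ''cert'' 0)]"
  by (auto simp: verdict_def)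

lemma verdict_Accept: "verdict s = Accept \<longleftrightarrow> s ''reject'' 0 = 0"
  by (auto simp: verdict_def)

lemma accepts_forest:
  assumes "\<forall>c. Reject c \<in> set_pmf D \<longrightarrow> is_cycle E c" "forest E"
  shows "measure_pmf.prob D {Accept} = 1"
proof -
  have "x = Accept" if "x \<in> set_pmf D" for x
    using assms that by (cases x) (auto simp: forest_def)
  then show ?thesis by (subst measure_pmf.prob_eq_1) (auto simp: AE_measure_pmf_iff)
qed

lemma main_case:
  fixes \<epsilon> :: real
  assumes G: "adjacency_graph n d adj E" and nd: "1 < n" "0 < d" and \<epsilon>: "0 < \<epsilon>" "\<epsilon> < 1"
  defines "x \<equiv> real d * (1 / \<epsilon>) * log 2 (real n)" and "y \<equiv> (1 / \<epsilon>) * log 2 (real n)"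
  shows "runs_in_time program (neighbour n adj) (input n d \<epsilon>) (sqrt (real n) * poly time_poly x) \<and>
    (far_from_forest n d \<epsilon> E \<longrightarrow> measure_pmf.prob (tester_output program n d \<epsilon> adj) (range Reject) \<ge> 2 / 3) \<and>
    (\<forall>c. Reject c \<in> set_pmf (tester_output program n d \<epsilon> adj) \<longrightarrow>
        is_cycle E c \<and> real (length c) \<le> poly length_poly y)"
proof -
  define e where "e = nat \<lceil>1 / \<epsilon>\<rceil>"
  define lg where "lg = (LEAST i. n \<le> 2 ^ i)"
  define sj where "sj = (LEAST i. n \<le> 2 ^ i * 2 ^ i)"
  define sq :: nat where "sq = 2 ^ sj"
  have ex: "n \<le> 2 ^ n" using less_exp[of n] by simp
  have lg: "n \<le> 2 ^ lg" unfolding lg_def by (rule LeastI[of "\<lambda>i. n \<le> 2 ^ i", OF ex])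
  have lg_min: "2 ^ i < n" if "i < lg" for i
    using not_less_Least[of i "\<lambda>i. n \<le> 2 ^ i"] that by (auto simp: lg_def)
  have lg2: "n \<le> 2 ^ lg * 2 ^ lg" using lg by (simp add: order_trans)
  have sj: "n \<le> 2 ^ sj * 2 ^ sj" "sj \<le> lg"
    unfolding sj_def by (rule LeastI[of "\<lambda>i. n \<le> 2 ^ i * 2 ^ i", OF lg2], rule Least_le, rule lg2)
  have sj_min: "2 ^ i * 2 ^ i < n" if "i < sj" for i
    using not_less_Least[of i "\<lambda>i. n \<le> 2 ^ i * 2 ^ i"] that by (auto simp: sj_def)
  have inv_pos: "1 < 1 / \<epsilon>" using \<epsilon> by simp
  have e: "1 / \<epsilon> \<le> real e" "real e \<le> 2 * (1 / \<epsilon>)" "0 < e"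
    using inv_pos unfolding e_def by linarith+
  interpret adjacency_graph n d adj E by fact
  interpret minimal_tester n d adj E e lg sq sj
    by unfold_locales (use nd e lg sj lg_min sj_min in \<open>auto simp: sq_def\<close>)

  have log1: "1 \<le> log 2 (real n)" using nd by (simp add: le_log_iff)
  have y1: "1 \<le> y" "1 / \<epsilon> \<le> y"
  proof -
    show "1 / \<epsilon> \<le> y" unfolding y_def using mult_left_mono[OF log1, of "1 / \<epsilon>"] \<epsilon> by simp
    then show "1 \<le> y" using inv_pos by linarith
  qed
  have logy: "log 2 (real n) \<le> y" unfolding y_def
    using mult_right_mono[of 1 "1 / \<epsilon>" "log 2 (real n)"] inv_pos log1 by simp
  have xy: "x = real d * y" by (simp add: x_def y_def)
  have yx: "y \<le> x" unfolding xy using mult_right_mono[of 1 "real d" y] nd y1 by simp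
  have dx: "real d \<le> x" unfolding xy using mult_left_mono[of 1 y "real d"] y1 by simp
  \<comment> \<open>By minimality \<open>lg\<close> exceeds the binary logarithm by at most 1, and
    both the logarithm and 1 are at most \<open>y\<close>.\<close>
  have lgy: "real lg \<le> 2 * y"
  proof -
    have "0 < lg" using lg nd by (cases lg) auto
    then have "2 ^ (lg - 1) < n" by (intro lg_min) simp
    then have "2 ^ (lg - 1) \<le> real n" by (metis less_imp_le of_nat_le_iff of_nat_numeral of_nat_power)
    then have "real (lg - 1) \<le> log 2 (real n)" using nd by (simp add: le_log_iff powr_realpow)
    then show ?thesis using logy log1 \<open>0 < lg\<close> by linarith
  qed
  have ey: "real e \<le> 2 * y" using e y1 by linarith
  have sqn: "real sq \<le> 2 * sqrt (real n)"
  proof (cases sj)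
    case 0
    have "1 \<le> sqrt (real n)" using nd by simp
    then have "1 \<le> 2 * sqrt (real n)" by linarith
    then show ?thesis using 0 by (simp add: sq_def)
  next
    case (Suc i)
    then have "2 ^ i * 2 ^ i < n" by (intro sj_min) simp
    then have "(2 ^ i)\<^sup>2 \<le> real n"
      by (metis less_imp_le of_nat_le_iff of_nat_numeral of_nat_power power2_eq_square)
    then have "2 ^ i \<le> sqrt (real n)" by (rule real_le_rsqrt)
    then show ?thesis using Suc by (simp add: sq_def)
  qed
  \<comment> \<open>The parameters \<open>d\<close>, \<open>e\<close>, \<open>lg\<close> and
    \<open>sj\<close> are all at most \<open>2 * x\<close>; the factor 4096 meets the premise of
    \<open>bounds\<close>.\<close>
  define w where "w = 4096 * nat \<lceil>2 * x\<rceil>"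
  have x1: "1 \<le> x" using y1 yx by linarith
  have wx: "2 * x \<le> real (nat \<lceil>2 * x\<rceil>)" "real (nat \<lceil>2 * x\<rceil>) \<le> 3 * x" using x1 by linarith+
  have ww: "2 * x \<le> real w" "real w \<le> 12288 * x" "4096 \<le> w"
  proof -
    have "real w = 4096 * real (nat \<lceil>2 * x\<rceil>)" unfolding w_def by (simp only: of_nat_mult of_nat_numeral)
    then show "2 * x \<le> real w" "real w \<le> 12288 * x" using wx x1 by linarith+
    have "1 \<le> nat \<lceil>2 * x\<rceil>" using x1 by linarith
    then show "4096 \<le> w" by (simp add: w_def)
  qed
  have small: "d \<le> w" "e \<le> w" "lg \<le> w" "sj \<le> w"
  proof -
    have "real d \<le> real w" "real e \<le> real w" and l: "real lg \<le> real w" using dx ey lgy yx ww x1 by linarith+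
    then show "d \<le> w" "e \<le> w" "lg \<le> w" by simp_all
    then show "sj \<le> w" using sj by simp
  qed
  note bnd = bounds[OF small ww(3)]
  define b where "b = 200 * w + w * w"
  have b0: "0 < b" using ww by (simp add: b_def)
  have inp: "input n d \<epsilon> ''n'' 0 = n" "input n d \<epsilon> ''d'' 0 = d" "input n d \<epsilon> ''inv_eps'' 0 = e"
    "input n d \<epsilon> ''reject'' = (\<lambda>i. 0)" "input n d \<epsilon> ''slot'' = (\<lambda>i. 0)"
    by (auto simp: input_def e_def)
  have "bounded_store b (input n d \<epsilon>)"
    using bnd(4-6) unfolding bounded_store_def input_def b_def[symmetric] by (simp add: e_def)
  from program_steps[OF this inp bnd(1,2)[folded b_def] b0 nd(1)] obtain N f \<tau> where
    st: "steps answer N ([program], input n d \<epsilon>, 0) =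
      map_pmf (\<lambda>\<omega>. ([], f \<omega>, \<tau> \<omega>)) (replicate_pmf (trials * block) sample)"
    and run: "\<And>\<omega>. \<omega> \<in> set_pmf (replicate_pmf (trials * block) sample) \<Longrightarrow>
       run_inv \<omega> trials (f \<omega>) \<and> \<tau> \<omega> \<le> total_cost * (com_weight program * b)" by blast
  let ?D = "replicate_pmf (trials * block) sample"
  note out = tester_output_eq[OF st]

  have time: "runs_in_time program (neighbour n adj) (input n d \<epsilon>) (sqrt (real n) * poly time_poly x)"
  proof (rule runs_in_time_eq[OF st])
    fix \<omega> assume "\<omega> \<in> set_pmf ?D"
    then have "\<tau> \<omega> \<le> total_cost * (com_weight program * b)" using run by blast
    also have "\<dots> \<le> (sq * w ^ 115) * (com_weight program * w ^ 3)"
    proof (intro mult_le_mono bnd(3) mult_le_mono2)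
      have "200 * w \<le> w * w" using ww(3) by (intro mult_le_mono1) simp
      then have "b \<le> 2 * (w * w)" by (simp add: b_def)
      also have "\<dots> \<le> w * (w * w)" using ww(3) by (intro mult_le_mono1) simp
      finally show "b \<le> w ^ 3" by (simp add: power3_eq_cube)
    qed simp
    also have "\<dots> = com_weight program * sq * w ^ 118" by (simp add: power_add[symmetric])
    finally have "real (\<tau> \<omega>) \<le> real (com_weight program * sq * w ^ 118)" by (simp only: of_nat_le_iff)
    also have "\<dots> = real (com_weight program) * real sq * real w ^ 118" by simp
    also have "\<dots> \<le> real (com_weight program) * (2 * sqrt (real n)) * (12288 * x) ^ 118"
      using sqn ww(2) by (intro mult_mono power_mono mult_nonneg_nonneg) auto
    also have "\<dots> = sqrt (real n) * (real (com_weight program) * 2 * 12288 ^ 118 * x ^ 118)"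
      by (simp only: power_mult_distrib) (simp only: ac_simps)
    also have "\<dots> \<le> sqrt (real n) * poly time_poly x"
      unfolding time_poly_def by (intro mult_left_mono) (simp_all add: poly_monom)
    finally show "real (\<tau> \<omega>) \<le> sqrt (real n) * poly time_poly x" .
  qed

  have far: "measure_pmf.prob (tester_output program n d \<epsilon> adj) (range Reject) \<ge> 2 / 3"
    if far: "far_from_forest n d \<epsilon> E"
  proof -
    have ef: "1 / real e \<le> \<epsilon>" using e \<epsilon> by (simp add: field_simps)
    \<comment> \<open>Acceptance means that the flag is unset, which by \<open>run_inv\<close>
      happens only if all trials are silent.\<close>
    have "measure_pmf.prob ?D ((\<lambda>\<omega>. verdict (f \<omega>)) -` {Accept})
        \<le> measure_pmf.prob ?D {xs. \<forall>t<trials. trial_silent (take block (drop (t * block) xs))}"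
    proof (rule measure_pmf.finite_measure_mono_AE)
      show "AE \<omega> in ?D. \<omega> \<in> (\<lambda>\<omega>. verdict (f \<omega>)) -` {Accept} \<longrightarrow>
          \<omega> \<in> {xs. \<forall>t<trials. trial_silent (take block (drop (t * block) xs))}"
        using run unfolding AE_measure_pmf_iff by (auto simp: verdict_Accept run_inv_def chunk_def)
    qed simp
    also have "\<dots> \<le> 1 / 3" by (rule prob_all_silent[OF far ef])
    finally have "measure_pmf.prob (tester_output program n d \<epsilon> adj) {Accept} \<le> 1 / 3" by (simp add: out)
    moreover have "range Reject = - {Accept}" by (auto intro: verdict.exhaust)
    then have "measure_pmf.prob (tester_output program n d \<epsilon> adj) (range Reject)
        = 1 - measure_pmf.prob (tester_output program n d \<epsilon> adj) {Accept}"
      using measure_pmf.prob_compl[of "{Accept}" "tester_output program n d \<epsilon> adj"] by (simp add: Compl_eq_Diff_UNIV)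
    ultimately show ?thesis by simp
  qed

  have cert: "is_cycle E c \<and> real (length c) \<le> poly length_poly y"
    if c: "Reject c \<in> set_pmf (tester_output program n d \<epsilon> adj)" for c
  proof -
    obtain \<omega> where \<omega>: "\<omega> \<in> set_pmf ?D" "verdict (f \<omega>) = Reject c" using c unfolding out by auto
    then have "certified (2 * len + 3) (f \<omega>)" using run by (simp add: run_inv_def)
    then have cyc: "is_cycle E c" "length c \<le> 2 * len + 3"
      using \<omega>(2) unfolding verdict_Reject certified_def by auto
    \<comment> \<open>The summands 6, \<open>e\<close> and \<open>lg\<close> are at most
      \<open>6 * y\<close>, \<open>2 * y\<close> and \<open>2 * y\<close>.\<close>
    have "real lightness \<le> 10 * y" using ey lgy y1 by (simp add: lightness_def)
    then have "4 * real e * real lightness \<le> 4 * (2 * y) * (10 * y)"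
      using ey y1 by (intro mult_mono) auto
    then have "real len \<le> 80 * y\<^sup>2" by (simp add: len_def power2_eq_square)
    moreover have "1 \<le> y\<^sup>2" using y1 by simp
    moreover have "real (length c) \<le> 2 * real len + 3" using cyc(2) by linarith
    ultimately have "real (length c) \<le> 163 * y\<^sup>2" by linarith
    then show ?thesis using cyc by (simp add: length_poly_def poly_monom)
  qed
  show ?thesis using time far cert by blast
qed

theorem theorem1:
  shows "\<exists>(P :: com) (p :: real poly) (q :: real poly).
    \<forall>(n :: nat) (d :: nat) (\<epsilon> :: real) (E :: nat set set) (adj :: nat \<Rightarrow> nat list).
      n \<ge> 1 \<and> 0 < \<epsilon> \<and> \<epsilon> < 1 \<and>
      simple_graph n E \<and> (\<forall>v\<in>{1..n}. vertex_degree E v \<le> d) \<and> adjacency_lists n E adj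
      \<longrightarrow>
      runs_in_time P (neighbour n adj) (input n d \<epsilon>)
        (sqrt (real n) * poly p (real d * (1 / \<epsilon>) * log 2 (real n))) \<and>
      (forest E \<longrightarrow> measure_pmf.prob (tester_output P n d \<epsilon> adj) {Accept} = 1) \<and>
      (far_from_forest n d \<epsilon> E \<longrightarrow>
        measure_pmf.prob (tester_output P n d \<epsilon> adj) (range Reject) \<ge> 2 / 3) \<and>
      (\<forall>c. Reject c \<in> set_pmf (tester_output P n d \<epsilon> adj) \<longrightarrow>
        is_cycle E c \<and> real (length c) \<le> poly q ((1 / \<epsilon>) * log 2 (real n)))"
proof (rule exI[of _ program], rule exI[of _ time_poly], rule exI[of _ length_poly], intro allI impI)
  fix n d :: nat and \<epsilon> :: real and E :: "nat set set" and adj :: "nat \<Rightarrow> nat list"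
  let ?x = "real d * (1 / \<epsilon>) * log 2 (real n)"
  let ?out = "tester_output program n d \<epsilon> adj"
  assume asm: "n \<ge> 1 \<and> 0 < \<epsilon> \<and> \<epsilon> < 1 \<and>
      simple_graph n E \<and> (\<forall>v\<in>{1..n}. vertex_degree E v \<le> d) \<and> adjacency_lists n E adj"
  then have G: "adjacency_graph n d adj E" by (simp add: adjacency_graph_def)
  have "runs_in_time program (neighbour n adj) (input n d \<epsilon>) (sqrt (real n) * poly time_poly ?x) \<and>
    (far_from_forest n d \<epsilon> E \<longrightarrow> measure_pmf.prob ?out (range Reject) \<ge> 2 / 3) \<and>
    (\<forall>c. Reject c \<in> set_pmf ?out \<longrightarrow>
        is_cycle E c \<and> real (length c) \<le> poly length_poly ((1 / \<epsilon>) * log 2 (real n)))"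
  proof (cases "1 < n \<and> 0 < d")
    case True
    then show ?thesis using main_case[OF G] asm by blast
  next
    case False
    then have triv: "\<not> 1 < n \<or> d = 0" by simp
    from trivial_steps[OF triv] asm obtain N \<tau> where
      st: "steps (neighbour n adj) N ([program], input n d \<epsilon>, 0) = map_pmf (\<lambda>_. ([], input n d \<epsilon>, \<tau>)) (return_pmf ())"
      and \<tau>: "real \<tau> \<le> 20 * sqrt (real n)" by blast
    have "0 \<le> ?x" using asm by simp
    then have "20 \<le> poly time_poly ?x" by (simp add: time_poly_def poly_monom)
    then have "20 * sqrt (real n) \<le> sqrt (real n) * poly time_poly ?x"
      by (subst mult.commute) (intro mult_left_mono, auto)
    then have "runs_in_time program (neighbour n adj) (input n d \<epsilon>) (sqrt (real n) * poly time_poly ?x)"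
      using \<tau> by (intro runs_in_time_eq[OF st]) simp
    moreover have "?out = return_pmf Accept"
      unfolding tester_output_eq[OF st] by (simp add: verdict_def input_def)
    ultimately show ?thesis using trivial_not_far[OF G triv] asm by simp
  qed
  then show "runs_in_time program (neighbour n adj) (input n d \<epsilon>) (sqrt (real n) * poly time_poly ?x) \<and>
      (forest E \<longrightarrow> measure_pmf.prob ?out {Accept} = 1) \<and>
      (far_from_forest n d \<epsilon> E \<longrightarrow> measure_pmf.prob ?out (range Reject) \<ge> 2 / 3) \<and>
      (\<forall>c. Reject c \<in> set_pmf ?out \<longrightarrow>
        is_cycle E c \<and> real (length c) \<le> poly length_poly ((1 / \<epsilon>) * log 2 (real n)))"
    using accepts_forest by blast
qed

end
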